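(* Let $\tau:[0,1]\to[0,1]$ be a piecewise convex map with countably many branches (in the class described in the context), let $\{\tau_n\}_{n\ge 1}$ be its approximating sequence of piecewise convex maps with finitely many branches, and for $n,k\ge 1$ let $P_{\tau_n}^{(k)}$ be the Ulam operators approximating $P_{\tau_n}$. For each $n,k\ge 1$ let $f_{n,k}$ be the normalized (in $L^1$) fixed point of $P_{\tau_n}^{(k)}$. Then the family $\{f_{n,k}\}_{n\ge 1,\,k\ge 1}$ is relatively weakly compact in $L^1([0,1],\lambda)$ and uniformly bounded in $L^\infty$. Moreover, if $\{f_{n_j,k_j}\}_{j\ge 1}$, with $n_j\to\infty$ and $k_j\to\infty$, is weakly convergent in $L^1$, then it converges in $L^1$ and almost everywhere to a function $f$ which is a fixed point of $P_\tau$, i.e. $P_\tau f=f$.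
   Context: $I=[0,1]$, $\lambda$ is Lebesgue measure, $L^1=L^1([0,1],\lambda)$. The map $\tau$: there are points $1=a_0>a_1>a_2>\cdots$ with $\lim_{n\to\infty}a_n=0$ such that $\tau:[0,1]\to[0,1]$ satisfies: (i) for every $j\ge 1$, $\tau|_{[a_j,a_{j-1})}$ is continuous and convex; (ii) $\tau(a_j)=0$ and $\tau'(a_j)>0$ for every $j\ge1$, where $\tau'(a_j)$ is the right derivative; (iii) $\sum_{j\ge 1}\frac{1}{\tau'(a_j)}<\infty$ (equivalently, there is $N\ge1$ with $\sum_{j\ge N+1}\frac1{\tau'(a_j)}<1$). Approximating maps: for $n\ge 1$, $\tau_n(x)=x/a_n$ for $0\le x<a_n$ and $\tau_n(x)=\tau(x)$ for $a_n\le x\le 1$. For a nonsingular measurable $T:[0,1]\to[0,1]$, the Frobenius–Perron operator $P_T:L^1\to L^1$ is defined by $\int_A P_Tf\,d\lambda=\int_{T^{-1}(A)}f\,d\lambda$ for all Lebesgue measurable $A$ and $f\in L^1$. Ulam operators: for $k\ge1$ let $J_1,\dots,J_k$ be the partition of $[0,1]$ into $k$ equal subintervals, $L^{(k)}\subset L^1$ the subspace of functions constant on each $J_i$ (identified with row vectors $[f_1,\dots,f_k]$, $f=\sum_i f_i\chi_{J_i}$), and $Q^{(k)}f=\sum_{i=1}^k\left(\frac1{\lambda(J_i)}\int_{J_i}f\,d\lambda\right)\chi_{J_i}$. The operator $P_{\tau_n}^{(k)}:L^{(k)}\to L^{(k)}$ is $P_{\tau_n}^{(k)}f=Q^{(k)}P_{\tau_n}f$;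 equivalently it sends the row vector $[f_1,\dots,f_k]$ to $[f_1,\dots,f_k]\cdot\mathbb M_n^{(k)}$ with $\mathbb M_n^{(k)}=\left(\frac{\lambda(\tau_n^{-1}(J_j)\cap J_i)}{\lambda(J_i)}\right)_{1\le i,j\le k}$. The normalized fixed point $f_{n,k}$ of $P_{\tau_n}^{(k)}$ is its invariant density: $f_{n,k}\in L^{(k)}$, $f_{n,k}\ge0$, $\int_0^1 f_{n,k}\,d\lambda=1$, $P_{\tau_n}^{(k)}f_{n,k}=f_{n,k}$ (it is unique). *)

theory Defs
  imports "HOL-Analysis.Analysis"
begin

text \<open>
  Elements of \<open>L\<^sup>1([0,1])\<close> are represented by integrable functions on \<open>[0,1]\<close> equipped with
  Lebesgue measure (on the Lebesgue, i.e. completed, sigma-algebra); equality in \<open>L\<^sup>1\<close> is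
  equality almost everywhere.
\<close>

abbreviation unit_leb :: "real measure" where
  "unit_leb \<equiv> lebesgue_on {0..1}"

definition L1 :: "(real \<Rightarrow> real) set" where
  "L1 = {f. integrable unit_leb f}"

definition L1_norm :: "(real \<Rightarrow> real) \<Rightarrow> real" where
  "L1_norm f = (LINT x|unit_leb. \<bar>f x\<bar>)"


subsection \<open>The weak topology of \<open>L\<^sup>1\<close>\<close>

text \<open>
  Bounded linear functionals on \<open>L\<^sup>1\<close>. Boundedness with respect to the seminorm \<^const>\<open>L1_norm\<close>
  forces \<open>\<phi>\<close> to take equal values on functions that agree almost everywhere. The topologies below
  are therefore the preimages of the usual ones under the quotient map identifying such functions,
  and compactness, closures and limits have their usual meaning.
\<close>

definition L1_dual :: "((real \<Rightarrow> real) \<Rightarrow> real) set" where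
  "L1_dual = {\<phi>.
     (\<forall>f\<in>L1. \<forall>g\<in>L1. \<phi> (\<lambda>x. f x + g x) = \<phi> f + \<phi> g) \<and>
     (\<forall>c. \<forall>f\<in>L1. \<phi> (\<lambda>x. c * f x) = c * \<phi> f) \<and>
     (\<exists>C. \<forall>f\<in>L1. \<bar>\<phi> f\<bar> \<le> C * L1_norm f)}"

definition weak_L1 :: "(real \<Rightarrow> real) topology" where
  "weak_L1 = topology_generated_by {{f \<in> L1. \<phi> f \<in> U} | \<phi> U. \<phi> \<in> L1_dual \<and> open U}"

lemma topspace_weak_L1 [simp]: "topspace weak_L1 = L1"
proof -
  have "(\<lambda>_. 0) \<in> L1_dual"
    unfolding L1_dual_def by (auto intro: exI[of _ 0])
  then have "L1 \<in> {{f \<in> L1. \<phi> f \<in> U} | \<phi> U. \<phi> \<in> L1_dual \<and> open U}"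
    by (auto intro!: exI[of _ "\<lambda>_. 0"] exI[of _ UNIV])
  then show ?thesis
    unfolding weak_L1_def topology_generated_by_topspace by blast
qed

definition relatively_weakly_compact :: "(real \<Rightarrow> real) set \<Rightarrow> bool" where
  "relatively_weakly_compact F \<longleftrightarrow> F \<subseteq> L1 \<and> compactin weak_L1 (weak_L1 closure_of F)"


subsection \<open>Piecewise convex maps with countably many branches\<close>

text \<open>
  The number \<open>d j\<close> is the right derivative of \<open>\<tau>\<close> at \<open>a j\<close>. Values of \<open>\<tau>\<close> outside \<open>[0,1]\<close> are
  irrelevant.
\<close>

definition piecewise_convex_map :: "(real \<Rightarrow> real) \<Rightarrow> (nat \<Rightarrow> real) \<Rightarrow> bool" where
  "piecewise_convex_map \<tau> a \<longleftrightarrow>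
     a 0 = 1 \<and> (\<forall>j. a (Suc j) < a j) \<and> a \<longlonglongrightarrow> 0 \<and>
     (\<forall>x\<in>{0..1}. \<tau> x \<in> {0..1}) \<and>
     (\<forall>j\<ge>1. continuous_on {a j..<a (j - 1)} \<tau> \<and> convex_on {a j..<a (j - 1)} \<tau>) \<and>
     (\<forall>j\<ge>1. \<tau> (a j) = 0) \<and>
     (\<exists>d. (\<forall>j\<ge>1. (\<tau> has_real_derivative d j) (at_right (a j)) \<and> 0 < d j) \<and>
          summable (\<lambda>j. 1 / d (Suc j)))"

definition approx_map :: "(real \<Rightarrow> real) \<Rightarrow> (nat \<Rightarrow> real) \<Rightarrow> nat \<Rightarrow> real \<Rightarrow> real" where
  "approx_map \<tau> a n x = (if x < a n then x / a n else \<tau> x)"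


subsection \<open>Frobenius--Perron and Ulam operators\<close>

definition nonsingular_map :: "(real \<Rightarrow> real) \<Rightarrow> bool" where
  "nonsingular_map T \<longleftrightarrow> T \<in> measurable unit_leb unit_leb \<and>
     (\<forall>A\<in>null_sets unit_leb. T -` A \<inter> {0..1} \<in> null_sets unit_leb)"

definition is_frobenius_perron_image ::
    "(real \<Rightarrow> real) \<Rightarrow> (real \<Rightarrow> real) \<Rightarrow> (real \<Rightarrow> real) \<Rightarrow> bool" where
  "is_frobenius_perron_image T f g \<longleftrightarrow> g \<in> L1 \<and>
     (\<forall>A\<in>sets unit_leb. (LINT x:A|unit_leb. g x) = (LINT x:(T -` A \<inter> {0..1})|unit_leb. f x))"

text \<open>
  The choice below picks a version of \<open>P\<^sub>T f\<close>. The lemmas that follow show that for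
  nonsingular \<open>T\<close> and \<open>f \<in> L\<^sup>1\<close> a version exists and is unique almost everywhere.
\<close>

definition frobenius_perron :: "(real \<Rightarrow> real) \<Rightarrow> (real \<Rightarrow> real) \<Rightarrow> (real \<Rightarrow> real)" where
  "frobenius_perron T f = (SOME g. is_frobenius_perron_image T f g)"

lemma is_frobenius_perron_image_unique:
  assumes "is_frobenius_perron_image T f g" "is_frobenius_perron_image T f h"
  shows "AE x in unit_leb. g x = h x"
  using assms unfolding is_frobenius_perron_image_def L1_def
  by (intro density_unique_real) auto

lemma is_frobenius_perron_image_nonneg_exists:
  assumes T: "nonsingular_map T" and f: "integrable unit_leb f" and f0: "\<And>x. 0 \<le> f x"
  shows "\<exists>g. is_frobenius_perron_image T f g"
proof -
  interpret I: finite_measure unit_leb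
    by (rule finite_measure_lebesgue_on) auto
  have Tm [measurable]: "T \<in> measurable unit_leb unit_leb"
    using T by (simp add: nonsingular_map_def)
  have fm [measurable]: "f \<in> borel_measurable unit_leb"
    using f by simp
  define N where "N = distr (density unit_leb (\<lambda>x. ennreal (f x))) unit_leb T"
  have N: "emeasure N A = (\<integral>\<^sup>+x. ennreal (f x) * indicator (T -` A \<inter> {0..1}) x \<partial>unit_leb)"
    if A: "A \<in> sets unit_leb" for A
  proof -
    have "T -` A \<inter> space unit_leb \<in> sets unit_leb"
      using A by (rule measurable_sets[OF Tm])
    then show ?thesis
      unfolding N_def using A by (subst emeasure_distr) (auto simp: emeasure_density)
  qed
  have ac: "absolutely_continuous unit_leb N"
    unfolding absolutely_continuous_def
  proof
    fix A assume A: "A \<in> null_sets unit_leb"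
    have nul: "T -` A \<inter> {0..1} \<in> null_sets unit_leb"
      using A T by (auto simp: nonsingular_map_def)
    have "AE x in unit_leb. ennreal (f x) * indicator (T -` A \<inter> {0..1}) x = 0"
      using AE_not_in[OF nul] by eventually_elim auto
    then have "(\<integral>\<^sup>+x. ennreal (f x) * indicator (T -` A \<inter> {0..1}) x \<partial>unit_leb) = (\<integral>\<^sup>+x. 0 \<partial>unit_leb)"
      by (rule nn_integral_cong_AE)
    then show "A \<in> null_sets N"
      using A N[of A] by (auto simp: null_sets_def N_def)
  qed
  have sN: "sets N = sets unit_leb"
    by (simp add: N_def)
  obtain h where h [measurable]: "h \<in> borel_measurable unit_leb" and hN: "density unit_leb h = N"
    using I.Radon_Nikodym[OF ac sN] by blast
  have hA: "(\<integral>\<^sup>+x. h x * indicator A x \<partial>unit_leb)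
      = (\<integral>\<^sup>+x. ennreal (f x) * indicator (T -` A \<inter> {0..1}) x \<partial>unit_leb)"
    if "A \<in> sets unit_leb" for A
    using N[OF that] emeasure_density[OF h that] hN by simp
  have "(\<integral>\<^sup>+x. h x \<partial>unit_leb) = (\<integral>\<^sup>+x. h x * indicator {0..1} x \<partial>unit_leb)"
    by (intro nn_integral_cong) auto
  also have "\<dots> = (\<integral>\<^sup>+x. ennreal (f x) * indicator (T -` {0..1} \<inter> {0..1}) x \<partial>unit_leb)"
    using hA[of "{0..1}"] sets.top[of unit_leb] by simp
  also have "\<dots> \<le> (\<integral>\<^sup>+x. ennreal (f x) \<partial>unit_leb)"
    by (intro nn_integral_mono) (auto simp: indicator_def)
  also have "\<dots> < \<infinity>"
    using f f0 by (simp add: nn_integral_eq_integral)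
  finally have fin: "(\<integral>\<^sup>+x. h x \<partial>unit_leb) < \<infinity>" .
  have AEh: "AE x in unit_leb. h x \<noteq> \<infinity>"
    using fin by (intro nn_integral_PInf_AE) auto
  define g where "g = (\<lambda>x. enn2real (h x))"
  have gm [measurable]: "g \<in> borel_measurable unit_leb"
    unfolding g_def by measurable
  have gh: "AE x in unit_leb. ennreal (g x) = h x"
    using AEh by eventually_elim (auto simp: g_def ennreal_enn2real_if)
  have "(\<integral>\<^sup>+x. ennreal (g x) \<partial>unit_leb) = (\<integral>\<^sup>+x. h x \<partial>unit_leb)"
    by (rule nn_integral_cong_AE[OF gh])
  then have gi: "integrable unit_leb g"
    using fin by (intro integrableI_nonneg) (auto simp: g_def)
  have "(LINT x:A|unit_leb. g x) = (LINT x:(T -` A \<inter> {0..1})|unit_leb. f x)"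
    if A: "A \<in> sets unit_leb" for A
  proof -
    have B [measurable]: "T -` A \<inter> {0..1} \<in> sets unit_leb"
      using measurable_sets[OF Tm A] by simp
    have Am [measurable]: "A \<in> sets unit_leb" by fact
    have "(LINT x:A|unit_leb. g x) = enn2real (\<integral>\<^sup>+x. ennreal (indicator A x *\<^sub>R g x) \<partial>unit_leb)"
      unfolding set_lebesgue_integral_def
      by (intro integral_eq_nn_integral) (auto simp: g_def)
    also have "(\<integral>\<^sup>+x. ennreal (indicator A x *\<^sub>R g x) \<partial>unit_leb) = (\<integral>\<^sup>+x. h x * indicator A x \<partial>unit_leb)"
      using gh by (intro nn_integral_cong_AE) (auto elim!: eventually_mono simp: indicator_def)
    also have "\<dots> = (\<integral>\<^sup>+x. ennreal (indicator (T -` A \<inter> {0..1}) x *\<^sub>R f x) \<partial>unit_leb)"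
      unfolding hA[OF A] by (intro nn_integral_cong) (auto simp: indicator_def)
    also have "enn2real \<dots> = (LINT x:(T -` A \<inter> {0..1})|unit_leb. f x)"
      unfolding set_lebesgue_integral_def
      by (intro integral_eq_nn_integral[symmetric]) (auto simp: f0)
    finally show ?thesis .
  qed
  then have "is_frobenius_perron_image T f g"
    using gi by (simp add: is_frobenius_perron_image_def L1_def)
  then show ?thesis
    by (intro exI[of _ g])
qed

lemma is_frobenius_perron_image_frobenius_perron:
  assumes T: "nonsingular_map T" and f: "f \<in> L1"
  shows "is_frobenius_perron_image T f (frobenius_perron T f)"
proof -
  have fi: "integrable unit_leb f"
    using f by (simp add: L1_def)
  define p where "p = (\<lambda>x. max 0 (f x))"
  define m where "m = (\<lambda>x. max 0 (- f x))"
  have pi: "integrable unit_leb p" and mi: "integrable unit_leb m"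
    unfolding p_def m_def using fi by auto
  obtain g where g: "is_frobenius_perron_image T p g"
    using is_frobenius_perron_image_nonneg_exists[OF T pi] by (auto simp: p_def)
  obtain h where h: "is_frobenius_perron_image T m h"
    using is_frobenius_perron_image_nonneg_exists[OF T mi] by (auto simp: m_def)
  have f_eq: "f = (\<lambda>x. p x - m x)"
    by (auto simp: p_def m_def)
  have "is_frobenius_perron_image T f (\<lambda>x. g x - h x)"
    unfolding is_frobenius_perron_image_def
  proof (intro conjI ballI)
    show "(\<lambda>x. g x - h x) \<in> L1"
      using g h by (simp add: is_frobenius_perron_image_def L1_def)
    fix A assume A: "A \<in> sets unit_leb"
    have B: "T -` A \<inter> {0..1} \<in> sets unit_leb"
      using T measurable_sets[of T unit_leb unit_leb A] A by (simp add: nonsingular_map_def)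
    have si: "set_integrable unit_leb C u"
      if "C \<in> sets unit_leb" "integrable unit_leb u" for C and u :: "real \<Rightarrow> real"
      using that unfolding set_integrable_def by (rule integrable_mult_indicator)
    have "(LINT x:A|unit_leb. g x - h x) = (LINT x:A|unit_leb. g x) - (LINT x:A|unit_leb. h x)"
      using g h A by (intro set_integral_diff si) (auto simp: is_frobenius_perron_image_def L1_def)
    also have "\<dots> = (LINT x:(T -` A \<inter> {0..1})|unit_leb. p x) - (LINT x:(T -` A \<inter> {0..1})|unit_leb. m x)"
      using g h A by (simp add: is_frobenius_perron_image_def)
    also have "\<dots> = (LINT x:(T -` A \<inter> {0..1})|unit_leb. f x)"
      unfolding f_eq using B pi mi by (intro set_integral_diff(2)[symmetric] si) auto
    finally show "(LINT x:A|unit_leb. g x - h x) = (LINT x:(T -` A \<inter> {0..1})|unit_leb. f x)" .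
  qed
  then show ?thesis
    unfolding frobenius_perron_def by (rule someI[of "is_frobenius_perron_image T f"])
qed

text \<open>The cells \<open>J\<^sub>1, \<dots>, J\<^sub>k\<close>; the last one contains the endpoint \<open>1\<close>.\<close>

definition ulam_cell :: "nat \<Rightarrow> nat \<Rightarrow> real set" where
  "ulam_cell k i =
     (if i = k then {(real i - 1) / real k..1} else {(real i - 1) / real k..<real i / real k})"

definition ulam_space :: "nat \<Rightarrow> (real \<Rightarrow> real) set" where
  "ulam_space k = {f \<in> L1. \<exists>c. AE x in unit_leb. f x = (\<Sum>i=1..k. c i * indicator (ulam_cell k i) x)}"

definition ulam_projection :: "nat \<Rightarrow> (real \<Rightarrow> real) \<Rightarrow> (real \<Rightarrow> real)" where
  "ulam_projection k f = (\<lambda>x. \<Sum>i=1..k.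
     (1 / measure unit_leb (ulam_cell k i)) * (LINT y:ulam_cell k i|unit_leb. f y) *
     indicator (ulam_cell k i) x)"

definition ulam_operator :: "(real \<Rightarrow> real) \<Rightarrow> nat \<Rightarrow> (real \<Rightarrow> real) \<Rightarrow> (real \<Rightarrow> real)" where
  "ulam_operator T k f = ulam_projection k (frobenius_perron T f)"

definition ulam_invariant_density :: "(real \<Rightarrow> real) \<Rightarrow> nat \<Rightarrow> (real \<Rightarrow> real) \<Rightarrow> bool" where
  "ulam_invariant_density T k f \<longleftrightarrow>
     f \<in> ulam_space k \<and> (AE x in unit_leb. 0 \<le> f x) \<and> (LINT x|unit_leb. f x) = 1 \<and>
     (AE x in unit_leb. ulam_operator T k f x = f x)"

end

theory Submission
  imports Defs
begin

text \<open>
  The Frobenius--Perron operator of a piecewise convex map and the averaging over equal cells both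
  preserve decreasing densities. Since every branch strictly expands \<open>dx / (x + e)\<close> for small \<open>e\<close>,
  every forward invariant union of cells contains the first cell; hence invariant densities are
  unique, and \<open>f\<^bsub>n,k\<^esub>\<close> is decreasing. Its value at \<open>0\<close> is at most the sum over the branches of its
  value at the left endpoint divided by the slope there. Far branches contribute only a fraction
  of the value at \<open>0\<close>, and the others are controlled by \<open>f\<^bsub>n,k\<^esub>(a\<^sub>j) \<le> 1 / a\<^sub>j\<close>. So all densities are
  decreasing with values in one interval \<open>[0, B]\<close>. These functions form a compact set, and weak
  convergence within it forces convergence at every continuity point of the limit. Comparing the
  integrals over \<open>[0, y)\<close> and over its preimage shows that the limit is invariant.
\<close>

subsection \<open>Fixed vectors of stochastic matrices\<close>

text \<open>That an operator preserves decreasing functions gives only some decreasing fixed vector,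
  while \<open>f\<close> is an arbitrary one; uniqueness is what transfers the property to it. The
  obstacle to uniqueness is that finitely many branches may have slopes below 1, so Euclidean length
  need not grow. Convexity and the value 0 at the left end \<alpha> make T(x) / (x - \<alpha>)
  increase along a branch, hence lengths in dx / x do not shrink. The linear branch x / a_n is an
  isometry of dx / x, and the shift by e cures exactly this. Uniformity in k comes from reading the
  value at 0 as a mean over the first cell, whose length cancels. The topology
  \<open>weak_L1\<close> lives on functions instead of classes and is not Hausdorff. Compact sets
  are therefore replaced by their saturations under inseparability. Compactness itself rests on the
  fact that finitely many point values of a decreasing function with values in [0, B] determine it
  up to a small error in the L1 norm.\<close>

lemma abs_fixed_vector_weighted_stochastic:
  fixes M :: "'a \<Rightarrow> 'a \<Rightarrow> real" and p z :: "'a \<Rightarrow> real"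
  assumes I: "finite I"
    and M: "\<And>i j. i \<in> I \<Longrightarrow> j \<in> I \<Longrightarrow> 0 \<le> M i j"
    and p: "\<And>j. j \<in> I \<Longrightarrow> 0 < p j"
    and Mp: "\<And>i. i \<in> I \<Longrightarrow> (\<Sum>j\<in>I. M i j * p j) = p i"
    and z: "\<And>j. j \<in> I \<Longrightarrow> z j = (\<Sum>i\<in>I. z i * M i j)"
    and j: "j \<in> I"
  shows "\<bar>z j\<bar> = (\<Sum>i\<in>I. \<bar>z i\<bar> * M i j)"
proof -
  have le: "\<bar>z j\<bar> \<le> (\<Sum>i\<in>I. \<bar>z i\<bar> * M i j)" if "j \<in> I" for j
  proof -
    have "\<bar>z j\<bar> \<le> (\<Sum>i\<in>I. \<bar>z i * M i j\<bar>)"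
      by (subst z[OF that]) (rule sum_abs)
    also have "\<dots> = (\<Sum>i\<in>I. \<bar>z i\<bar> * M i j)"
      using M that by (intro sum.cong) (auto simp: abs_mult)
    finally show ?thesis .
  qed
  \<comment> \<open>The triangle inequality makes each deficit nonnegative. Pairing with the right
    eigenvector \<open>p\<close> shows that \<open>M\<close> preserves the weighted total of the
    absolute values, so the deficits sum to 0 and all vanish.\<close>
  define e where "e j = ((\<Sum>i\<in>I. \<bar>z i\<bar> * M i j) - \<bar>z j\<bar>) * p j" for j
  have "(\<Sum>j\<in>I. (\<Sum>i\<in>I. \<bar>z i\<bar> * M i j) * p j) = (\<Sum>i\<in>I. \<bar>z i\<bar> * (\<Sum>j\<in>I. M i j * p j))"
    unfolding sum_distrib_left sum_distrib_right by (subst sum.swap) (simp add: mult.assoc)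
  also have "\<dots> = (\<Sum>i\<in>I. \<bar>z i\<bar> * p i)"
    using Mp by simp
  finally have "sum e I = 0"
    by (simp add: e_def left_diff_distrib sum_subtractf)
  moreover have "0 \<le> e j" if "j \<in> I" for j
    using le[OF that] p[OF that] by (simp add: e_def)
  ultimately have "e j = 0"
    using I j by (simp add: sum_nonneg_eq_0_iff)
  then show ?thesis
    using p[OF j] by (simp add: e_def)
qed

lemma sum_ge_telescope:
  fixes v :: "nat \<Rightarrow> real"
  assumes "i \<le> k" "v (Suc k) = 0"
  shows "(\<Sum>m\<in>{i..k}. v m - v (Suc m)) = v i"
proof -
  have "(\<Sum>m\<in>{i..k}. v (Suc m) - v m) = v (Suc k) - v i"
    by (rule sum_Suc_diff) (use assms in simp)
  then show ?thesis
    using assms by (simp add: sum_subtractf)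
qed

text \<open>
  In the basis of indicators of initial segments \<open>{1..m}\<close> the matrix stays nonnegative, so the
  entrywise absolute value of the coordinates of \<open>v\<close> yields a decreasing fixed vector; it
  is a multiple of \<open>v\<close> because fixed vectors are determined by their first entry.
\<close>

lemma fixed_vector_decreasing:
  fixes M :: "nat \<Rightarrow> nat \<Rightarrow> real" and v :: "nat \<Rightarrow> real"
  assumes M: "\<And>i j. i \<in> {1..k} \<Longrightarrow> j \<in> {1..k} \<Longrightarrow> 0 \<le> M i j"
    and M1: "\<And>i. i \<in> {1..k} \<Longrightarrow> (\<Sum>j\<in>{1..k}. M i j) = 1"
    and dec: "\<And>m j. m \<in> {1..k} \<Longrightarrow> 1 \<le> j \<Longrightarrow> j < k \<Longrightarrow> (\<Sum>i\<in>{1..m}. M i (Suc j)) \<le> (\<Sum>i\<in>{1..m}. M i j)"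
    and unique: "\<And>u. (\<And>j. j \<in> {1..k} \<Longrightarrow> 0 \<le> u j) \<Longrightarrow>
        (\<And>j. j \<in> {1..k} \<Longrightarrow> u j = (\<Sum>i\<in>{1..k}. u i * M i j)) \<Longrightarrow> u 1 = 0 \<Longrightarrow>
        (\<And>j. j \<in> {1..k} \<Longrightarrow> u j = 0)"
    and v0: "\<And>j. j \<in> {1..k} \<Longrightarrow> 0 \<le> v j"
    and v: "\<And>j. j \<in> {1..k} \<Longrightarrow> v j = (\<Sum>i\<in>{1..k}. v i * M i j)"
    and j: "1 \<le> j" "j < k"
  shows "v (Suc j) \<le> v j"
proof -
  let ?K = "{1..k}"
  \<comment> \<open>Extension by 0 lets the telescoping sums end at \<open>k\<close>: the last
    difference \<open>w k\<close> is \<open>v k\<close> itself.\<close>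
  define V where "V j = (if j \<in> ?K then v j else 0)" for j
  \<comment> \<open>\<open>E m\<close> is the image of the indicator of {1..m}, \<open>w\<close>
    lists the coordinates of \<open>V\<close> in the basis of these indicators, and \<open>B\<close>
    is the matrix in that basis.\<close>
  define E where "E m j = (if j \<in> ?K then \<Sum>i\<in>{1..m}. M i j else 0)" for m j
  define w where "w m = V m - V (Suc m)" for m
  define B where "B m l = E m l - E m (Suc l)" for m l
  have swap: "(\<Sum>i\<in>?K. (\<Sum>m\<in>{i..k}. x m) * M i j) = (\<Sum>m\<in>?K. x m * E m j)"
    if "j \<in> ?K" for x :: "nat \<Rightarrow> real" and j
  proof -
    have "(\<Sum>i\<in>?K. (\<Sum>m\<in>{i..k}. x m) * M i j) = (\<Sum>i\<in>?K. \<Sum>m\<in>{m\<in>?K. i \<le> m}. x m * M i j)"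
      unfolding sum_distrib_right by (intro sum.cong) auto
    also have "\<dots> = (\<Sum>m\<in>?K. \<Sum>i\<in>{i\<in>?K. i \<le> m}. x m * M i j)"
      by (rule sum.swap_restrict) auto
    also have "\<dots> = (\<Sum>m\<in>?K. x m * E m j)"
      using that by (intro sum.cong) (auto simp: E_def sum_distrib_left intro!: sum.cong)
    finally show ?thesis .
  qed
  have V: "V j = (\<Sum>m\<in>{j..k}. w m)" if "j \<in> ?K" for j
    unfolding w_def by (subst sum_ge_telescope) (use that in \<open>auto simp: V_def\<close>)
  have VE: "V j = (\<Sum>m\<in>?K. w m * E m j)" for j
  proof (cases "j \<in> ?K")
    case True
    have "V j = (\<Sum>i\<in>?K. V i * M i j)"
      using True v[of j] by (simp add: V_def)
    also have "\<dots> = (\<Sum>i\<in>?K. (\<Sum>m\<in>{i..k}. w m) * M i j)"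
      using V by (intro sum.cong) auto
    finally show ?thesis
      using swap[OF True] by simp
  qed (auto simp: V_def E_def)
  have wB: "w l = (\<Sum>m\<in>?K. w m * B m l)" if "l \<in> ?K" for l
    unfolding B_def right_diff_distrib sum_subtractf VE[symmetric] by (simp add: w_def)
  have E0: "0 \<le> E m l" if "m \<in> ?K" for m l
    using that by (auto simp: E_def intro!: sum_nonneg M)
  have B0: "0 \<le> B m l" if "m \<in> ?K" "l \<in> ?K" for m l
  proof (cases "l = k")
    case True
    then show ?thesis using E0[OF that(1), of l] by (simp add: B_def E_def)
  next
    case False
    then show ?thesis using dec[of m l] that by (simp add: B_def E_def)
  qed
  have EB: "(\<Sum>l\<in>{i..k}. B m l) = E m i" if "i \<in> ?K" for m i
    unfolding B_def by (rule sum_ge_telescope) (use that in \<open>auto simp: E_def\<close>)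
  \<comment> \<open>The indicator of {1..l} has total mass l, and the stochastic matrix preserves
    total mass. Hence l is a positive right eigenvector of \<open>B\<close>, as the absolute value
    argument requires.\<close>
  have Bp: "(\<Sum>l\<in>?K. B m l * real l) = real m" if m: "m \<in> ?K" for m
  proof -
    have "(\<Sum>l\<in>?K. B m l * real l) = (\<Sum>l\<in>?K. \<Sum>i\<in>{i\<in>?K. i \<le> l}. B m l)"
    proof (intro sum.cong refl)
      fix l assume "l \<in> ?K"
      then have "{i\<in>?K. i \<le> l} = {1..l}" by auto
      then show "B m l * real l = (\<Sum>i\<in>{i\<in>?K. i \<le> l}. B m l)" by simp
    qed
    also have "\<dots> = (\<Sum>i\<in>?K. \<Sum>l\<in>{l\<in>?K. i \<le> l}. B m l)"
      by (rule sum.swap_restrict) auto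
    also have "\<dots> = (\<Sum>i\<in>?K. E m i)"
    proof (intro sum.cong refl)
      fix i assume i: "i \<in> ?K"
      then have "{l\<in>?K. i \<le> l} = {i..k}" by auto
      then show "(\<Sum>l\<in>{l\<in>?K. i \<le> l}. B m l) = E m i" using EB[OF i] by simp
    qed
    also have "\<dots> = (\<Sum>i\<in>?K. \<Sum>l\<in>{1..m}. M l i)"
      by (intro sum.cong) (auto simp: E_def)
    also have "\<dots> = (\<Sum>l\<in>{1..m}. \<Sum>i\<in>?K. M l i)"
      by (rule sum.swap)
    also have "\<dots> = (\<Sum>l\<in>{1..m}. 1)"
      using m by (intro sum.cong refl M1) auto
    finally show ?thesis by simp
  qed
  have aw: "\<bar>w l\<bar> = (\<Sum>m\<in>?K. \<bar>w m\<bar> * B m l)" if "l \<in> ?K" for l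
    by (rule abs_fixed_vector_weighted_stochastic[where p = real]) (use that B0 Bp wB in auto)
  \<comment> \<open>The vector with coordinates |w m|; it is decreasing because all its coordinates
    are nonnegative.\<close>
  define u where "u i = (\<Sum>m\<in>{i..k}. \<bar>w m\<bar>)" for i
  have u: "u j = (\<Sum>i\<in>?K. u i * M i j)" if j: "j \<in> ?K" for j
  proof -
    have "u j = (\<Sum>l\<in>{j..k}. \<Sum>m\<in>?K. \<bar>w m\<bar> * B m l)"
      unfolding u_def using aw j by (intro sum.cong) auto
    also have "\<dots> = (\<Sum>m\<in>?K. \<bar>w m\<bar> * E m j)"
      by (subst sum.swap) (simp add: sum_distrib_left[symmetric] EB[OF j])
    also have "\<dots> = (\<Sum>i\<in>?K. u i * M i j)"
      using swap[OF j, of "\<lambda>m. \<bar>w m\<bar>"] by (simp add: u_def)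
    finally show ?thesis .
  qed
  have u_dec: "u (Suc i) \<le> u i" for i
    unfolding u_def by (intro sum_mono2) auto
  have u0: "0 \<le> u i" for i
    unfolding u_def by (intro sum_nonneg) auto
  \<comment> \<open>The combination of \<open>u\<close> and \<open>v\<close> that vanishes at 1.
    Uniqueness speaks of nonnegative vectors, so it is applied to |z|, which is again fixed, now
    with the constant right eigenvector 1.\<close>
  define z where "z i = u 1 * v i - v 1 * u i" for i
  have z: "z j = (\<Sum>i\<in>?K. z i * M i j)" if "j \<in> ?K" for j
    using u[OF that] v[OF that]
    by (simp add: z_def left_diff_distrib sum_subtractf sum_distrib_left mult.assoc)
  have az: "\<bar>z j\<bar> = (\<Sum>i\<in>?K. \<bar>z i\<bar> * M i j)" if "j \<in> ?K" for j
    by (rule abs_fixed_vector_weighted_stochastic[where p = "\<lambda>_. 1"]) (use that M M1 z in auto)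
  have uv: "u 1 * v i = v 1 * u i" if i: "i \<in> ?K" for i
  proof -
    have "\<bar>z i\<bar> = 0"
      by (rule unique[OF _ az _ i]) (simp_all add: z_def)
    then show ?thesis
      by (simp add: z_def)
  qed
  have jK: "j \<in> ?K" "Suc j \<in> ?K" "1 \<in> ?K"
    using j by auto
  show ?thesis
  proof (cases "u 1 = 0")
    case True
    \<comment> \<open>In this case \<open>u\<close> vanishes identically, and so does
      \<open>v\<close>, which it dominates.\<close>
    have "\<bar>v j\<bar> \<le> u j" if "j \<in> ?K" for j
      using V[OF that] that unfolding u_def by (simp add: V_def sum_abs)
    moreover have "u j = 0" if "j \<in> ?K" for j
      by (rule unique[OF u0 u True that])
    ultimately show ?thesis
      using jK by fastforce
  next
    case False
    have "u 1 * v (Suc j) \<le> u 1 * v j"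
      using uv jK u_dec v0[of 1] by (simp add: mult_left_mono)
    then show ?thesis
      using False u0[of 1] by (simp add: mult_le_cancel_left)
  qed
qed

subsection \<open>Maps with convex branches\<close>

lemma convex_on_secant_mono:
  fixes f :: "real \<Rightarrow> real"
  assumes f: "convex_on A f" and A: "a \<in> A" "t \<in> A" "x \<in> A" "y \<in> A"
    and le: "a < t" "t \<le> x" "x < y"
  shows "(f t - f a) / (t - a) \<le> (f y - f x) / (y - x)"
proof -
  have "(f t - f a) / (t - a) \<le> (f x - f a) / (x - a)"
  proof (cases "t = x")
    case False
    then show ?thesis
      using convex_on_slope_le(1)[OF f A(1,3), of t] le
      by (simp add: minus_divide_divide[symmetric, of "f a - _"])
  qed simp
  also have "\<dots> \<le> (f y - f a) / (y - a)"
    using convex_on_slope_le(1)[OF f A(1,4), of x] le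
    by (simp add: minus_divide_divide[symmetric, of "f a - _"])
  also have "\<dots> \<le> (f y - f x) / (y - x)"
    using convex_on_slope_le(2)[OF f A(1,4), of x] le
    by (simp add: minus_divide_divide[symmetric, of "_ - f y"])
  finally show ?thesis .
qed

text \<open>Secant slopes from \<open>a\<close> to t tend to \<open>d\<close> as t decreases to
  \<open>a\<close>, and each is at most any secant slope further to the right.\<close>

lemma convex_on_right_derivative_le_slope:
  fixes f :: "real \<Rightarrow> real"
  assumes f: "convex_on {a..<b} f" and d: "(f has_real_derivative d) (at_right a)"
    and xy: "a \<le> x" "x \<le> y" "y < b"
  shows "d * (y - x) \<le> f y - f x"
proof (cases "x = y")
  case False
  have *: "d * (y - x) \<le> f y - f x" if xy: "a < x" "x < y" "y < b" for x y
  proof -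
    have "((\<lambda>t. (f t - f a) / (t - a)) \<longlongrightarrow> d) (at_right a)"
      using d by (simp add: has_field_derivative_iff)
    moreover have "eventually (\<lambda>t. (f t - f a) / (t - a) \<le> (f y - f x) / (y - x)) (at_right a)"
      using eventually_at_right_real[OF xy(1)]
      by eventually_elim (rule convex_on_secant_mono[OF f], use xy in auto)
    ultimately have "d \<le> (f y - f x) / (y - x)"
      by (intro tendsto_upperbound[where F = "at_right a"]) auto
    then show ?thesis
      using xy by (simp add: le_divide_eq)
  qed
  show ?thesis
  proof (cases "x = a")
    \<comment> \<open>Here t ranges over the points between \<open>a\<close> and \<open>y\<close>;
      above it had to stay to the left of \<open>x\<close>.\<close>
    case True
    have "((\<lambda>t. (f t - f a) / (t - a)) \<longlongrightarrow> d) (at_right a)"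
      using d by (simp add: has_field_derivative_iff)
    moreover have "eventually (\<lambda>t. (f t - f a) / (t - a) \<le> (f y - f a) / (y - a)) (at_right a)"
    proof (rule eventually_mono)
      show "eventually (\<lambda>t. t \<in> {a<..<y}) (at_right a)"
        using False True xy by (intro eventually_at_right_real) auto
      fix t assume t: "t \<in> {a<..<y}"
      show "(f t - f a) / (t - a) \<le> (f y - f a) / (y - a)"
        using convex_on_slope_le(1)[OF f, of a y t] t xy
        by (simp add: minus_divide_divide[symmetric, of "f a - _"])
    qed
    ultimately have "d \<le> (f y - f a) / (y - a)"
      by (intro tendsto_upperbound[where F = "at_right a"]) auto
    then show ?thesis
      using xy True False by (simp add: le_divide_eq)
  qed (use * xy False in auto)
qed simp

section \<open>Lebesgue measure on the unit interval\<close>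

interpretation unit_leb: finite_measure unit_leb
  by (rule finite_measure_lebesgue_on) auto

lemma sets_unit_leb_iff: "A \<in> sets unit_leb \<longleftrightarrow> A \<subseteq> {0..1} \<and> A \<in> sets lebesgue"
  by (auto simp: sets_restrict_space_iff)

lemma null_sets_unit_leb_iff: "A \<in> null_sets unit_leb \<longleftrightarrow> A \<subseteq> {0..1} \<and> negligible A"
  by (auto simp: null_sets_restrict_space negligible_iff_null_sets)

lemma measure_unit_leb_Ico: "0 \<le> u \<Longrightarrow> u \<le> v \<Longrightarrow> v \<le> 1 \<Longrightarrow> measure unit_leb {u..<v} = v - u"
  by (subst measure_restrict_space) auto

lemma measure_unit_leb_Icc: "0 \<le> u \<Longrightarrow> u \<le> v \<Longrightarrow> v \<le> 1 \<Longrightarrow> measure unit_leb {u..v} = v - u"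
  by (subst measure_restrict_space) auto

lemma measure_unit_leb_le_length:
  assumes "A \<subseteq> {u..v}" "u \<le> v"
  shows "measure unit_leb A \<le> v - u"
\<comment> \<open>Outside the sigma-algebra \<open>measure\<close> is 0 by convention, so the bound
  covers such sets as well.\<close>
proof (cases "A \<in> sets unit_leb")
  case True
  have "measure unit_leb A = measure lebesgue A"
    using True by (intro measure_restrict_space) (auto simp: sets_unit_leb_iff)
  also have "\<dots> \<le> measure lebesgue {u..v}"
    using True assms by (intro measure_mono_fmeasurable) (auto simp: sets_unit_leb_iff)
  finally show ?thesis using assms by simp
qed (use assms in \<open>simp add: measure_notin_sets\<close>)

text \<open>The index set may be infinite, so that the map \<tau> itself is an instance beside its
  approximations. Covering is asked for the open interval only: the branches of \<tau> accumulate at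
  0 without containing it, and 1 is in no half-open branch. \<open>d i\<close> is the slope at the
  left end, which by convexity bounds all slopes on the branch from below.\<close>

locale convex_branches =
  fixes T :: "real \<Rightarrow> real" and I :: "nat set" and \<alpha> \<beta> d :: "nat \<Rightarrow> real"
  assumes ends: "i \<in> I \<Longrightarrow> 0 \<le> \<alpha> i \<and> \<alpha> i < \<beta> i \<and> \<beta> i \<le> 1"
    and disj: "i \<in> I \<Longrightarrow> j \<in> I \<Longrightarrow> x \<in> {\<alpha> i..<\<beta> i} \<Longrightarrow> x \<in> {\<alpha> j..<\<beta> j} \<Longrightarrow> i = j"
    and cover: "0 < x \<Longrightarrow> x < 1 \<Longrightarrow> \<exists>i\<in>I. x \<in> {\<alpha> i..<\<beta> i}"
    and maps: "x \<in> {0..1} \<Longrightarrow> T x \<in> {0..1}"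
    and cont: "i \<in> I \<Longrightarrow> continuous_on {\<alpha> i..<\<beta> i} T"
    and conv: "i \<in> I \<Longrightarrow> convex_on {\<alpha> i..<\<beta> i} T"
    and zero: "i \<in> I \<Longrightarrow> T (\<alpha> i) = 0"
    and d_pos: "i \<in> I \<Longrightarrow> 0 < d i"
    and slope: "i \<in> I \<Longrightarrow> \<alpha> i \<le> x \<Longrightarrow> x \<le> y \<Longrightarrow> y < \<beta> i \<Longrightarrow> d i * (y - x) \<le> T y - T x"
begin

lemma branch_subset: "i \<in> I \<Longrightarrow> {\<alpha> i..<\<beta> i} \<subseteq> {0..<1}"
  using ends[of i] by auto

lemma strict_mono_branch: "i \<in> I \<Longrightarrow> \<alpha> i \<le> x \<Longrightarrow> x < y \<Longrightarrow> y < \<beta> i \<Longrightarrow> T x < T y"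
  using slope[of i x y] d_pos[of i] mult_pos_pos[of "d i" "y - x"] by linarith

lemma mono_branch: "i \<in> I \<Longrightarrow> \<alpha> i \<le> x \<Longrightarrow> x \<le> y \<Longrightarrow> y < \<beta> i \<Longrightarrow> T x \<le> T y"
  using strict_mono_branch[of i x y] by (cases "x = y") auto

lemma less_one_branch:
  assumes "i \<in> I" "x \<in> {\<alpha> i..<\<beta> i}"
  shows "T x < 1"
proof -
  obtain y where y: "x < y" "y < \<beta> i"
    using dense[of x "\<beta> i"] assms by auto
  have "T x < T y"
    using assms y by (intro strict_mono_branch) auto
  also have "T y \<le> 1"
    using assms y branch_subset[OF assms(1)] maps[of y] by auto
  finally show ?thesis .
qed

text \<open>The inverse of a branch is Lipschitz with constant 1 / \<open>d i\<close>, and Lipschitz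
  maps carry null sets to null sets.\<close>

lemma negligible_vimage_branch:
  assumes i: "i \<in> I" and N: "negligible N"
  shows "negligible {x \<in> {\<alpha> i..<\<beta> i}. T x \<in> N}"
proof -
  let ?b = "{\<alpha> i..<\<beta> i}"
  have inj: "inj_on T ?b"
    by (rule linorder_inj_onI') (use strict_mono_branch[OF i] in fastforce)
  define \<phi> where "\<phi> = inv_into ?b T"
  have eq: "{x \<in> ?b. T x \<in> N} = \<phi> ` (N \<inter> T ` ?b)"
    using inj by (force simp: \<phi>_def inv_into_f_f)
  have lip: "\<bar>\<phi> (T x) - \<phi> (T y)\<bar> \<le> 1 / d i * \<bar>T x - T y\<bar>" if "x \<in> ?b" "y \<in> ?b" for x y
  proof -
    have "d i * \<bar>x - y\<bar> \<le> \<bar>T x - T y\<bar>"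
      using slope[OF i, of x y] slope[OF i, of y x] that by (cases "x \<le> y") auto
    then show ?thesis
      using inj that d_pos[OF i] by (simp add: \<phi>_def inv_into_f_f field_simps)
  qed
  show ?thesis
    unfolding eq
  proof (rule negligible_locally_Lipschitz_image)
    show "negligible (N \<inter> T ` ?b)"
      using N by (rule negligible_subset) auto
    show "\<exists>U B. open U \<and> x \<in> U \<and> (\<forall>y\<in>N \<inter> T ` ?b \<inter> U. norm (\<phi> y - \<phi> x) \<le> B * norm (y - x))"
      if "x \<in> N \<inter> T ` ?b" for x
      using that lip by (intro exI[of _ UNIV] exI[of _ "1 / d i"]) auto
  qed simp
qed

text \<open>A Lebesgue set is a Borel set together with part of a null set. Continuity handles the
  first, the previous lemma the second.\<close>

lemma measurable_vimage_branch:
  assumes i: "i \<in> I" and A: "A \<in> sets lebesgue"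
  shows "{x \<in> {\<alpha> i..<\<beta> i}. T x \<in> A} \<in> sets lebesgue"
proof -
  let ?b = "{\<alpha> i..<\<beta> i}"
  obtain C N N' where CN: "C \<in> sets borel" "N \<subseteq> N'" "N' \<in> null_sets lborel" "A = C \<union> N"
    by (rule sets_completionE[OF A]) simp
  have N: "negligible N"
    using null_sets_completionI[OF CN(3)] CN(2) negligible_subset by (auto simp: negligible_iff_null_sets)
  have "T \<in> borel_measurable (restrict_space borel ?b)"
    by (rule borel_measurable_continuous_on_restrict[OF cont[OF i]])
  then have "T -` C \<inter> ?b \<in> sets (restrict_space borel ?b)"
    using measurable_sets[of T "restrict_space borel ?b" borel C] CN(1)
    by (simp add: space_restrict_space)
  then have "T -` C \<inter> ?b \<in> sets borel"
    by (subst (asm) sets_restrict_space_iff) auto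
  moreover have "{x \<in> ?b. T x \<in> N} \<in> sets lebesgue"
    by (rule negligible_imp_sets[OF negligible_vimage_branch[OF i N]])
  moreover have "{x \<in> ?b. T x \<in> A} = (T -` C \<inter> ?b) \<union> {x \<in> ?b. T x \<in> N}"
    using CN(4) by auto
  moreover have "T -` C \<inter> ?b \<in> sets lebesgue"
    using calculation(1) by simp
  ultimately show ?thesis by (simp only: sets.Un)
qed

lemma vimage_eq_UN_branches:
  "T -` A \<inter> {0..1} = (\<Union>i\<in>I. {x \<in> {\<alpha> i..<\<beta> i}. T x \<in> A}) \<union> (T -` A \<inter> {0,1})"
proof -
  have "(\<Union>i\<in>I. {\<alpha> i..<\<beta> i}) \<union> {0,1} \<subseteq> {0..1}"
    using branch_subset by (auto simp: subset_iff less_imp_le)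
  moreover have "x \<in> (\<Union>i\<in>I. {\<alpha> i..<\<beta> i}) \<union> {0,1}" if "x \<in> {0..1}" for x
  proof (cases "0 < x \<and> x < 1")
    case True
    then show ?thesis using cover[of x] by blast
  next
    case False
    then have "x = 0 \<or> x = 1" using that by auto
    then show ?thesis by blast
  qed
  ultimately have "{0..1} = (\<Union>i\<in>I. {\<alpha> i..<\<beta> i}) \<union> {0,1}"
    by blast
  moreover have "T -` A \<inter> S = (\<Union>i\<in>I. {x \<in> {\<alpha> i..<\<beta> i}. T x \<in> A}) \<union> (T -` A \<inter> {0,1})"
    if "S = (\<Union>i\<in>I. {\<alpha> i..<\<beta> i}) \<union> {0,1}" for S
    unfolding that by auto
  ultimately show ?thesis by (simp only:)
qed

lemma nonsingular: "nonsingular_map T"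
  unfolding nonsingular_map_def
proof
  show "T \<in> measurable unit_leb unit_leb"
  proof (rule measurableI)
    fix A assume "A \<in> sets unit_leb"
    then have A: "A \<in> sets lebesgue" by (simp add: sets_unit_leb_iff)
    have "T -` A \<inter> {0, 1} \<in> sets lebesgue"
      by (rule negligible_imp_sets[OF negligible_finite]) auto
    moreover have "(\<Union>i\<in>I. {x \<in> {\<alpha> i..<\<beta> i}. T x \<in> A}) \<in> sets lebesgue"
      by (rule sets.countable_UN'') (simp_all only: countableI_type measurable_vimage_branch A)
    ultimately have "T -` A \<inter> {0..1} \<in> sets lebesgue"
      by (subst vimage_eq_UN_branches) (rule sets.Un)
    then show "T -` A \<inter> space unit_leb \<in> sets unit_leb"
      by (simp add: sets_unit_leb_iff)
  qed (use maps in simp)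
  show "\<forall>A\<in>null_sets unit_leb. T -` A \<inter> {0..1} \<in> null_sets unit_leb"
  proof
    fix A assume "A \<in> null_sets unit_leb"
    then have A: "negligible A" by (simp add: null_sets_unit_leb_iff)
    have "negligible (T -` A \<inter> {0, 1})"
      by (rule negligible_finite) auto
    moreover have "negligible (\<Union>i\<in>I. {x \<in> {\<alpha> i..<\<beta> i}. T x \<in> A})"
      by (rule negligible_countable_Union) (auto simp only: intro!: countable_image countableI_type negligible_vimage_branch A)
    ultimately have "negligible (T -` A \<inter> {0..1})"
      by (subst vimage_eq_UN_branches) (rule negligible_Un)
    then show "T -` A \<inter> {0..1} \<in> null_sets unit_leb"
      by (simp add: null_sets_unit_leb_iff)
  qed
qed

lemma vimage_sets [measurable]: "A \<in> sets lebesgue \<Longrightarrow> T -` A \<inter> {0..1} \<in> sets unit_leb"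
proof -
  assume "A \<in> sets lebesgue"
  then have "A \<inter> {0..1} \<in> sets unit_leb" by (auto simp: sets_unit_leb_iff)
  then have "T -` (A \<inter> {0..1}) \<inter> {0..1} \<in> sets unit_leb"
    using nonsingular measurable_sets[of T unit_leb unit_leb "A \<inter> {0..1}"]
    by (simp add: nonsingular_map_def del: vimage_Int)
  also have "T -` (A \<inter> {0..1}) \<inter> {0..1} = T -` A \<inter> {0..1}"
    using maps by auto
  finally show ?thesis .
qed

text \<open>This allows half-open cells to be exchanged for closed sublevel sets when preimages are
  measured.\<close>

lemma negligible_level_set: "negligible (T -` {y} \<inter> {0..1})"
proof -
  have "{y} \<inter> {0..1} \<in> null_sets unit_leb"
    by (auto simp: null_sets_unit_leb_iff intro: negligible_subset[of "{y}"])
  then have "T -` ({y} \<inter> {0..1}) \<inter> {0..1} \<in> null_sets unit_leb"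
    using nonsingular by (auto simp: nonsingular_map_def)
  moreover have "T -` ({y} \<inter> {0..1}) \<inter> {0..1} = T -` {y} \<inter> {0..1}"
    using maps by auto
  ultimately show ?thesis by (simp add: null_sets_unit_leb_iff)
qed

lemma branch_vimage_sets:
  assumes "i \<in> I" "A \<in> sets lebesgue" "B \<in> sets lebesgue"
  shows "{x \<in> {\<alpha> i..<\<beta> i}. x \<in> B \<and> T x \<in> A} \<in> sets unit_leb"
proof -
  have "{x \<in> {\<alpha> i..<\<beta> i}. x \<in> B \<and> T x \<in> A} = {x \<in> {\<alpha> i..<\<beta> i}. T x \<in> A} \<inter> B" by auto
  also have "\<dots> \<in> sets lebesgue"
    using measurable_vimage_branch[OF assms(1,2)] assms(3) by (rule sets.Int)
  finally show ?thesis
    using branch_subset[OF assms(1)] by (force simp: sets_unit_leb_iff)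
qed

text \<open>Slopes are at least \<open>d i\<close>, so two points of the branch whose values differ
  by at most h are at most h / \<open>d i\<close> apart. The set therefore fits into an interval of
  that length.\<close>

lemma measure_branch_vimage_le:
  assumes i: "i \<in> I" and h: "0 \<le> h"
  shows "measure unit_leb {x \<in> {\<alpha> i..<\<beta> i}. y \<le> T x \<and> T x \<le> y + h} \<le> h / d i"
proof -
  let ?S = "{x \<in> {\<alpha> i..<\<beta> i}. y \<le> T x \<and> T x \<le> y + h}"
  have diff: "x' - x \<le> h / d i" if "x \<in> ?S" "x' \<in> ?S" for x x'
  proof (cases "x \<le> x'")
    case True
    then have "d i * (x' - x) \<le> h" using slope[OF i, of x x'] that by auto
    then show ?thesis using d_pos[OF i] by (simp add: field_simps)
  next
    case False
    moreover have "0 \<le> h / d i" using h d_pos[OF i] by simp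
    ultimately show ?thesis by linarith
  qed
  have bdd: "bdd_below ?S" by (rule bdd_belowI[of _ "\<alpha> i"]) auto
  have "?S \<subseteq> {Inf ?S..Inf ?S + h / d i}"
  proof
    fix x assume x: "x \<in> ?S"
    have "x - h / d i \<le> Inf ?S"
      using x diff by (intro cInf_greatest) (auto simp: algebra_simps)
    then show "x \<in> {Inf ?S..Inf ?S + h / d i}"
      using cInf_lower[OF x bdd] by simp
  qed
  from measure_unit_leb_le_length[OF this] show ?thesis
    using h d_pos[OF i] by simp
qed

text \<open>Midpoints of points of two sublevel sets of a convex function lie in the sublevel set of the
  average level.\<close>

lemma measure_branch_sublevel_concave:
  assumes i: "i \<in> I" and y: "0 \<le> y" and h: "0 \<le> h"
  shows "measure unit_leb {x \<in> {\<alpha> i..<\<beta> i}. x < b \<and> T x \<le> y}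
      + measure unit_leb {x \<in> {\<alpha> i..<\<beta> i}. x < b \<and> T x \<le> y + 2 * h}
    \<le> 2 * measure unit_leb {x \<in> {\<alpha> i..<\<beta> i}. x < b \<and> T x \<le> y + h}"
proof -
  define A where "A y = {x \<in> {\<alpha> i..<\<beta> i}. x < b \<and> T x \<le> y}" for y
  show ?thesis
  proof (cases "\<alpha> i < b")
    case False
    then have "A y = {}" for y by (auto simp: A_def)
    then show ?thesis unfolding A_def[symmetric] by simp
  next
    case True
    have bdd: "bdd_above (A y)" for y
      by (rule bdd_aboveI[of _ "\<beta> i"]) (auto simp: A_def)
    have \<alpha>: "\<alpha> i \<in> A y" if "0 \<le> y" for y
      using True that zero[OF i] ends[OF i] by (auto simp: A_def)
    have meas: "A y \<in> sets unit_leb" for y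
      using branch_vimage_sets[OF i, of "{..y}" "{..<b}"] by (simp add: A_def)
    \<comment> \<open>On a branch T increases, so a sublevel set is an interval starting at
      \<open>\<alpha> i\<close> and its measure is read off its supremum.\<close>
    have mA: "measure unit_leb (A y) = Sup (A y) - \<alpha> i" if y: "0 \<le> y" for y
    proof (rule antisym)
      have le: "\<alpha> i \<le> Sup (A y)" by (rule cSup_upper[OF \<alpha>[OF y] bdd])
      have "Sup (A y) \<le> \<beta> i"
        by (rule cSup_least) (use \<alpha>[OF y] in \<open>auto simp: A_def\<close>)
      then have le1: "Sup (A y) \<le> 1" using ends[OF i] by simp
      have "A y \<subseteq> {\<alpha> i..Sup (A y)}"
        using cSup_upper[OF _ bdd] by (auto simp: A_def)
      then show "measure unit_leb (A y) \<le> Sup (A y) - \<alpha> i"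
        using le by (rule measure_unit_leb_le_length)
      have "{\<alpha> i..<Sup (A y)} \<subseteq> A y"
      proof
        fix x assume x: "x \<in> {\<alpha> i..<Sup (A y)}"
        then obtain x' where "x' \<in> A y" "x < x'"
          using less_cSup_iff[OF _ bdd] \<alpha>[OF y] by (metis atLeastLessThan_iff empty_iff)
        then show "x \<in> A y"
          using x mono_branch[OF i, of x x'] by (auto simp: A_def)
      qed
      then have "measure unit_leb {\<alpha> i..<Sup (A y)} \<le> measure unit_leb (A y)"
        by (intro unit_leb.finite_measure_mono meas)
      then show "Sup (A y) - \<alpha> i \<le> measure unit_leb (A y)"
        using ends[OF i] le le1 by (subst (asm) measure_unit_leb_Ico) auto
    qed
    have mid: "x + x' \<le> 2 * Sup (A (y + h))" if "x \<in> A y" "x' \<in> A (y + 2 * h)" for x x'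
    proof -
      have "T ((1 - 1/2) *\<^sub>R x + (1/2) *\<^sub>R x') \<le> (1 - 1/2) * T x + 1/2 * T x'"
        using that by (intro convex_onD[OF conv[OF i]]) (auto simp: A_def)
      then have "(x + x') / 2 \<in> A (y + h)"
        using that by (auto simp: A_def field_simps)
      from cSup_upper[OF this bdd] show ?thesis by simp
    qed
    \<comment> \<open>The suprema need not be attained, so the midpoint bound is carried over to
      them one at a time.\<close>
    have "Sup (A y) \<le> 2 * Sup (A (y + h)) - x'" if "x' \<in> A (y + 2 * h)" for x'
      by (rule cSup_least) (use \<alpha>[OF y] mid that in \<open>auto simp: algebra_simps\<close>)
    then have "x' \<le> 2 * Sup (A (y + h)) - Sup (A y)" if "x' \<in> A (y + 2 * h)" for x'
      using that by force
    then have "Sup (A (y + 2 * h)) \<le> 2 * Sup (A (y + h)) - Sup (A y)"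
      by (intro cSup_least) (use \<alpha>[of "y + 2 * h"] y h in auto)
    then show ?thesis
      using mA[of y] mA[of "y + h"] mA[of "y + 2 * h"] y h by (simp add: A_def)
  qed
qed

end

subsection \<open>The Ulam matrix\<close>

text \<open>Clamping makes the index monotone on the whole real line and puts 1 into the last,
  closed cell. A decreasing vector composed with it is then \<open>antimono\<close> on all
  reals.\<close>

definition cell_index :: "nat \<Rightarrow> real \<Rightarrow> nat" where
  "cell_index k x = max 1 (min k (nat \<lfloor>x * real k\<rfloor> + 1))"

lemma cell_index_in: "1 \<le> k \<Longrightarrow> cell_index k x \<in> {1..k}"
  by (simp add: cell_index_def)

lemma cell_index_mono: "x \<le> y \<Longrightarrow> cell_index k x \<le> cell_index k y"
  unfolding cell_index_def
  by (intro max.mono min.mono add_mono nat_mono floor_mono mult_right_mono order_refl) auto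

lemma cell_index_eq_iff:
  assumes k: "1 \<le> k" and x: "0 \<le> x" "x < 1" and i: "1 \<le> i"
  shows "cell_index k x = i \<longleftrightarrow> (real i - 1) / real k \<le> x \<and> x < real i / real k"
proof -
  have "x * real k < real k" using k x by simp
  then have "\<lfloor>x * real k\<rfloor> < int k" by (simp add: floor_less_iff)
  moreover have "0 \<le> \<lfloor>x * real k\<rfloor>" using x by simp
  ultimately have "cell_index k x = i \<longleftrightarrow> \<lfloor>x * real k\<rfloor> = int i - 1"
    using k i by (auto simp: cell_index_def)
  also have "\<dots> \<longleftrightarrow> (real i - 1) / real k \<le> x \<and> x < real i / real k"
    unfolding floor_eq_iff using k by (simp add: field_simps)
  finally show ?thesis .
qed

lemma cell_index_bounds:
  assumes k: "1 \<le> k" and x: "0 \<le> x" "x < 1"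
  shows "(real (cell_index k x) - 1) / real k \<le> x" "x < real (cell_index k x) / real k"
  using cell_index_eq_iff[OF assms, of "cell_index k x"] cell_index_in[OF k, of x] by auto

lemma cell_index_0: "1 \<le> k \<Longrightarrow> cell_index k 0 = 1"
  by (simp add: cell_index_def)

lemma mem_ulam_cell_iff:
  assumes k: "1 \<le> k" and i: "i \<in> {1..k}" and x: "x \<in> {0..1}"
  shows "x \<in> ulam_cell k i \<longleftrightarrow> cell_index k x = i"
proof (cases "x = 1")
  case True
  then show ?thesis
    using k i by (auto simp: ulam_cell_def cell_index_def field_simps)
next
  case False
  then show ?thesis
    using k i x cell_index_eq_iff[OF k, of x i] by (auto simp: ulam_cell_def)
qed

lemma ulam_cell_subset: "i \<in> {1..k} \<Longrightarrow> ulam_cell k i \<subseteq> {0..1}"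
proof
  fix x assume i: "i \<in> {1..k}" and x: "x \<in> ulam_cell k i"
  have "0 \<le> (real i - 1) / real k" "real i / real k \<le> 1" using i by auto
  then show "x \<in> {0..1}"
    using x by (auto simp: ulam_cell_def split: if_splits simp del: divide_nonneg_nonneg)
qed

lemma ulam_cell_lebesgue: "ulam_cell k i \<in> sets lebesgue"
  by (simp add: ulam_cell_def)

lemma sets_ulam_cell [measurable]: "i \<in> {1..k} \<Longrightarrow> ulam_cell k i \<in> sets unit_leb"
  using ulam_cell_subset[of i k] by (simp add: sets_unit_leb_iff ulam_cell_lebesgue)

lemma measure_ulam_cell:
  assumes "i \<in> {1..k}"
  shows "measure unit_leb (ulam_cell k i) = 1 / real k"
proof (cases "i = k")
  case True
  then show ?thesis
    using assms by (simp add: ulam_cell_def measure_unit_leb_Icc field_simps)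
next
  case False
  have "measure unit_leb {(real i - 1) / real k..<real i / real k} = real i / real k - (real i - 1) / real k"
    using assms by (intro measure_unit_leb_Ico divide_right_mono) auto
  then show ?thesis
    using False by (simp add: ulam_cell_def diff_divide_distrib)
qed

text \<open>The entry of the Ulam matrix; \<open>real k\<close> is the reciprocal of the length of a
  cell.\<close>

definition ulam_transition :: "(real \<Rightarrow> real) \<Rightarrow> nat \<Rightarrow> nat \<Rightarrow> nat \<Rightarrow> real" where
  "ulam_transition T k i j = real k * measure unit_leb (ulam_cell k i \<inter> (T -` ulam_cell k j \<inter> {0..1}))"

lemma ulam_transition_nonneg: "0 \<le> ulam_transition T k i j"
  by (simp add: ulam_transition_def)

lemma (in convex_branches) sum_ulam_transition:
  assumes k: "1 \<le> k" and i: "i \<in> {1..k}"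
  shows "(\<Sum>j\<in>{1..k}. ulam_transition T k i j) = 1"
proof -
  let ?A = "\<lambda>j. ulam_cell k i \<inter> (T -` ulam_cell k j \<inter> {0..1})"
  have "(\<Sum>j\<in>{1..k}. measure unit_leb (?A j)) = measure unit_leb (\<Union>j\<in>{1..k}. ?A j)"
  proof (rule unit_leb.finite_measure_finite_Union[symmetric])
    show "?A ` {1..k} \<subseteq> sets unit_leb"
      by (intro image_subsetI sets.Int sets_ulam_cell[OF i] vimage_sets ulam_cell_lebesgue)
    have "cell_index k (T x) = j" if "x \<in> ?A j" "j \<in> {1..k}" for x j
      using mem_ulam_cell_iff[OF k that(2), of "T x"] maps[of x] that(1) by blast
    then show "disjoint_family_on ?A {1..k}"
      unfolding disjoint_family_on_def by blast
  qed simp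
  also have "(\<Union>j\<in>{1..k}. ?A j) = ulam_cell k i"
  proof (intro equalityI subsetI)
    fix x assume x: "x \<in> ulam_cell k i"
    then have x01: "x \<in> {0..1}" using ulam_cell_subset[OF i] by blast
    then have "T x \<in> ulam_cell k (cell_index k (T x))"
      using mem_ulam_cell_iff[OF k cell_index_in[OF k] maps] by blast
    then show "x \<in> (\<Union>j\<in>{1..k}. ?A j)"
      using x x01 cell_index_in[OF k, of "T x"] by blast
  qed blast
  finally show ?thesis
    using k i by (simp add: ulam_transition_def measure_ulam_cell sum_distrib_left[symmetric])
qed

text \<open>At the left end of a branch, where T is 0, the metric dx / (x + e) is stretched by a
  factor of at least (\<open>\<alpha> i\<close> + e) * \<open>d i\<close> / e. The last assumption
  says that this factor exceeds 1. The origin now belongs to a branch.\<close>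

locale finite_convex_branches = convex_branches +
  fixes e :: real
  assumes finite_I: "finite I"
    and cover_0: "\<exists>i\<in>I. 0 \<in> {\<alpha> i..<\<beta> i}"
    and e_pos: "0 < e"
    and e_less: "i \<in> I \<Longrightarrow> e < (\<alpha> i + e) * d i"
begin

lemma cover': "0 \<le> x \<Longrightarrow> x < 1 \<Longrightarrow> \<exists>i\<in>I. x \<in> {\<alpha> i..<\<beta> i}"
  using cover[of x] cover_0 by (cases "x = 0") auto

text \<open>Cells are closed on the left and T increases continuously on a branch. A short interval
  to the right of z therefore stays in the cell of z, and its image stays in the cell of T z. So a
  single point already forces a positive entry.\<close>

lemma ulam_transition_pos:
  assumes k: "1 \<le> k" and i: "i \<in> I" and z: "z \<in> {\<alpha> i..<\<beta> i}"
  shows "0 < ulam_transition T k (cell_index k z) (cell_index k (T z))"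
proof -
  have z01: "0 \<le> z" "z < 1" using branch_subset[OF i] z by auto
  have Tz: "0 \<le> T z" "T z < 1" using maps[of z] less_one_branch[OF i z] z01 by auto
  let ?i = "cell_index k z" and ?j = "cell_index k (T z)"
  have "continuous (at z within {\<alpha> i..<\<beta> i}) T"
    using cont[OF i] z by (simp add: continuous_on_eq_continuous_within)
  then have "((\<lambda>x. T x) \<longlongrightarrow> T z) (at z within {\<alpha> i..<\<beta> i})"
    by (simp add: continuous_within)
  then have "eventually (\<lambda>x. T x < real ?j / real k) (at z within {\<alpha> i..<\<beta> i})"
    using cell_index_bounds(2)[OF k Tz] by (rule order_tendstoD(2))
  then obtain \<delta> where \<delta>: "0 < \<delta>"
    "\<And>x. x \<in> {\<alpha> i..<\<beta> i} \<Longrightarrow> x \<noteq> z \<Longrightarrow> dist x z < \<delta> \<Longrightarrow> T x < real ?j / real k"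
    unfolding eventually_at by blast
  define w where "w = min (z + \<delta>) (min (\<beta> i) (real ?i / real k))"
  have w: "z < w"
    using \<delta> z cell_index_bounds(2)[OF k z01] by (simp add: w_def)
  have w1: "w \<le> 1" using ends[OF i] by (auto simp: w_def min_def)
  have "{z..<w} \<subseteq> ulam_cell k ?i \<inter> (T -` ulam_cell k ?j \<inter> {0..1})"
  proof
    fix x assume x: "x \<in> {z..<w}"
    then have xb: "x \<in> {\<alpha> i..<\<beta> i}" and x01: "0 \<le> x" "x < 1"
      using z z01 w1 by (auto simp: w_def)
    have Tx: "0 \<le> T x" "T x < 1" using maps[of x] less_one_branch[OF i xb] x01 by auto
    have "cell_index k x = ?i"
      using x x01 cell_index_bounds(1)[OF k z01] cell_index_in[OF k, of z]
      by (subst cell_index_eq_iff[OF k]) (auto simp: w_def)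
    moreover have "cell_index k (T x) = ?j"
    proof (subst cell_index_eq_iff[OF k Tx])
      have "T z \<le> T x" using i x xb z by (intro mono_branch) auto
      moreover have "T x < real ?j / real k"
        using \<delta>(2)[OF xb] x cell_index_bounds(2)[OF k Tz] by (cases "x = z") (auto simp: w_def dist_real_def)
      ultimately show "(real ?j - 1) / real k \<le> T x \<and> T x < real ?j / real k"
        using cell_index_bounds(1)[OF k Tz] by simp
    qed (use cell_index_in[OF k, of "T z"] in auto)
    ultimately show "x \<in> ulam_cell k ?i \<inter> (T -` ulam_cell k ?j \<inter> {0..1})"
      using x01 Tx mem_ulam_cell_iff[OF k cell_index_in[OF k]] by auto
  qed
  then have "measure unit_leb {z..<w} \<le> measure unit_leb (ulam_cell k ?i \<inter> (T -` ulam_cell k ?j \<inter> {0..1}))"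
    by (rule unit_leb.finite_measure_mono[OF _
          sets.Int[OF sets_ulam_cell[OF cell_index_in[OF k]] vimage_sets[OF ulam_cell_lebesgue]]])
  moreover have "measure unit_leb {z..<w} = w - z"
    using w w1 z01 by (intro measure_unit_leb_Ico) auto
  ultimately show ?thesis
    using w k by (simp add: ulam_transition_def)
qed

text \<open>
  The shift by \<open>e\<close> makes the metric \<open>dx / (x + e)\<close> strictly expanded by every branch,
  including the linear one through the origin.
\<close>

lemma log_expanding:
  assumes i: "i \<in> I" and ux: "\<alpha> i < u" "u < x" "x < \<beta> i"
  shows "(x + e) * (T u + e) + ((\<alpha> i + e) * d i - e) * (x - u) \<le> (T x + e) * (u + e)"
proof -
  have "(T u - T (\<alpha> i)) / (u - \<alpha> i) \<le> (T x - T (\<alpha> i)) / (x - \<alpha> i)"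
    using convex_on_slope_le(1)[OF conv[OF i], of "\<alpha> i" x u] ux
    by (simp add: minus_divide_divide[symmetric, of "T (\<alpha> i) - _"])
  then have 1: "T u * (x - \<alpha> i) \<le> T x * (u - \<alpha> i)"
    using ux by (simp add: zero[OF i] divide_simps)
  have "d i * (x - u) \<le> T x - T u"
    using ux by (intro slope[OF i]) auto
  moreover have "0 \<le> \<alpha> i + e" using ends[OF i] e_pos by simp
  ultimately have 2: "(\<alpha> i + e) * (d i * (x - u)) \<le> (\<alpha> i + e) * (T x - T u)"
    by (rule mult_left_mono)
  \<comment> \<open>Split x + e into (x - \<open>\<alpha> i\<close>) + (\<open>\<alpha> i\<close> +
    e), and u + e likewise; the first parts are compared by 1, the second ones by 2.\<close>
  from 1 2 show ?thesis by (simp add: algebra_simps)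
qed

text \<open>
  The support of a fixed vector is forward invariant. A run of cells in it of maximal length
  with respect to \<open>dx / (x + e)\<close> contains no left endpoint of a branch, as that would lead to the
  first cell. So it lies in one branch and is mapped into a strictly longer run.
\<close>

lemma ulam_fixed_vector_eq_0:
  assumes k: "1 \<le> k"
    and v0: "\<And>j. j \<in> {1..k} \<Longrightarrow> 0 \<le> v j"
    and v: "\<And>j. j \<in> {1..k} \<Longrightarrow> v j = (\<Sum>i\<in>{1..k}. v i * ulam_transition T k i j)"
    and v1: "v 1 = 0"
    and j: "j \<in> {1..k}"
  shows "v j = 0"
proof (rule ccontr)
  define S where "S = {j\<in>{1..k}. 0 < v j}"
  assume "v j \<noteq> 0"
  then have jS: "j \<in> S" using v0[OF j] j by (simp add: S_def)
  \<comment> \<open>Positive mass in the cell of z sends positive mass to the cell of T z, and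
    \<open>v\<close> is fixed.\<close>
  have closed: "cell_index k (T z) \<in> S" if z: "cell_index k z \<in> S" "0 \<le> z" "z < 1" for z
  proof -
    let ?i = "cell_index k z" and ?j = "cell_index k (T z)"
    have jk: "?j \<in> {1..k}" using cell_index_in[OF k] .
    obtain i where "i \<in> I" "z \<in> {\<alpha> i..<\<beta> i}" using cover' z by blast
    then have "0 < v ?i * ulam_transition T k ?i ?j"
      using ulam_transition_pos[OF k] z by (simp add: S_def)
    also have "\<dots> \<le> (\<Sum>i\<in>{1..k}. v i * ulam_transition T k i ?j)"
      using v0 ulam_transition_nonneg cell_index_in[OF k]
      by (intro member_le_sum[where f = "\<lambda>i. v i * ulam_transition T k i ?j"]) auto
    also have "\<dots> = v ?j" using v[OF jk] by simp
    finally show ?thesis using jk by (simp add: S_def)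
  qed
  define R where "R = {(p, q). p \<le> q \<and> {p..q} \<subseteq> S}"
  \<comment> \<open>The exponential of the length of the union of the cells p, ..., q in the metric
    dx / (x + e).\<close>
  define \<psi> where "\<psi> = (\<lambda>(p, q). (real q / real k + e) / ((real p - 1) / real k + e))"
  have "R \<subseteq> {1..k} \<times> {1..k}"
    by (auto simp: R_def S_def subset_iff)
  then have "finite R" by (rule finite_subset) simp
  moreover have "(j, j) \<in> R" using jS by (simp add: R_def)
  ultimately have "Max (\<psi> ` R) \<in> \<psi> ` R" "\<And>r. r \<in> R \<Longrightarrow> \<psi> r \<le> Max (\<psi> ` R)"
    by (intro Max_in, auto)
  then obtain p q where pq: "(p, q) \<in> R" and max: "\<And>r. r \<in> R \<Longrightarrow> \<psi> r \<le> \<psi> (p, q)"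
    by auto
  from pq have "p \<le> q" "p \<in> S" "q \<in> S" by (auto simp: R_def)
  then have p: "1 \<le> p" "q \<le> k" by (auto simp: S_def)
  define u where "u = (real p - 1) / real k"
  define w where "w = real q / real k"
  have u0: "0 \<le> u" using p by (simp add: u_def)
  have uw: "u < w" using p \<open>p \<le> q\<close> k by (simp add: u_def w_def divide_strict_right_mono)
  have w1: "w \<le> 1" using p k by (simp add: w_def)
  have cell_S: "cell_index k z \<in> S" if z: "u \<le> z" "z < w" for z
  proof -
    have z01: "0 \<le> z" "z < 1" using z u0 w1 by auto
    note b = cell_index_bounds[OF k z01]
    have "(real p - 1) / real k < real (cell_index k z) / real k"
      using b(2) z by (simp add: u_def)
    then have "p \<le> cell_index k z" using k by (simp add: divide_less_cancel)
    moreover have "(real (cell_index k z) - 1) / real k < real q / real k"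
      using b(1) z by (simp add: w_def)
    then have "cell_index k z \<le> q" using k by (simp add: divide_less_cancel)
    ultimately show ?thesis using pq by (auto simp: R_def)
  qed
  \<comment> \<open>A left end is mapped to 0, that is, into the first cell, where \<open>v\<close>
    vanishes.\<close>
  have no_end: "\<not> (u \<le> \<alpha> i \<and> \<alpha> i < w)" if i: "i \<in> I" for i
  proof
    assume a: "u \<le> \<alpha> i \<and> \<alpha> i < w"
    then have "cell_index k (T (\<alpha> i)) \<in> S"
      using cell_S u0 w1 by (intro closed) auto
    then show False
      using v1 by (simp add: S_def zero[OF i] cell_index_0[OF k])
  qed
  obtain i where i: "i \<in> I" "u \<in> {\<alpha> i..<\<beta> i}" using cover'[of u] u0 uw w1 by auto
  have \<alpha>u: "\<alpha> i < u" using no_end[OF i(1)] i uw by force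
  \<comment> \<open>Otherwise the branch that contains \<open>\<beta> i\<close> would start before
    u, as no left end lies in the run. It would then contain u and overlap branch i.\<close>
  have w\<beta>: "w \<le> \<beta> i"
  proof (rule ccontr)
    assume "\<not> w \<le> \<beta> i"
    then have \<beta>: "u < \<beta> i" "\<beta> i < w" using i by auto
    then obtain i' where i': "i' \<in> I" "\<beta> i \<in> {\<alpha> i'..<\<beta> i'}"
      using cover'[of "\<beta> i"] u0 w1 by force
    have "\<alpha> i' < u" using no_end[OF i'(1)] i' \<beta> by force
    then have "u \<in> {\<alpha> i'..<\<beta> i'}" using i' \<beta> by auto
    then have "i' = i" using disj i i' by blast
    then show False using i' by simp
  qed
  have Tu: "0 \<le> T u" "T u < 1" using maps[of u] less_one_branch[OF i] u0 uw w1 by auto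
  define c where "c = (\<alpha> i + e) * d i - e"
  have c: "0 < c" using e_less[OF i(1)] by (simp add: c_def)
  define B where "B = T u + e"
  have B: "0 < B" using Tu e_pos by (simp add: B_def)
  \<comment> \<open>The right end w may lie outside the branch, so a point x slightly before it is
    used instead. Stopping early loses (1 - s) * B and the strict expansion gains c * s per unit of
    w - u. The gain wins as soon as s > B / (B + c); the value chosen is the midpoint between this
    bound and 1.\<close>
  define s where "s = (B + c / 2) / (B + c)"
  have s: "0 < s" "s < 1"
    using B c by (auto simp: s_def)
  have "(1 - s) * B = (c / 2 * B) / (B + c)"
    using B c by (simp add: s_def field_simps)
  also have "\<dots> < (c * (B + c / 2)) / (B + c)"
    using B c by (intro divide_strict_right_mono) (auto simp: algebra_simps intro!: add_pos_pos)
  finally have sB: "(1 - s) * B < c * s"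
    by (simp add: s_def)
  define x where "x = u + s * (w - u)"
  have xu: "u < x" using s uw by (simp add: x_def)
  have "s * (w - u) < 1 * (w - u)" using s uw by (intro mult_strict_right_mono) auto
  then have xw: "x < w" by (simp add: x_def)
  have "(1 - s) * B * (w - u) < c * s * (w - u)" using sB uw by (intro mult_strict_right_mono) auto
  then have "(w - x) * B < c * (x - u)" by (simp add: x_def algebra_simps)
  moreover have "(x + e) * B + c * (x - u) \<le> (T x + e) * (u + e)"
    using log_expanding[OF i(1) \<alpha>u xu] xw w\<beta> by (simp add: B_def c_def)
  ultimately have key: "(w + e) * (T u + e) < (T x + e) * (u + e)"
    by (simp add: B_def algebra_simps)
  have xb: "x \<in> {\<alpha> i..<\<beta> i}" using \<alpha>u xu xw w\<beta> by auto
  have Tx: "0 \<le> T x" "T x < 1" using maps[of x] less_one_branch[OF i(1) xb] u0 xu xw w1 by auto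
  have Tux: "T u \<le> T x" using i xu xb by (intro mono_branch) auto
  define p' where "p' = cell_index k (T u)"
  define q' where "q' = cell_index k (T x)"
  have "(p', q') \<in> R"
    unfolding R_def
  proof (clarsimp, intro conjI subsetI)
    show "p' \<le> q'" unfolding p'_def q'_def using Tux by (rule cell_index_mono)
    fix j assume "j \<in> {p'..q'}"
    then consider "j = p'" | "p' < j" "j \<le> q'" by fastforce
    then show "j \<in> S"
    proof cases
      case 1
      then show ?thesis
        unfolding p'_def using cell_S u0 uw w1 by (auto intro!: closed)
    next
      case 2
      \<comment> \<open>The left end of cell j. As j lies beyond the cell of T u, it lies between T
        u and T x and is the image of a point of the run by the intermediate value theorem.\<close>
      define y where "y = (real j - 1) / real k"
      have "T u < real p' / real k" unfolding p'_def by (rule cell_index_bounds[OF k Tu])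
      also have "\<dots> \<le> y" unfolding y_def using 2 by (intro divide_right_mono) auto
      finally have y1: "T u \<le> y" by simp
      have "y \<le> (real q' - 1) / real k" unfolding y_def using 2 by (intro divide_right_mono) auto
      also have "\<dots> \<le> T x" unfolding q'_def by (rule cell_index_bounds[OF k Tx])
      finally have y2: "y \<le> T x" .
      have "continuous_on {u..x} T"
        by (rule continuous_on_subset[OF cont[OF i(1)]]) (use i xb in auto)
      then obtain z where z: "u \<le> z" "z \<le> x" "T z = y"
        using IVT'[of T u y x] y1 y2 xu by auto
      have "cell_index k (T z) \<in> S"
        using z xw u0 w1 by (intro closed cell_S) auto
      moreover have "cell_index k (T z) = j"
      proof (subst cell_index_eq_iff[OF k])
        show "0 \<le> T z" "T z < 1" using z y1 y2 Tu Tx by linarith+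
      qed (use z 2 k in \<open>auto simp: y_def divide_strict_right_mono\<close>)
      ultimately show ?thesis by simp
    qed
  qed
  then have "\<psi> (p', q') \<le> \<psi> (p, q)" by (rule max)
  moreover have "\<psi> (p, q) < \<psi> (p', q')"
  proof -
    have "\<psi> (p, q) = (w + e) / (u + e)" by (simp add: \<psi>_def u_def w_def)
    also have "\<dots> < (T x + e) / (T u + e)"
      using key u0 e_pos Tu by (simp add: divide_simps)
    \<comment> \<open>Rounding the image outwards to full cells only lengthens it.\<close>
    also have "\<dots> \<le> \<psi> (p', q')"
      unfolding \<psi>_def prod.case
    proof (rule frac_le)
      show "T x + e \<le> real q' / real k + e" 
        unfolding q'_def using cell_index_bounds(2)[OF k Tx] by simp
      show "(real p' - 1) / real k + e \<le> T u + e" 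
        unfolding p'_def using cell_index_bounds(1)[OF k Tu] by simp
      show "0 < (real p' - 1) / real k + e"
        using e_pos cell_index_in[OF k, of "T u"] by (simp add: p'_def add_nonneg_pos)
      show "0 \<le> real q' / real k + e" using e_pos by simp
    qed
    finally show ?thesis .
  qed
  ultimately show False by simp
qed

section \<open>The Ulam matrix on indicators of initial segments\<close>

lemma measure_sublevel_concave:
  assumes y: "0 \<le> y" and h: "0 \<le> h" and b: "b \<le> 1"
  shows "measure unit_leb {x \<in> {0..1}. x < b \<and> T x \<le> y} + measure unit_leb {x \<in> {0..1}. x < b \<and> T x \<le> y + 2 * h}
    \<le> 2 * measure unit_leb {x \<in> {0..1}. x < b \<and> T x \<le> y + h}"
proof -
  have eq: "measure unit_leb {x \<in> {0..1}. x < b \<and> T x \<le> y} =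
      (\<Sum>i\<in>I. measure unit_leb {x \<in> {\<alpha> i..<\<beta> i}. x < b \<and> T x \<le> y})" for y
  proof -
    let ?A = "\<lambda>i. {x \<in> {\<alpha> i..<\<beta> i}. x < b \<and> T x \<le> y}"
    have "{x \<in> {0..1}. x < b \<and> T x \<le> y} = (\<Union>i\<in>I. ?A i)"
    proof (intro set_eqI iffI)
      fix x assume "x \<in> {x \<in> {0..1}. x < b \<and> T x \<le> y}"
      then show "x \<in> (\<Union>i\<in>I. ?A i)" using cover'[of x] b by auto
    next
      fix x assume "x \<in> (\<Union>i\<in>I. ?A i)"
      then obtain i where "i \<in> I" "x \<in> ?A i" by blast
      then show "x \<in> {x \<in> {0..1}. x < b \<and> T x \<le> y}" using branch_subset[of i] by force
    qed
    moreover have "measure unit_leb (\<Union>i\<in>I. ?A i) = (\<Sum>i\<in>I. measure unit_leb (?A i))"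
    proof (rule unit_leb.finite_measure_finite_Union[OF finite_I])
      show "?A ` I \<subseteq> sets unit_leb"
        using branch_vimage_sets[of _ "{..y}" "{..<b}"] by (intro image_subsetI) simp
      show "disjoint_family_on ?A I"
        using disj by (auto simp: disjoint_family_on_def)
    qed
    ultimately show ?thesis by simp
  qed
  show ?thesis
    unfolding eq sum.distrib[symmetric] sum_distrib_left
    by (intro sum_mono measure_branch_sublevel_concave y h)
qed

text \<open>Writes the mass that the first m cells send to cell j as an increment of the measure of
  sublevel sets. Concavity of that measure in the level then makes the mass decrease with j.\<close>

lemma sum_ulam_transition_eq:
  assumes k: "1 \<le> k" and m: "m \<in> {1..k}" and j: "j \<in> {1..k}"
  shows "(\<Sum>i\<in>{1..m}. ulam_transition T k i j) = real k *
    (measure unit_leb {x \<in> {0..1}. x < real m / real k \<and> T x \<le> real j / real k} -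
     measure unit_leb {x \<in> {0..1}. x < real m / real k \<and> T x \<le> (real j - 1) / real k})"
proof -
  define b where "b = real m / real k"
  have b: "b \<le> 1" using m k by (simp add: b_def)
  let ?A = "\<lambda>i. ulam_cell k i \<inter> (T -` ulam_cell k j \<inter> {0..1})"
  let ?L = "\<lambda>y. {x \<in> {0..1}. x < b \<and> T x \<le> y}"
  have L: "?L y \<in> sets unit_leb" for y
  proof -
    have "?L y = T -` {..y} \<inter> {0..1} \<inter> {0..<b}" using b by auto
    moreover have "T -` {..y} \<inter> {0..1} \<in> sets unit_leb" by (rule vimage_sets) simp
    moreover have "{0..<b} \<in> sets unit_leb" using b by (auto simp: sets_unit_leb_iff)
    ultimately show ?thesis by (metis sets.Int)
  qed
  have A: "?A i \<in> sets unit_leb" if "i \<in> {1..k}" for i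
    using sets_ulam_cell[OF that] vimage_sets[OF ulam_cell_lebesgue] by (rule sets.Int)
  have "(\<Sum>i\<in>{1..m}. measure unit_leb (?A i)) = measure unit_leb (\<Union>i\<in>{1..m}. ?A i)"
  proof (rule unit_leb.finite_measure_finite_Union[symmetric])
    show "?A ` {1..m} \<subseteq> sets unit_leb"
      using A m by (intro image_subsetI) simp
    have "cell_index k x = i" if "x \<in> ?A i" "i \<in> {1..m}" for x i
      using mem_ulam_cell_iff[OF k, of i x] that m by auto
    then show "disjoint_family_on ?A {1..m}"
      unfolding disjoint_family_on_def by blast
  qed simp
  also have "\<dots> = measure unit_leb (?L (real j / real k) - ?L ((real j - 1) / real k))"
  proof (rule measure_eq_AE)
    have null: "AE x in unit_leb. x \<notin> T -` {y} \<inter> {0..1}" for y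
      using negligible_level_set by (intro AE_not_in) (simp add: null_sets_unit_leb_iff)
    have "AE x in unit_leb. x \<notin> {1}"
      by (intro AE_not_in) (simp add: null_sets_unit_leb_iff)
    with null[of "real j / real k"] null[of "(real j - 1) / real k"] AE_space
    show "AE x in unit_leb. x \<in> (\<Union>i\<in>{1..m}. ?A i) \<longleftrightarrow> x \<in> ?L (real j / real k) - ?L ((real j - 1) / real k)"
    proof eventually_elim
      case (elim x)
      then have x: "0 \<le> x" "x < 1" by auto
      then obtain i where i: "i \<in> I" "x \<in> {\<alpha> i..<\<beta> i}" using cover' by blast
      have Tx: "0 \<le> T x" "T x < 1" using maps[of x] less_one_branch[OF i] x by auto
      have "x \<in> (\<Union>i\<in>{1..m}. ?A i) \<longleftrightarrow> cell_index k x \<le> m \<and> cell_index k (T x) = j"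
        using mem_ulam_cell_iff[OF k _, of _ x] mem_ulam_cell_iff[OF k j, of "T x"] x Tx m cell_index_in[OF k, of x] by auto
      also have "cell_index k x \<le> m \<longleftrightarrow> x < b"
      proof
        assume "cell_index k x \<le> m"
        then have "real (cell_index k x) / real k \<le> b" unfolding b_def by (intro divide_right_mono) auto
        then show "x < b" using cell_index_bounds(2)[OF k x] by simp
      next
        assume "x < b"
        then have "(real (cell_index k x) - 1) / real k < real m / real k"
          using cell_index_bounds(1)[OF k x] by (simp add: b_def)
        then show "cell_index k x \<le> m" using k by (simp add: divide_less_cancel)
      qed
      also have "cell_index k (T x) = j \<longleftrightarrow> (real j - 1) / real k < T x \<and> T x \<le> real j / real k"
        using elim j x by (subst cell_index_eq_iff[OF k Tx]) auto
      finally show ?case using x by auto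
    qed
    show "(\<Union>i\<in>{1..m}. ?A i) \<in> sets unit_leb" using A m by (intro sets.finite_UN) auto
    show "?L (real j / real k) - ?L ((real j - 1) / real k) \<in> sets unit_leb" using L by (intro sets.Diff)
  qed
  also have "\<dots> = measure unit_leb (?L (real j / real k)) - measure unit_leb (?L ((real j - 1) / real k))"
  proof (rule unit_leb.finite_measure_Diff[OF L L])
    have "(real j - 1) / real k \<le> real j / real k" by (intro divide_right_mono) auto
    then show "?L ((real j - 1) / real k) \<subseteq> ?L (real j / real k)" by auto
  qed
  finally show ?thesis
    by (simp add: ulam_transition_def sum_distrib_left[symmetric] b_def)
qed

lemma ulam_fixed_vector_decreasing:
  assumes k: "1 \<le> k"
    and v0: "\<And>j. j \<in> {1..k} \<Longrightarrow> 0 \<le> v j"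
    and v: "\<And>j. j \<in> {1..k} \<Longrightarrow> v j = (\<Sum>i\<in>{1..k}. v i * ulam_transition T k i j)"
    and j: "1 \<le> j" "j < k"
  shows "v (Suc j) \<le> v j"
proof (rule fixed_vector_decreasing[where M = "ulam_transition T k" and k = k])
  show "(\<Sum>i\<in>{1..m}. ulam_transition T k i (Suc j)) \<le> (\<Sum>i\<in>{1..m}. ulam_transition T k i j)"
    if m: "m \<in> {1..k}" and j: "1 \<le> j" "j < k" for m j
  proof -
    let ?\<mu> = "\<lambda>y. measure unit_leb {x \<in> {0..1}. x < real m / real k \<and> T x \<le> y}"
    \<comment> \<open>Concavity at three consecutive grid levels compares the increments over cells
      j and j + 1.\<close>
    have "?\<mu> ((real j - 1) / real k) + ?\<mu> ((real j - 1) / real k + 2 * (1 / real k))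
        \<le> 2 * ?\<mu> ((real j - 1) / real k + 1 / real k)"
      by (rule measure_sublevel_concave) (use k j m in auto)
    moreover have "(real j - 1) / real k + 2 * (1 / real k) = real (Suc j) / real k"
      "(real j - 1) / real k + 1 / real k = real j / real k"
      by (simp_all add: add_divide_distrib[symmetric])
    ultimately have "?\<mu> (real (Suc j) / real k) - ?\<mu> ((real (Suc j) - 1) / real k) 
        \<le> ?\<mu> (real j / real k) - ?\<mu> ((real j - 1) / real k)"
      by simp
    then show ?thesis
      using j by (subst (1 2) sum_ulam_transition_eq[OF k m]) (auto intro!: mult_left_mono)
  qed
  show "u j = 0" if "\<And>j. j \<in> {1..k} \<Longrightarrow> 0 \<le> u j"
    "\<And>j. j \<in> {1..k} \<Longrightarrow> u j = (\<Sum>i\<in>{1..k}. u i * ulam_transition T k i j)"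
    "u 1 = 0" "j \<in> {1..k}" for u j
    using that by (rule ulam_fixed_vector_eq_0[OF k])
qed (use k v0 v j ulam_transition_nonneg sum_ulam_transition in auto)

end

subsection \<open>Invariant densities as decreasing step functions\<close>

lemma step_function_eq:
  assumes k: "1 \<le> k" and x: "x \<in> {0..1}"
  shows "(\<Sum>i=1..k. c i * indicator (ulam_cell k i) x) = (c (cell_index k x) :: real)"
proof -
  have "(\<Sum>i=1..k. c i * indicator (ulam_cell k i) x) = (\<Sum>i=1..k. if i = cell_index k x then c i else 0)"
    using mem_ulam_cell_iff[OF k _ x] by (intro sum.cong refl) (auto simp: indicator_def)
  then show ?thesis using cell_index_in[OF k, of x] by simp
qed

lemma integrable_unit_leb_indicator:
  "A \<in> sets unit_leb \<Longrightarrow> integrable unit_leb (\<lambda>x. indicator A x :: real)"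
  using unit_leb.emeasure_finite[of A] by (simp add: less_top[symmetric] integrable_real_indicator)

lemma set_integral_step_function:
  fixes c :: "nat \<Rightarrow> real"
  assumes k: "1 \<le> k" and B: "B \<in> sets unit_leb"
  shows "(LINT x:B|unit_leb. c (cell_index k x)) = (\<Sum>i=1..k. c i * measure unit_leb (ulam_cell k i \<inter> B))"
proof -
  have "(LINT x:B|unit_leb. c (cell_index k x)) =
      (LINT x|unit_leb. (\<Sum>i=1..k. c i * indicator (ulam_cell k i \<inter> B) x))"
    unfolding set_lebesgue_integral_def
  proof (intro Bochner_Integration.integral_cong refl)
    fix x assume "x \<in> space unit_leb"
    then have x: "x \<in> {0..1}" by simp
    show "indicator B x *\<^sub>R c (cell_index k x) = (\<Sum>i=1..k. c i * indicator (ulam_cell k i \<inter> B) x)"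
      unfolding step_function_eq[OF k x, of c, symmetric]
      unfolding sum_distrib_left real_scaleR_def by (intro sum.cong refl) (auto simp: indicator_def)
  qed
  also have "\<dots> = (\<Sum>i=1..k. LINT x|unit_leb. c i * indicator (ulam_cell k i \<inter> B) x)"
  proof (rule Bochner_Integration.integral_sum)
    fix i assume "i \<in> {1..k}"
    then have "ulam_cell k i \<inter> B \<in> sets unit_leb" using B by (intro sets.Int sets_ulam_cell)
    then show "integrable unit_leb (\<lambda>x. c i * indicator (ulam_cell k i \<inter> B) x)"
      by (intro integrable_mult_right integrable_unit_leb_indicator)
  qed
  also have "\<dots> = (\<Sum>i=1..k. c i * measure unit_leb (ulam_cell k i \<inter> B))"
  proof (intro sum.cong refl)
    fix i assume i: "i \<in> {1..k}"
    then have "ulam_cell k i \<inter> B \<subseteq> {0..1}" using ulam_cell_subset[OF i] by blast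
    then show "(LINT x|unit_leb. c i * indicator (ulam_cell k i \<inter> B) x) = c i * measure unit_leb (ulam_cell k i \<inter> B)"
      by (simp add: Int_absorb2)
  qed
  finally show ?thesis .
qed

text \<open>Every cell has positive measure, so no index can be exceptional. This turns equalities
  almost everywhere into exact equations for the coefficients.\<close>

lemma AE_cell_indexD:
  assumes k: "1 \<le> k" and AE: "AE x in unit_leb. P (cell_index k x)" and j: "j \<in> {1..k}"
  shows "P j"
proof (rule ccontr)
  assume nP: "\<not> P j"
  have "AE x in unit_leb. x \<notin> ulam_cell k j"
    using AE AE_space
  proof eventually_elim
    case (elim x)
    then show ?case using nP mem_ulam_cell_iff[OF k j, of x] by auto
  qed
  then have "ulam_cell k j \<in> null_sets unit_leb"
    using sets_ulam_cell[OF j] AE_iff_null_sets by blast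
  then have "measure unit_leb (ulam_cell k j) = 0"
    using measure_eq_0_null_sets by blast
  then show False using measure_ulam_cell[OF j] k by simp
qed

text \<open>The version of the image selected by \<open>frobenius_perron\<close> enters only through
  its integrals over cells, and these are prescribed by its defining property.\<close>

lemma ulam_invariant_density_coefficients:
  assumes T: "nonsingular_map T" and k: "1 \<le> k" and f: "ulam_invariant_density T k f"
  obtains c where "AE x in unit_leb. f x = c (cell_index k x)"
    "\<And>j. j \<in> {1..k} \<Longrightarrow> 0 \<le> c j"
    "\<And>j. j \<in> {1..k} \<Longrightarrow> c j = real k * (LINT x:(T -` ulam_cell k j \<inter> {0..1})|unit_leb. f x)"
    "\<And>j. j \<in> {1..k} \<Longrightarrow> c j = (\<Sum>i=1..k. c i * ulam_transition T k i j)"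
proof -
  obtain c where c: "AE x in unit_leb. f x = (\<Sum>i=1..k. c i * indicator (ulam_cell k i) x)"
    using f unfolding ulam_invariant_density_def ulam_space_def by blast
  have fc: "AE x in unit_leb. f x = c (cell_index k x)"
    using c AE_space
  proof eventually_elim
    case (elim x)
    then show ?case using step_function_eq[OF k, of x c] by simp
  qed
  have c0: "0 \<le> c j" if "j \<in> {1..k}" for j
  proof (rule AE_cell_indexD[OF k _ that, where P = "\<lambda>i. 0 \<le> c i"])
    have "AE x in unit_leb. 0 \<le> f x" using f by (simp add: ulam_invariant_density_def)
    with fc show "AE x in unit_leb. 0 \<le> c (cell_index k x)" by eventually_elim simp
  qed
  \<comment> \<open>The mean of the Frobenius--Perron image over cell j.\<close>
  define c' where "c' j = real k * (LINT x:(T -` ulam_cell k j \<inter> {0..1})|unit_leb. f x)" for j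
  have fL: "f \<in> L1" using f by (simp add: ulam_invariant_density_def ulam_space_def)
  have op: "ulam_operator T k f x = c' (cell_index k x)" if x: "x \<in> {0..1}" for x
  proof -
    have "ulam_operator T k f x = (\<Sum>i=1..k. c' i * indicator (ulam_cell k i) x)"
      unfolding ulam_operator_def ulam_projection_def
    proof (intro sum.cong refl)
      fix i assume i: "i \<in> {1..k}"
      have "(LINT y:ulam_cell k i|unit_leb. frobenius_perron T f y) =
          (LINT x:(T -` ulam_cell k i \<inter> {0..1})|unit_leb. f x)"
        using is_frobenius_perron_image_frobenius_perron[OF T fL] sets_ulam_cell[OF i]
        by (simp add: is_frobenius_perron_image_def)
      then show "1 / measure unit_leb (ulam_cell k i) * (LINT y:ulam_cell k i|unit_leb. frobenius_perron T f y) *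
          indicator (ulam_cell k i) x = c' i * indicator (ulam_cell k i) x"
        by (simp add: measure_ulam_cell[OF i] c'_def)
    qed
    then show ?thesis using step_function_eq[OF k x, of c'] by simp
  qed
  have cc': "c j = c' j" if "j \<in> {1..k}" for j
  proof (rule AE_cell_indexD[OF k _ that, where P = "\<lambda>i. c i = c' i"])
    have "AE x in unit_leb. ulam_operator T k f x = f x" using f by (simp add: ulam_invariant_density_def)
    with fc AE_space show "AE x in unit_leb. c (cell_index k x) = c' (cell_index k x)"
    proof eventually_elim
      case (elim x)
      then show ?case using op[of x] by simp
    qed
  qed
  have trans: "c j = (\<Sum>i=1..k. c i * ulam_transition T k i j)" if j: "j \<in> {1..k}" for j
  proof -
    have B: "T -` ulam_cell k j \<inter> {0..1} \<in> sets unit_leb"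
      using T measurable_sets[of T unit_leb unit_leb, OF _ sets_ulam_cell[OF j]] by (simp add: nonsingular_map_def)
    have "(LINT x:(T -` ulam_cell k j \<inter> {0..1})|unit_leb. f x) =
        (LINT x:(T -` ulam_cell k j \<inter> {0..1})|unit_leb. c (cell_index k x))"
      unfolding set_lebesgue_integral_def
    proof (rule integral_cong_AE)
      have "f \<in> borel_measurable unit_leb" using fL by (simp add: L1_def)
      then show "(\<lambda>x. indicator (T -` ulam_cell k j \<inter> {0..1}) x *\<^sub>R f x) \<in> borel_measurable unit_leb"
        using B by (intro borel_measurable_scaleR borel_measurable_indicator)
      have "(\<lambda>x. \<Sum>i=1..k. c i * indicator (ulam_cell k i) x) \<in> borel_measurable unit_leb"
        by (intro borel_measurable_sum borel_measurable_times borel_measurable_const borel_measurable_indicator sets_ulam_cell)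
      then have "(\<lambda>x. c (cell_index k x)) \<in> borel_measurable unit_leb"
        by (rule measurable_cong[THEN iffD1, rotated]) (use step_function_eq[OF k] in simp)
      then show "(\<lambda>x. indicator (T -` ulam_cell k j \<inter> {0..1}) x *\<^sub>R c (cell_index k x)) \<in> borel_measurable unit_leb"
        using B by (intro borel_measurable_scaleR borel_measurable_indicator)
      show "AE x in unit_leb. indicator (T -` ulam_cell k j \<inter> {0..1}) x *\<^sub>R f x =
          indicator (T -` ulam_cell k j \<inter> {0..1}) x *\<^sub>R c (cell_index k x)"
        using fc by eventually_elim simp
    qed
    then show ?thesis
      using cc'[OF j] set_integral_step_function[OF k B, of c]
      by (simp add: c'_def ulam_transition_def sum_distrib_left mult_ac)
  qed
  show ?thesis
    by (rule that[OF fc c0 _ trans]) (use cc' c'_def in simp_all)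
qed

lemma set_integrable_bounded:
  fixes f :: "real \<Rightarrow> real"
  assumes "f \<in> borel_measurable unit_leb" "B \<in> sets unit_leb" "\<And>x. x \<in> {0..1} \<Longrightarrow> \<bar>f x\<bar> \<le> C"
  shows "set_integrable unit_leb B f"
proof -
  have "integrable unit_leb f"
    using assms by (intro unit_leb.integrable_const_bound[where B = C]) auto
  then show ?thesis
    unfolding set_integrable_def using assms(2) by (intro integrable_mult_indicator)
qed

lemma borel_measurable_antimono_unit_leb:
  fixes s :: "real \<Rightarrow> real"
  assumes "antimono s"
  shows "s \<in> borel_measurable unit_leb"
proof -
  have "(\<lambda>x. - s x) \<in> borel_measurable borel"
    using assms by (intro borel_measurable_mono) (auto simp: mono_def antimono_def)
  then have "s \<in> borel_measurable borel" by simp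
  then show ?thesis by (intro measurable_restrict_space1 measurable_completion) simp
qed

context finite_convex_branches begin

lemma vimage_Icc_sets: "{x \<in> {0..1}. y \<le> T x \<and> T x \<le> z} \<in> sets unit_leb"
proof -
  have "{x \<in> {0..1}. y \<le> T x \<and> T x \<le> z} = T -` {y..z} \<inter> {0..1}" by auto
  then show ?thesis using vimage_sets[of "{y..z}"] by simp
qed

text \<open>Branch i meets the preimage of the strip in a set of measure at most h /
  \<open>d i\<close>, on which the decreasing function s is at most s
  (\<open>\<alpha> i\<close>).\<close>

lemma set_integral_vimage_le:
  fixes s :: "real \<Rightarrow> real"
  assumes s: "antimono s" "\<And>x. 0 \<le> s x" and h: "0 \<le> h"
  shows "(LINT x:{x \<in> {0..1}. y \<le> T x \<and> T x \<le> y + h}|unit_leb. s x) \<le> h * (\<Sum>i\<in>I. s (\<alpha> i) / d i)"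
proof -
  let ?B = "{x \<in> {0..1}. y \<le> T x \<and> T x \<le> y + h}"
  let ?A = "\<lambda>i. {x \<in> {\<alpha> i..<\<beta> i}. y \<le> T x \<and> T x \<le> y + h}"
  have A: "?A i \<in> sets unit_leb" if "i \<in> I" for i
    using branch_vimage_sets[OF that, of "{y..y+h}" UNIV] by simp
  have B: "?B \<in> sets unit_leb" by (rule vimage_Icc_sets)
  have intA: "integrable unit_leb (\<lambda>x. s (\<alpha> i) * indicator (?A i) x)" if "i \<in> I" for i
    using A[OF that] by (intro integrable_mult_right integrable_unit_leb_indicator)
  have "(LINT x:?B|unit_leb. s x) \<le> (LINT x|unit_leb. (\<Sum>i\<in>I. s (\<alpha> i) * indicator (?A i) x))"
    unfolding set_lebesgue_integral_def
  proof (rule integral_mono_AE)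
    show "integrable unit_leb (\<lambda>x. indicator ?B x *\<^sub>R s x)"
    proof (rule set_integrable_bounded[unfolded set_integrable_def, OF borel_measurable_antimono_unit_leb B])
      fix x :: real assume "x \<in> {0..1}"
      then show "\<bar>s x\<bar> \<le> s 0" using s antimonoD[OF s(1), of 0 x] by simp
    qed (rule s)
    show "integrable unit_leb (\<lambda>x. \<Sum>i\<in>I. s (\<alpha> i) * indicator (?A i) x)"
      using intA by (rule Bochner_Integration.integrable_sum)
    have "AE x in unit_leb. x \<notin> {1}"
      by (intro AE_not_in) (simp add: null_sets_unit_leb_iff)
    then show "AE x in unit_leb. indicator ?B x *\<^sub>R s x \<le> (\<Sum>i\<in>I. s (\<alpha> i) * indicator (?A i) x)"
    proof eventually_elim
      case (elim x)
      have nonneg: "0 \<le> s (\<alpha> i) * indicator (?A i) x" for i using s(2) by simp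
      show ?case
      proof (cases "x \<in> ?B")
        case True
        then obtain i where i: "i \<in> I" "x \<in> {\<alpha> i..<\<beta> i}" using cover'[of x] elim by auto
        have "s x \<le> s (\<alpha> i)" using i by (intro antimonoD[OF s(1)]) auto
        also have "\<dots> = s (\<alpha> i) * indicator (?A i) x" using i True by simp
        also have "\<dots> \<le> (\<Sum>i\<in>I. s (\<alpha> i) * indicator (?A i) x)"
          using i nonneg finite_I by (intro member_le_sum) auto
        finally show ?thesis using True by simp
      qed (use nonneg in \<open>simp add: sum_nonneg\<close>)
    qed
  qed
  also have "\<dots> = (\<Sum>i\<in>I. s (\<alpha> i) * measure unit_leb (?A i))"
  proof (subst Bochner_Integration.integral_sum[OF intA], assumption, intro sum.cong refl)
    fix i assume "i \<in> I"
    then have "?A i \<inter> {0..1} = ?A i" using branch_subset[of i] by force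
    then show "(LINT x|unit_leb. s (\<alpha> i) * indicator (?A i) x) = s (\<alpha> i) * measure unit_leb (?A i)"
      by simp
  qed
  also have "\<dots> \<le> (\<Sum>i\<in>I. s (\<alpha> i) * (h / d i))"
    using s(2) h by (intro sum_mono mult_left_mono measure_branch_vimage_le) auto
  finally show ?thesis by (simp add: sum_distrib_left mult_ac)
qed

text \<open>The value at 0 is \<open>k\<close> times the integral over the preimage of the first
  cell. The strip bound with h = 1 / k cancels this factor, so the inequality for s 0 has no k in
  it. Averaging keeps integrals over cells, hence invariance survives exactly on intervals that end
  at grid points.\<close>

lemma ulam_invariant_density_step_function:
  assumes k: "1 \<le> k" and f: "ulam_invariant_density T k f"
  obtains s where "antimono s" "\<And>x. 0 \<le> s x" "AE x in unit_leb. f x = s x"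
    "s 0 \<le> (\<Sum>i\<in>I. s (\<alpha> i) / d i)" "\<And>x. s x \<le> s 0"
    "\<And>m. m < k \<Longrightarrow> (LINT x:{0..<real m / real k}|unit_leb. f x) =
      (LINT x:(T -` {0..<real m / real k} \<inter> {0..1})|unit_leb. f x)"
proof -
  obtain c where fc: "AE x in unit_leb. f x = c (cell_index k x)"
    and c0: "\<And>j. j \<in> {1..k} \<Longrightarrow> 0 \<le> c j"
    and ci: "\<And>j. j \<in> {1..k} \<Longrightarrow> c j = real k * (LINT x:(T -` ulam_cell k j \<inter> {0..1})|unit_leb. f x)"
    and ct: "\<And>j. j \<in> {1..k} \<Longrightarrow> c j = (\<Sum>i=1..k. c i * ulam_transition T k i j)"
    using ulam_invariant_density_coefficients[OF nonsingular k f] by blast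
  define s where "s x = c (cell_index k x)" for x
  have dec: "c j \<le> c i" if "1 \<le> i" "i \<le> j" "j \<le> k" for i j
    using that(2,1,3)
  proof (induction rule: dec_induct)
    case (step m)
    have "c (Suc m) \<le> c m"
      using step by (intro ulam_fixed_vector_decreasing[OF k c0 ct]) auto
    then show ?case using step by simp
  qed simp
  have s: "antimono s"
    unfolding s_def using cell_index_in[OF k] by (intro antimonoI dec cell_index_mono) auto
  have s0: "0 \<le> s x" for x unfolding s_def using cell_index_in[OF k] by (intro c0)
  have s_le: "s x \<le> s 0" for x
    unfolding s_def cell_index_0[OF k] using cell_index_in[OF k, of x] by (intro dec) auto
  have fs: "AE x in unit_leb. f x = s x" using fc by (simp add: s_def)
  have fm: "f \<in> borel_measurable unit_leb"
    using f by (auto simp: ulam_invariant_density_def ulam_space_def L1_def)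
  have sm: "s \<in> borel_measurable unit_leb" by (rule borel_measurable_antimono_unit_leb[OF s])
  have set_eq: "(LINT x:B|unit_leb. f x) = (LINT x:B|unit_leb. s x)" if "B \<in> sets unit_leb" for B
    unfolding set_lebesgue_integral_def
    using fm sm that fs
    by (intro integral_cong_AE borel_measurable_scaleR borel_measurable_indicator) auto
  have cell_vim: "T -` ulam_cell k j \<inter> {0..1} \<in> sets unit_leb" for j
    using vimage_sets[OF ulam_cell_lebesgue] .
  have int: "set_integrable unit_leb B s" if "B \<in> sets unit_leb" for B
    using sm that s0 s_le by (intro set_integrable_bounded[where C = "s 0"]) auto
  have "s 0 \<le> (\<Sum>i\<in>I. s (\<alpha> i) / d i)"
  proof -
    have k1: "1 \<in> {1..k}" using k by simp
    let ?B = "{x \<in> {0..1}. 0 \<le> T x \<and> T x \<le> 0 + 1 / real k}"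
    have "s 0 = real k * (LINT x:(T -` ulam_cell k 1 \<inter> {0..1})|unit_leb. s x)"
      using ci[OF k1] set_eq[OF cell_vim] by (simp add: s_def cell_index_0[OF k])
    also have "\<dots> \<le> real k * (LINT x:?B|unit_leb. s x)"
    proof (intro mult_left_mono)
      have "T -` ulam_cell k 1 \<inter> {0..1} \<subseteq> ?B"
        using k by (auto simp: ulam_cell_def split: if_splits)
      then show "(LINT x:(T -` ulam_cell k 1 \<inter> {0..1})|unit_leb. s x) \<le> (LINT x:?B|unit_leb. s x)"
        unfolding set_lebesgue_integral_def
        using int[OF cell_vim] int[OF vimage_Icc_sets] s0
        by (intro integral_mono) (auto simp: set_integrable_def indicator_def split: if_splits)
    qed simp
    also have "\<dots> \<le> real k * (1 / real k * (\<Sum>i\<in>I. s (\<alpha> i) / d i))"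
      using s s0 by (intro mult_left_mono set_integral_vimage_le) auto
    finally show ?thesis using k by simp
  qed
  \<comment> \<open>For m < k the interval is a union of half-open cells; the closed last cell never
    enters.\<close>
  moreover have "(LINT x:{0..<real m / real k}|unit_leb. f x) =
      (LINT x:(T -` {0..<real m / real k} \<inter> {0..1})|unit_leb. f x)" if m: "m < k" for m
    using m
  proof (induction m)
    case 0
    then show ?case by (simp add: set_lebesgue_integral_def)
  next
    case (Suc m)
    let ?J = "ulam_cell k (Suc m)" and ?E = "{0..<real m / real k}"
    have J: "Suc m \<in> {1..k}" using Suc by simp
    have "real m / real k \<le> 1" using Suc.prems by simp
    then have E: "?E \<in> sets unit_leb" unfolding sets_unit_leb_iff by auto
    have JE: "ulam_cell k (Suc m) = {real m / real k..<real (Suc m) / real k}"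
      using Suc by (simp add: ulam_cell_def)
    have "real m / real k \<le> real (Suc m) / real k" by (intro divide_right_mono) auto
    then have un: "{0..<real (Suc m) / real k} = ?E \<union> ?J" and dj: "?E \<inter> ?J = {}"
      unfolding JE using ivl_disj_un_two(3)[of 0 "real m / real k"] by auto
    have "(LINT x:?J|unit_leb. f x) = c (Suc m) / real k"
    proof -
      have "(LINT x:?J|unit_leb. f x) = (LINT x:?J|unit_leb. c (cell_index k x))"
        using set_eq[OF sets_ulam_cell[OF J]] by (simp add: s_def)
      also have "\<dots> = (LINT x:?J|unit_leb. c (Suc m))"
        unfolding set_lebesgue_integral_def
        using mem_ulam_cell_iff[OF k J] ulam_cell_subset[OF J]
        by (intro Bochner_Integration.integral_cong refl) (auto simp: indicator_def)
      also have "\<dots> = c (Suc m) / real k"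
        using measure_ulam_cell[OF J] ulam_cell_subset[OF J] sets_ulam_cell[OF J]
        by (simp add: set_lebesgue_integral_def Int_absorb2)
      finally show ?thesis .
    qed
    also have "\<dots> = (LINT x:(T -` ?J \<inter> {0..1})|unit_leb. f x)"
      using ci[OF J] k by simp
    finally have J_eq: "(LINT x:?J|unit_leb. f x) = (LINT x:(T -` ?J \<inter> {0..1})|unit_leb. f x)" .
    have fi: "set_integrable unit_leb B f" if "B \<in> sets unit_leb" for B
      using f that unfolding set_integrable_def
      by (intro integrable_mult_indicator) (auto simp: ulam_invariant_density_def ulam_space_def L1_def)
    have vE: "T -` ?E \<inter> {0..1} \<in> sets unit_leb" by (rule vimage_sets) simp
    have "(LINT x:{0..<real (Suc m) / real k}|unit_leb. f x) = (LINT x:?E|unit_leb. f x) + (LINT x:?J|unit_leb. f x)"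
      unfolding un by (rule set_integral_Un[OF dj fi[OF E] fi[OF sets_ulam_cell[OF J]]])
    also have "\<dots> = (LINT x:(T -` ?E \<inter> {0..1})|unit_leb. f x) + (LINT x:(T -` ?J \<inter> {0..1})|unit_leb. f x)"
      using Suc J_eq by simp
    also have "\<dots> = (LINT x:(T -` ?E \<inter> {0..1}) \<union> (T -` ?J \<inter> {0..1})|unit_leb. f x)"
      by (rule set_integral_Un[symmetric, OF _ fi[OF vE] fi[OF cell_vim]]) (use dj in blast)
    also have "(T -` ?E \<inter> {0..1}) \<union> (T -` ?J \<inter> {0..1}) = T -` {0..<real (Suc m) / real k} \<inter> {0..1}"
      unfolding un by blast
    finally show ?case .
  qed
  ultimately show ?thesis
    using that[OF s s0 fs _ s_le] by blast
qed

end

subsection \<open>Countably many branches\<close>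

lemma convex_on_eq:
  assumes "convex_on S f" "\<And>x. x \<in> S \<Longrightarrow> g x = f x"
  shows "convex_on S g"
  unfolding convex_on_def
proof (intro conjI ballI allI impI)
  show S: "convex S" using assms(1) by (rule convex_on_imp_convex)
  fix x y :: 'a and u v :: real
  assume uv: "x \<in> S" "y \<in> S" "0 \<le> u" "0 \<le> v" "u + v = 1"
  then have "u *\<^sub>R x + v *\<^sub>R y \<in> S" using S by (simp add: convexD)
  then show "g (u *\<^sub>R x + v *\<^sub>R y) \<le> u * g x + v * g y"
    using assms uv by (simp add: convex_on_def)
qed

text \<open>Fixes a witness for the slopes whose existence \<open>piecewise_convex_map\<close>
  asserts.\<close>

locale piecewise_convex =
  fixes \<tau> :: "real \<Rightarrow> real" and a d :: "nat \<Rightarrow> real"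
  assumes map: "piecewise_convex_map \<tau> a"
    and deriv: "1 \<le> j \<Longrightarrow> (\<tau> has_real_derivative d j) (at_right (a j))"
    and deriv_pos: "1 \<le> j \<Longrightarrow> 0 < d j"
    and summable_d: "summable (\<lambda>j. 1 / d (Suc j))"
begin

lemma a_0: "a 0 = 1" and a_less: "a (Suc j) < a j" and a_lim: "a \<longlonglongrightarrow> 0"
  and \<tau>_maps: "x \<in> {0..1} \<Longrightarrow> \<tau> x \<in> {0..1}"
  and \<tau>_cont: "1 \<le> j \<Longrightarrow> continuous_on {a j..<a (j - 1)} \<tau>"
  and \<tau>_conv: "1 \<le> j \<Longrightarrow> convex_on {a j..<a (j - 1)} \<tau>"
  and \<tau>_zero: "1 \<le> j \<Longrightarrow> \<tau> (a j) = 0"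
  using map unfolding piecewise_convex_map_def by blast+

lemma a_decseq: "decseq a"
  by (rule decseq_SucI) (rule less_imp_le[OF a_less])

lemma a_nonneg: "0 \<le> a j"
  using decseq_ge[OF a_decseq a_lim] .

lemma a_pos: "0 < a j"
  using a_less[of j] a_nonneg[of "Suc j"] by linarith

lemma a_le_1: "a j \<le> 1"
  using decseqD[OF a_decseq, of 0 j] a_0 by simp

lemma a_pred_less: "1 \<le> j \<Longrightarrow> a j < a (j - 1)"
  using a_less[of "j - 1"] by simp

lemma a_le_pred: "i < j \<Longrightarrow> a (j - 1) \<le> a i"
  by (rule decseqD[OF a_decseq]) simp

lemma branch_disjoint:
  assumes "1 \<le> i" "1 \<le> j" "x \<in> {a i..<a (i - 1)}" "x \<in> {a j..<a (j - 1)}"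
  shows "i = j"
  using a_le_pred[of i j] a_le_pred[of j i] assms by (cases i j rule: linorder_cases) auto

lemma ex_branch:
  assumes "a n \<le> x" "x < 1"
  shows "\<exists>j. 1 \<le> j \<and> j \<le> n \<and> x \<in> {a j..<a (j - 1)}"
proof -
  define j where "j = (LEAST j. a j \<le> x)"
  have j: "a j \<le> x" unfolding j_def by (rule LeastI[of _ n]) (rule assms)
  have jn: "j \<le> n" unfolding j_def by (rule Least_le) (rule assms)
  have "j \<noteq> 0" using j a_0 assms by (intro notI) auto
  moreover from this have "\<not> a (j - 1) \<le> x"
    unfolding j_def by (intro not_less_Least) simp
  ultimately show ?thesis using j jn by (intro exI[of _ j]) auto
qed

lemma slope_branch:
  "1 \<le> j \<Longrightarrow> a j \<le> x \<Longrightarrow> x \<le> y \<Longrightarrow> y < a (j - 1) \<Longrightarrow> d j * (y - x) \<le> \<tau> y - \<tau> x"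
  by (rule convex_on_right_derivative_le_slope[OF \<tau>_conv deriv])

lemma nonsingular_\<tau>: "nonsingular_map \<tau>"
proof -
  interpret convex_branches \<tau> "{1..}" a "\<lambda>j. a (j - 1)" d
  proof
    show "0 \<le> a i \<and> a i < a (i - 1) \<and> a (i - 1) \<le> 1" if "i \<in> {1..}" for i
      using a_nonneg[of i] a_le_1[of "i - 1"] a_pred_less[of i] that by simp
    show "i = j" if "i \<in> {1..}" "j \<in> {1..}" "x \<in> {a i..<a (i - 1)}" "x \<in> {a j..<a (j - 1)}" for i j x
      using branch_disjoint[OF _ _ that(3,4)] that(1,2) by simp
    show "d i * (y - x) \<le> \<tau> y - \<tau> x" if "i \<in> {1..}" "a i \<le> x" "x \<le> y" "y < a (i - 1)" for i x y
      using slope_branch[OF _ that(2-4)] that(1) by simp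
    fix x :: real assume x: "0 < x" "x < 1"
    have "eventually (\<lambda>n. a n < x) sequentially"
      using a_lim x(1) by (rule order_tendstoD(2))
    then obtain n where "a n \<le> x"
      using eventually_happens by (fastforce intro: less_imp_le)
    then show "\<exists>i\<in>{1..}. x \<in> {a i..<a (i - 1)}"
      using ex_branch[of n x] x by auto
  qed (use \<tau>_maps \<tau>_cont \<tau>_conv \<tau>_zero deriv_pos in auto)
  show ?thesis by (rule nonsingular)
qed

text \<open>Index 0 stands for the linear branch on [0, a n), index j >= 1 for the branch of \<tau>
  that starts at a j.\<close>

definition left_end :: "nat \<Rightarrow> real" where "left_end j = (if j = 0 then 0 else a j)"

definition right_end :: "nat \<Rightarrow> nat \<Rightarrow> real" where "right_end n j = (if j = 0 then a n else a (j - 1))"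

definition left_slope :: "nat \<Rightarrow> nat \<Rightarrow> real" where "left_slope n j = (if j = 0 then 1 / a n else d j)"

lemma approx_map_branches:
  assumes n: "1 \<le> n"
  obtains e where "finite_convex_branches (approx_map \<tau> a n) {..n} left_end (right_end n) (left_slope n) e"
proof -
  define \<delta> where "\<delta> = Min (d ` {1..n})"
  have \<delta>: "0 < \<delta>" "\<And>j. 1 \<le> j \<Longrightarrow> j \<le> n \<Longrightarrow> \<delta> \<le> d j"
    using n deriv_pos by (auto simp: \<delta>_def)
  have an: "a n < 1" using a_less[of 0] decseqD[OF a_decseq n] a_0 by simp
  have T: "approx_map \<tau> a n x = (if j = 0 then x / a n else \<tau> x)"
    if "j \<in> {..n}" "x \<in> {left_end j..<right_end n j}" for j x
    using that decseqD[OF a_decseq, of j n] by (auto simp: approx_map_def left_end_def right_end_def)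
  \<comment> \<open>The shift e must satisfy e < e / a n on the linear branch, true as a n < 1, and
    it suffices that e < a i * d i on the others. There a n * \<delta> is a lower bound of a i * d
    i; halving it gives strictness.\<close>
  have "finite_convex_branches (approx_map \<tau> a n) {..n} left_end (right_end n) (left_slope n) (a n * \<delta> / 2)"
  proof
    fix i assume "i \<in> {..n}"
    show "0 \<le> left_end i \<and> left_end i < right_end n i \<and> right_end n i \<le> 1"
      using a_pos a_le_1 a_nonneg a_pred_less[of i] by (auto simp: left_end_def right_end_def)
  next
    fix i j x assume ij: "i \<in> {..n}" "j \<in> {..n}" "x \<in> {left_end i..<right_end n i}" "x \<in> {left_end j..<right_end n j}"
    then show "i = j"
      using branch_disjoint[of i j x] decseqD[OF a_decseq, of i n] decseqD[OF a_decseq, of j n]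
      by (auto simp: left_end_def right_end_def split: if_splits)
  next
    have cov: "\<exists>i\<in>{..n}. x \<in> {left_end i..<right_end n i}" if x: "0 \<le> x" "x < 1" for x
    proof (cases "x < a n")
      case True
      then show ?thesis using x by (intro bexI[of _ 0]) (auto simp: left_end_def right_end_def)
    next
      case False
      then obtain j where "1 \<le> j" "j \<le> n" "x \<in> {a j..<a (j - 1)}" using ex_branch[of n x] x by auto
      then show ?thesis by (intro bexI[of _ j]) (auto simp: left_end_def right_end_def)
    qed
    show "\<exists>i\<in>{..n}. x \<in> {left_end i..<right_end n i}" if "0 < x" "x < 1" for x
      using that by (intro cov) auto
    show "\<exists>i\<in>{..n}. 0 \<in> {left_end i..<right_end n i}" by (intro cov) auto
  next
    fix x :: real assume x: "x \<in> {0..1}"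
    then show "approx_map \<tau> a n x \<in> {0..1}"
      using \<tau>_maps[OF x] a_pos[of n] by (auto simp: approx_map_def)
  next
    fix i assume i: "i \<in> {..n}"
    have "continuous_on {left_end i..<right_end n i} (\<lambda>x. if i = 0 then x / a n else \<tau> x)"
      using \<tau>_cont[of i] a_pos[of n] by (auto simp: left_end_def right_end_def intro!: continuous_intros)
    then show "continuous_on {left_end i..<right_end n i} (approx_map \<tau> a n)"
      by (rule continuous_on_eq) (simp only: T[OF i])
    have "convex_on {left_end i..<right_end n i} (\<lambda>x. if i = 0 then x / a n else \<tau> x)"
    proof (cases "i = 0")
      case True
      have "convex_on {0..<a n} (\<lambda>x. x / a n)"
        by (rule convex_onI) (auto simp: algebra_simps add_divide_distrib diff_divide_distrib)
      then show ?thesis using True by (simp add: left_end_def right_end_def)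
    next
      case False
      then show ?thesis using \<tau>_conv[of i] by (simp add: left_end_def right_end_def)
    qed
    then show "convex_on {left_end i..<right_end n i} (approx_map \<tau> a n)"
      by (rule convex_on_eq) (simp only: T[OF i])
    show "approx_map \<tau> a n (left_end i) = 0"
      using T[OF i, of "left_end i"] a_pos[of n] a_pred_less[of i] \<tau>_zero[of i]
      by (auto simp: left_end_def right_end_def split: if_splits)
    show "0 < left_slope n i"
      using a_pos[of n] deriv_pos[of i] by (auto simp: left_slope_def)
    show "left_slope n i * (y - x) \<le> approx_map \<tau> a n y - approx_map \<tau> a n x"
      if xy: "left_end i \<le> x" "x \<le> y" "y < right_end n i" for x y
    proof -
      have "approx_map \<tau> a n x = (if i = 0 then x / a n else \<tau> x)"
        "approx_map \<tau> a n y = (if i = 0 then y / a n else \<tau> y)"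
        using T[OF i, of x] T[OF i, of y] xy by simp_all
      then show ?thesis
        using xy slope_branch[of i x y]
        by (auto simp: left_slope_def left_end_def right_end_def diff_divide_distrib)
    qed
    show "a n * \<delta> / 2 < (left_end i + a n * \<delta> / 2) * left_slope n i"
    proof (cases "i = 0")
      case True
      have "a n * \<delta> / 2 < (a n * \<delta> / 2) / a n"
        using an \<delta>(1) a_pos[of n] by (simp add: field_simps)
      then show ?thesis using True by (simp add: left_end_def left_slope_def)
    next
      case False
      have "a n * \<delta> / 2 < a n * \<delta>" using a_pos[of n] \<delta>(1) by simp
      also have "\<dots> \<le> a i * d i"
        using False i \<delta> a_nonneg decseqD[OF a_decseq, of i n] by (intro mult_mono) auto
      also have "\<dots> \<le> (a i + a n * \<delta> / 2) * d i"
        using False deriv_pos[of i] \<delta>(1) a_nonneg by (intro mult_right_mono) auto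
      finally show ?thesis using False by (simp add: left_end_def left_slope_def)
    qed
  next
    show "finite {..n}" by simp
    show "0 < a n * \<delta> / 2" using a_pos \<delta>(1) by simp
  qed
  then show ?thesis by (rule that)
qed

section \<open>Estimates uniform in the number of branches\<close>

lemma sum_branches:
  "(\<Sum>j\<le>n. g (left_end j) / left_slope n j) = g 0 * a n + (\<Sum>j=1..n. g (a j) / d j)"
proof -
  have "{..n} = insert 0 {1..n}" by auto
  then show ?thesis by (simp add: left_end_def left_slope_def)
qed

text \<open>A branch starts at 0, rises with slope at least d and stays below 1, which limits its
  length.\<close>

lemma gap_le: "a j - a (Suc j) \<le> 1 / d (Suc j)"
proof -
  let ?j = "Suc j"
  have "y \<le> a ?j + 1 / d ?j" if y: "a ?j < y" "y < a j" for y
  proof -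
    have "d ?j * (y - a ?j) \<le> \<tau> y - \<tau> (a ?j)" using slope_branch[of ?j "a ?j" y] y by simp
    also have "\<dots> \<le> 1" using \<tau>_zero[of ?j] \<tau>_maps[of y] y a_nonneg[of ?j] a_le_1[of j] by simp
    finally have "y - a ?j \<le> 1 / d ?j"
      using deriv_pos[of ?j] by (simp add: pos_le_divide_eq mult.commute)
    then show ?thesis by simp
  qed
  then have "a j \<le> a ?j + 1 / d ?j"
    by (rule dense_le_bounded[OF a_less])
  then show ?thesis by simp
qed

text \<open>The omitted branches fill the interval from 0 to a n, so their lengths sum to a
  n.\<close>

lemma a_le_tail: "a n \<le> (\<Sum>j. 1 / d (Suc (j + n)))"
proof -
  have "(\<lambda>j. a (j + n)) \<longlonglongrightarrow> 0" using a_lim by (rule LIMSEQ_ignore_initial_segment)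
  then have sums: "(\<lambda>j. a (j + n) - a (Suc j + n)) sums (a (0 + n) - 0)"
    by (rule telescope_sums')
  have "a n = (\<Sum>j. a (j + n) - a (Suc j + n))"
    using sums_unique[OF sums] by simp
  also have "\<dots> \<le> (\<Sum>j. 1 / d (Suc (j + n)))"
    using gap_le sums_summable[OF sums] summable_ignore_initial_segment[OF summable_d, of n]
    by (intro suminf_le) auto
  finally show ?thesis .
qed

text \<open>With this bound the preimage of a short interval has measure at most a constant times
  its length, uniformly in n. One copy of the series pays for the linear branch, since a n <= 1 and
  1 is the total length of all branches; the other pays for the remaining branches.\<close>

lemma sum_inverse_left_slope_le:
  "(\<Sum>j\<le>n. 1 / left_slope n j) \<le> 2 * (\<Sum>j. 1 / d (Suc j))"
proof -
  have "(\<Sum>j\<le>n. 1 / left_slope n j) = a n + (\<Sum>j=1..n. 1 / d j)"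
    using sum_branches[of "\<lambda>_. 1" n] by simp
  also have "(\<Sum>j=1..n. 1 / d j) = (\<Sum>j<n. 1 / d (Suc j))"
    by (rule sum.reindex_bij_witness[of _ Suc "\<lambda>j. j - 1"]) auto
  also have "a n \<le> (\<Sum>j. 1 / d (Suc j))"
    using a_le_tail[of 0] a_0 a_le_1[of n] by simp
  also have "(\<Sum>j<n. 1 / d (Suc j)) \<le> (\<Sum>j. 1 / d (Suc j))"
    using summable_d deriv_pos by (intro sum_le_suminf) (auto simp: less_imp_le)
  finally show ?thesis by simp
qed

text \<open>On [0, y] the density is at least s y, so the mass there is at least s y * y.\<close>

lemma antimono_le_inverse:
  assumes s: "antimono s" "\<And>x. 0 \<le> s x" "\<And>x. s x \<le> s 0"
    and int: "(LINT x|unit_leb. s x) = 1" and y: "0 < y" "y \<le> (1::real)"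
  shows "s y \<le> 1 / y"
proof -
  have si: "integrable unit_leb s"
    using s by (intro unit_leb.integrable_const_bound[where B = "s 0"] borel_measurable_antimono_unit_leb) auto
  have yy: "{0..y} \<in> sets unit_leb" using y by (auto simp: sets_unit_leb_iff)
  then have "s y * y = (LINT x|unit_leb. s y * indicator {0..y} x)"
    using y by (simp add: measure_unit_leb_Icc Int_absorb2)
  also have "\<dots> \<le> (LINT x|unit_leb. s x)"
  proof (rule integral_mono[OF _ si])
    show "integrable unit_leb (\<lambda>x. s y * indicator {0..y} x)"
      using yy by (intro integrable_mult_right integrable_unit_leb_indicator)
    show "s y * indicator {0..y} x \<le> s x" for x
      using s(2)[of x] antimonoD[OF s(1), of x y] by (simp add: indicator_def)
  qed
  finally show ?thesis using int y by (simp add: field_simps)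
qed

text \<open>
  A Lasota--Yorke estimate at \<open>0\<close>, uniform in \<open>n\<close>: the linear branch of the \<open>n\<close>-th map
  contributes \<open>a n\<close>, which the omitted branches dominate.
\<close>

lemma density_bound:
  obtains B where "0 \<le> B"
    "\<And>n s. 1 \<le> n \<Longrightarrow> antimono s \<Longrightarrow> (\<And>x. 0 \<le> s x) \<Longrightarrow> (\<And>x. s x \<le> s 0) \<Longrightarrow>
      (LINT x|unit_leb. s x) = 1 \<Longrightarrow> s 0 \<le> (\<Sum>j\<le>n. s (left_end j) / left_slope n j) \<Longrightarrow> s 0 \<le> B"
proof -
  let ?r = "\<lambda>N. \<Sum>j. 1 / d (Suc (j + N))"
  have "?r \<longlonglongrightarrow> 0" using suminf_exist_split2[OF summable_d] by simp
  then have "eventually (\<lambda>N. ?r N < 1) sequentially"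
    by (rule order_tendstoD) simp
  then obtain N where N: "?r N < 1" by (auto simp: eventually_sequentially)
  define C where "C = (\<Sum>j=1..N. 1 / (a j * d j))"
  \<comment> \<open>The tail is the coefficient of s 0 when n > N. For n <= N all branches from
    \<tau> go into \<open>C\<close>, and only a n <= a 1 < 1 remains as the coefficient.\<close>
  define \<rho> where "\<rho> = max (?r N) (a 1)"
  have \<rho>1: "\<rho> < 1" using N a_less[of 0] a_0 by (simp add: \<rho>_def)
  have C0: "0 \<le> C" unfolding C_def using a_pos deriv_pos by (intro sum_nonneg) (simp add: less_imp_le)
  show ?thesis
  proof (rule that[of "C / (1 - \<rho>)"])
    show "0 \<le> C / (1 - \<rho>)" using C0 \<rho>1 by simp
    fix n :: nat and s :: "real \<Rightarrow> real"
    assume n: "1 \<le> n" and s: "antimono s" "\<And>x. 0 \<le> s x" "\<And>x. s x \<le> s 0"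
      and int: "(LINT x|unit_leb. s x) = 1" and le: "s 0 \<le> (\<Sum>j\<le>n. s (left_end j) / left_slope n j)"
    let ?t = "\<lambda>j. s (a j) / d j"
    have t0: "0 \<le> ?t j" if "1 \<le> j" for j using s(2)[of "a j"] deriv_pos[OF that] by simp
    have t1: "?t j \<le> 1 / (a j * d j)" if j: "1 \<le> j" for j
    proof -
      have "?t j \<le> (1 / a j) / d j"
        using antimono_le_inverse[OF s int a_pos a_le_1, of j] deriv_pos[OF j]
        by (intro divide_right_mono) auto
      then show ?thesis by simp
    qed
    have "s 0 * a n + (\<Sum>j=1..n. ?t j) \<le> s 0 * \<rho> + C"
    proof (cases "n \<le> N")
      case True
      have "(\<Sum>j=1..n. ?t j) \<le> (\<Sum>j=1..N. ?t j)"
        using True t0 by (intro sum_mono2) auto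
      also have "\<dots> \<le> C" unfolding C_def using t1 by (intro sum_mono) auto
      finally have "(\<Sum>j=1..n. ?t j) \<le> C" .
      moreover have "s 0 * a n \<le> s 0 * \<rho>"
        using decseqD[OF a_decseq n] s(2) by (intro mult_left_mono) (auto simp: \<rho>_def)
      ultimately show ?thesis by simp
    next
      case False
      have "{1..n} = {1..N} \<union> {Suc N..n}" using False by auto
      then have "(\<Sum>j=1..n. ?t j) = (\<Sum>j=1..N. ?t j) + (\<Sum>j=Suc N..n. ?t j)"
        by (simp add: sum.union_disjoint)
      also have "(\<Sum>j=1..N. ?t j) \<le> C" unfolding C_def using t1 by (intro sum_mono) auto
      also have "(\<Sum>j=Suc N..n. ?t j) \<le> (\<Sum>j=Suc N..n. s 0 * (1 / d j))"
      proof (rule sum_mono)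
        fix j assume "j \<in> {Suc N..n}"
        then show "?t j \<le> s 0 * (1 / d j)"
          using s(3)[of "a j"] deriv_pos[of j] by (simp add: divide_right_mono)
      qed
      also have "\<dots> = s 0 * (\<Sum>j<n - N. 1 / d (Suc (j + N)))"
        unfolding sum_distrib_left
        by (rule sum.reindex_bij_witness[of _ "\<lambda>j. Suc (j + N)" "\<lambda>j. j - Suc N"]) auto
      finally have "s 0 * a n + (\<Sum>j=1..n. ?t j) \<le> s 0 * (a n + (\<Sum>j<n - N. 1 / d (Suc (j + N)))) + C"
        by (simp add: distrib_left)
      \<comment> \<open>The linear branch costs at most the tail after n, which completes the
        partial sum to the tail after N.\<close>
      also have "a n + (\<Sum>j<n - N. 1 / d (Suc (j + N))) \<le> ?r N"
        using suminf_split_initial_segment[OF summable_ignore_initial_segment[OF summable_d, of N], of "n - N"]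
          a_le_tail[of n] False by (simp add: add.assoc)
      also have "?r N \<le> \<rho>" by (simp add: \<rho>_def)
      finally show ?thesis using s(2) by (simp add: mult_left_mono)
    qed
    with le have "s 0 * (1 - \<rho>) \<le> C" by (simp add: sum_branches algebra_simps)
    then show "s 0 \<le> C / (1 - \<rho>)" using \<rho>1 by (simp add: pos_le_divide_eq)
  qed
qed

end

subsection \<open>Weak compactness of decreasing functions\<close>

lemma L1_dual_add:
  "\<phi> \<in> L1_dual \<Longrightarrow> f \<in> L1 \<Longrightarrow> g \<in> L1 \<Longrightarrow> \<phi> (\<lambda>x. f x + g x) = \<phi> f + \<phi> g"
  by (simp add: L1_dual_def)

lemma L1_dual_AE_eq:
  assumes \<phi>: "\<phi> \<in> L1_dual" and f: "f \<in> L1" and g: "g \<in> L1" and AE: "AE x in unit_leb. f x = g x"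
  shows "\<phi> f = \<phi> g"
proof -
  obtain C where C: "\<And>f. f \<in> L1 \<Longrightarrow> \<bar>\<phi> f\<bar> \<le> C * L1_norm f"
    using \<phi> unfolding L1_dual_def by blast
  have d: "(\<lambda>x. f x - g x) \<in> L1" using f g by (simp add: L1_def)
  have "L1_norm (\<lambda>x. f x - g x) = (LINT x|unit_leb. 0)"
    unfolding L1_norm_def using AE f g by (intro integral_cong_AE) (auto simp: L1_def)
  then have "\<phi> (\<lambda>x. f x - g x) = 0" using C[OF d] by simp
  moreover have "\<phi> (\<lambda>x. g x + (f x - g x)) = \<phi> g + \<phi> (\<lambda>x. f x - g x)"
    using \<phi> g d by (rule L1_dual_add)
  ultimately show ?thesis by simp
qed

lemma L1_dual_diff:
  assumes \<phi>: "\<phi> \<in> L1_dual" and f: "f \<in> L1" and g: "g \<in> L1"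
  shows "\<phi> (\<lambda>x. f x - g x) = \<phi> f - \<phi> g"
proof -
  have "(\<lambda>x. f x - g x) \<in> L1" using f g by (simp add: L1_def)
  then have "\<phi> (\<lambda>x. g x + (f x - g x)) = \<phi> g + \<phi> (\<lambda>x. f x - g x)"
    using L1_dual_add[OF \<phi> g] by blast
  then show ?thesis by simp
qed

lemma set_integral_in_L1_dual:
  assumes A: "A \<in> sets unit_leb"
  shows "(\<lambda>f. LINT x:A|unit_leb. f x) \<in> L1_dual"
proof -
  have si: "set_integrable unit_leb A f" if "f \<in> L1" for f
    using integrable_mult_indicator[OF A, of f] that by (simp add: L1_def set_integrable_def)
  have "\<bar>LINT x:A|unit_leb. f x\<bar> \<le> 1 * L1_norm f" if "f \<in> L1" for f
  proof -
    have "\<bar>LINT x:A|unit_leb. f x\<bar> \<le> (LINT x|unit_leb. \<bar>indicator A x *\<^sub>R f x\<bar>)"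
      unfolding set_lebesgue_integral_def by (rule integral_abs_bound)
    also have "\<dots> \<le> (LINT x|unit_leb. \<bar>f x\<bar>)"
      using that si[OF that] by (intro integral_mono) (auto simp: L1_def set_integrable_def indicator_def)
    finally show ?thesis by (simp add: L1_norm_def)
  qed
  then show ?thesis
    unfolding L1_dual_def using si by (auto simp: set_integral_add(2) intro!: exI[of _ 1])
qed

lemma openin_weak_L1_basic:
  "\<phi> \<in> L1_dual \<Longrightarrow> open U \<Longrightarrow> openin weak_L1 {f \<in> L1. \<phi> f \<in> U}"
  unfolding weak_L1_def by (rule topology_generated_by_Basis) blast

lemma limitin_weak_L1_dual:
  assumes lim: "limitin weak_L1 f g F" and \<phi>: "\<phi> \<in> L1_dual"
  shows "((\<lambda>j. \<phi> (f j)) \<longlongrightarrow> \<phi> g) F"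
proof (rule topological_tendstoI)
  fix U assume U: "open U" "\<phi> g \<in> U"
  have "g \<in> L1" using limitin_topspace[OF lim] by simp
  then have "eventually (\<lambda>j. f j \<in> {f \<in> L1. \<phi> f \<in> U}) F"
    using lim openin_weak_L1_basic[OF \<phi> U(1)] U(2) unfolding limitin_def by blast
  then show "eventually (\<lambda>j. \<phi> (f j) \<in> U) F"
    by eventually_elim simp
qed

text \<open>Functions on which all functionals agree lie in the same generating sets, and unions and
  finite intersections inherit this. It does the work of passing to the quotient.\<close>

lemma openin_weak_L1_saturated:
  assumes "openin weak_L1 U" and fg: "f \<in> L1" "g \<in> L1" "\<And>\<phi>. \<phi> \<in> L1_dual \<Longrightarrow> \<phi> f = \<phi> g"
  shows "f \<in> U \<longleftrightarrow> g \<in> U"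
proof -
  have "generate_topology_on {{f \<in> L1. \<phi> f \<in> U} | \<phi> U. \<phi> \<in> L1_dual \<and> open U} U"
    using assms(1) unfolding weak_L1_def openin_topology_generated_by_iff .
  then show ?thesis
  proof induction
    case (Basis s)
    then obtain \<phi> U where "s = {f \<in> L1. \<phi> f \<in> U}" "\<phi> \<in> L1_dual" by blast
    then show ?case using fg(1,2) fg(3)[of \<phi>] by simp
  qed auto
qed

text \<open>On this set pointwise convergence, even along nets, implies convergence in \<open>L\<^sup>1\<close>, so Tychonoff's
  theorem yields compactness.\<close>

definition antimono_upto :: "real \<Rightarrow> (real \<Rightarrow> real) set" where
  "antimono_upto B = {h. antimono h \<and> (\<forall>x. 0 \<le> h x \<and> h x \<le> B)}"

lemma antimono_upto_L1: "h \<in> antimono_upto B \<Longrightarrow> h \<in> L1"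
  unfolding antimono_upto_def L1_def
  by (auto intro!: unit_leb.integrable_const_bound[where B = B] borel_measurable_antimono_unit_leb)

lemma compact_antimono_upto: "compact (antimono_upto B)"
proof -
  have "compactin (product_topology (\<lambda>_. euclidean) UNIV) (PiE UNIV (\<lambda>_::real. {0..B}))"
    unfolding compactin_PiE by (simp add: compactin_euclidean_iff)
  then have "compact (PiE UNIV (\<lambda>_::real. {0..B}))"
    by (simp add: euclidean_product_topology compactin_euclidean_iff)
  \<comment> \<open>Monotonicity is an intersection of conditions on two coordinates each, closed in
    the product topology.\<close>
  moreover have "antimono_upto B = PiE UNIV (\<lambda>_. {0..B}) \<inter> (\<Inter>x. \<Inter>y\<in>{x..}. {h. h y \<le> h x})"
    by (auto simp: antimono_upto_def PiE_iff antimono_def)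
  moreover have "closed (\<Inter>x. \<Inter>y\<in>{x..}. {h :: real \<Rightarrow> real. h y \<le> h x})"
    by (intro closed_INT ballI closed_Collect_le continuous_on_product_coordinates)
  ultimately show ?thesis by (simp add: compact_Int_closed)
qed

text \<open>On a cell both functions lie between their values at its ends, so they differ by at most
  \<delta> plus the drop of h there. The drops telescope to at most B, weighted by the cell length 1
  / m. Thus a neighbourhood in the product topology controls the norm.\<close>

lemma L1_norm_antimono_diff_le:
  assumes h: "h \<in> antimono_upto B" and h': "h' \<in> antimono_upto B" and m: "1 \<le> m"
    and close: "\<And>i. i \<le> m \<Longrightarrow> \<bar>h' (real i / real m) - h (real i / real m)\<bar> \<le> \<delta>"
  shows "L1_norm (\<lambda>x. h' x - h x) \<le> \<delta> + B / real m"
proof -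
  have anti: "antimono h" "antimono h'" using h h' by (auto simp: antimono_upto_def)
  define c where "c j = \<delta> + (h ((real j - 1) / real m) - h (real j / real m))" for j :: nat
  have int: "integrable unit_leb (\<lambda>x. \<bar>h' x - h x\<bar>)"
    using antimono_upto_L1[OF h] antimono_upto_L1[OF h'] by (simp add: L1_def)
  have step: "c (cell_index m x) = (\<Sum>i=1..m. c i * indicator (ulam_cell m i) x)" if "x \<in> {0..1}" for x
    using step_function_eq[OF m that, of c] by simp
  have "L1_norm (\<lambda>x. h' x - h x) \<le> (LINT x|unit_leb. (\<Sum>i=1..m. c i * indicator (ulam_cell m i) x))"
    unfolding L1_norm_def
  proof (rule integral_mono_AE[OF int])
    show "integrable unit_leb (\<lambda>x. \<Sum>i=1..m. c i * indicator (ulam_cell m i) x)"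
      by (intro Bochner_Integration.integrable_sum integrable_mult_right integrable_unit_leb_indicator sets_ulam_cell)
    have "AE x in unit_leb. x \<notin> {1}"
      by (intro AE_not_in) (simp add: null_sets_unit_leb_iff)
    then show "AE x in unit_leb. \<bar>h' x - h x\<bar> \<le> (\<Sum>i=1..m. c i * indicator (ulam_cell m i) x)"
      using AE_space
    proof eventually_elim
      case (elim x)
      then have x: "0 \<le> x" "x < 1" "x \<in> {0..1}" by auto
      define j where "j = cell_index m x"
      have j: "j \<in> {1..m}" unfolding j_def by (rule cell_index_in[OF m])
      let ?u = "(real j - 1) / real m" and ?v = "real j / real m"
      have uv: "?u \<le> x" "x \<le> ?v" using cell_index_bounds[OF m x(1,2)] by (auto simp: j_def)
      have u: "?u = real (j - 1) / real m" using j by (simp add: of_nat_diff)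
      have 1: "\<bar>h' ?u - h ?u\<bar> \<le> \<delta>" unfolding u using j by (intro close) auto
      have 2: "\<bar>h' ?v - h ?v\<bar> \<le> \<delta>" using j by (intro close) auto
      have "h x \<le> h ?u" "h ?v \<le> h x" "h' x \<le> h' ?u" "h' ?v \<le> h' x"
        using uv anti by (auto intro: antimonoD)
      then have "\<bar>h' x - h x\<bar> \<le> c j" using 1 2 unfolding c_def by linarith
      then show ?case using step[OF x(3)] by (simp add: j_def)
    qed
  qed
  also have "\<dots> = (LINT x:{0..1}|unit_leb. c (cell_index m x))"
    unfolding set_lebesgue_integral_def
    using step by (intro Bochner_Integration.integral_cong refl) simp
  also have "\<dots> = (\<Sum>i=1..m. c i * measure unit_leb (ulam_cell m i \<inter> {0..1}))"
    by (rule set_integral_step_function[OF m]) (simp add: sets_unit_leb_iff)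
  also have "\<dots> = (\<Sum>i=1..m. c i) / real m"
    unfolding sum_divide_distrib
  proof (intro sum.cong refl)
    fix i assume "i \<in> {1..m}"
    then show "c i * measure unit_leb (ulam_cell m i \<inter> {0..1}) = c i / real m"
      using measure_ulam_cell[of i m] ulam_cell_subset[of i m] by (simp add: Int_absorb2)
  qed
  also have "(\<Sum>i=1..m. c i) = real m * \<delta> + (h 0 - h 1)"
  proof -
    have "(\<Sum>i=1..m. h ((real i - 1) / real m) - h (real i / real m)) =
        (\<Sum>i<m. h (real i / real m) - h (real (Suc i) / real m))"
      by (rule sum.reindex_bij_witness[of _ Suc "\<lambda>j. j - 1"]) (auto simp: of_nat_diff)
    also have "\<dots> = h 0 - h 1"
      using m by (subst sum_lessThan_telescope') simp
    finally show ?thesis by (simp add: c_def sum.distrib)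
  qed
  also have "(real m * \<delta> + (h 0 - h 1)) / real m \<le> (real m * \<delta> + B) / real m"
  proof (rule divide_right_mono)
    have "h 0 \<le> B" "0 \<le> h 1" using h by (auto simp: antimono_upto_def)
    then show "real m * \<delta> + (h 0 - h 1) \<le> real m * \<delta> + B" by simp
  qed simp
  also have "\<dots> = \<delta> + B / real m" using m by (simp add: add_divide_distrib)
  finally show ?thesis .
qed

lemma continuous_on_L1_dual_antimono_upto:
  assumes \<phi>: "\<phi> \<in> L1_dual"
  shows "continuous_on (antimono_upto B) \<phi>"
  unfolding continuous_on_def
proof (intro ballI tendstoI)
  fix h \<epsilon> assume h: "h \<in> antimono_upto B" and \<epsilon>: "0 < (\<epsilon> :: real)"
  obtain C where C: "\<And>f. f \<in> L1 \<Longrightarrow> \<bar>\<phi> f\<bar> \<le> C * L1_norm f"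
    using \<phi> unfolding L1_dual_def by blast
  define D where "D = max C 1"
  have D: "0 < D" by (simp add: D_def)
  \<comment> \<open>The norm will be at most 2 * \<delta>, so the functional changes by at most two
    thirds of \<epsilon>. Taking the maximum with 1 keeps the divisor positive.\<close>
  define \<delta> where "\<delta> = \<epsilon> / (3 * D)"
  have \<delta>: "0 < \<delta>" using \<epsilon> D by (simp add: \<delta>_def)
  obtain m0 :: nat where m0: "B / \<delta> < real m0" using reals_Archimedean2 by blast
  define m where "m = Suc m0"
  have m: "1 \<le> m" "B / real m \<le> \<delta>"
    using m0 \<delta> by (auto simp: m_def field_simps)
  let ?V = "{h'. \<forall>i\<in>{..m}. h' (real i / real m) \<in> ball (h (real i / real m)) \<delta>}"
  have "open ?V"
    by (rule product_topology_basis') auto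
  moreover have "h \<in> ?V" using \<delta> by simp
  moreover have "dist (\<phi> h') (\<phi> h) < \<epsilon>" if "h' \<in> ?V" "h' \<in> antimono_upto B" for h'
  proof -
    note L = antimono_upto_L1[OF h] antimono_upto_L1[OF that(2)]
    have d: "(\<lambda>x. h' x - h x) \<in> L1" using L by (simp add: L1_def)
    have "L1_norm (\<lambda>x. h' x - h x) \<le> \<delta> + B / real m"
    proof (rule L1_norm_antimono_diff_le[OF h that(2) m(1)])
      fix i assume "i \<le> m"
      then have "dist (h (real i / real m)) (h' (real i / real m)) < \<delta>" using that(1) by simp
      then show "\<bar>h' (real i / real m) - h (real i / real m)\<bar> \<le> \<delta>" by (simp add: dist_real_def)
    qed
    also have "\<dots> \<le> 2 * \<delta>" using m(2) by simp
    finally have n: "L1_norm (\<lambda>x. h' x - h x) \<le> 2 * \<delta>" .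
    have n0: "0 \<le> L1_norm (\<lambda>x. h' x - h x)" by (simp add: L1_norm_def)
    have "dist (\<phi> h') (\<phi> h) = \<bar>\<phi> (\<lambda>x. h' x - h x)\<bar>"
      using L1_dual_diff[OF \<phi> L(2,1)] by (simp add: dist_real_def)
    also have "\<dots> \<le> C * L1_norm (\<lambda>x. h' x - h x)" using C[OF d] .
    also have "\<dots> \<le> D * L1_norm (\<lambda>x. h' x - h x)"
      using n0 by (intro mult_right_mono) (auto simp: D_def)
    also have "\<dots> \<le> D * (2 * \<delta>)"
      using n D by (intro mult_left_mono) auto
    also have "\<dots> < \<epsilon>" using D \<epsilon> by (simp add: \<delta>_def)
    finally show ?thesis .
  qed
  ultimately show "eventually (\<lambda>h'. dist (\<phi> h') (\<phi> h) < \<epsilon>) (at h within antimono_upto B)"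
    unfolding eventually_at_topological by blast
qed

text \<open>By continuity of every functional, the identity is continuous from the product topology
  on this set to the weak one and carries compactness over.\<close>

lemma compactin_weak_L1_antimono_upto: "compactin weak_L1 (antimono_upto B)"
proof -
  let ?X = "top_of_set (antimono_upto B)"
  have "continuous_map ?X weak_L1 (\<lambda>h. h)"
    unfolding weak_L1_def continuous_on_generated_topo_iff
  proof (intro conjI allI impI)
    fix W assume "W \<in> {{f \<in> L1. \<phi> f \<in> U} | \<phi> U. \<phi> \<in> L1_dual \<and> open U}"
    then obtain \<phi> U where W: "W = {f \<in> L1. \<phi> f \<in> U}" and \<phi>: "\<phi> \<in> L1_dual" "open U" by blast
    have "openin ?X (antimono_upto B \<inter> \<phi> -` U)"
      by (rule continuous_openin_preimage_gen[OF continuous_on_L1_dual_antimono_upto[OF \<phi>(1)] \<phi>(2)])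
    moreover have "(\<lambda>h. h) -` W \<inter> topspace ?X = antimono_upto B \<inter> \<phi> -` U"
      using antimono_upto_L1 by (auto simp: W)
    ultimately show "openin ?X ((\<lambda>h. h) -` W \<inter> topspace ?X)" by simp
  next
    have "topspace ?X \<subseteq> topspace weak_L1" using antimono_upto_L1 by auto
    then show "(\<lambda>h. h) ` topspace ?X \<subseteq> \<Union> {{f \<in> L1. \<phi> f \<in> U} | \<phi> U. \<phi> \<in> L1_dual \<and> open U}"
      unfolding weak_L1_def topology_generated_by_topspace by simp
  qed
  moreover have "compactin ?X (antimono_upto B)"
    using compact_antimono_upto by (simp add: compactin_subtopology compactin_euclidean_iff)
  ultimately have "compactin weak_L1 ((\<lambda>h. h) ` antimono_upto B)"
    by (rule image_compactin[rotated])
  then show ?thesis by simp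
qed

text \<open>All functions that the weak topology cannot tell from a member of X. Functionals include
  integration over every measurable set, so these are the functions equal almost everywhere to a
  member of X, when X consists of integrable functions.\<close>

definition weak_saturation :: "(real \<Rightarrow> real) set \<Rightarrow> (real \<Rightarrow> real) set" where
  "weak_saturation X = {g \<in> L1. \<exists>h\<in>X. \<forall>\<phi>\<in>L1_dual. \<phi> g = \<phi> h}"

text \<open>Open sets are saturated, so a finite cover of X already covers the saturation.\<close>

lemma compactin_weak_saturation:
  assumes "compactin weak_L1 X"
  shows "compactin weak_L1 (weak_saturation X)"
  unfolding compactin_def
proof (intro conjI allI impI)
  have X: "X \<subseteq> L1" using compactin_subset_topspace[OF assms] by simp
  show "weak_saturation X \<subseteq> topspace weak_L1" by (auto simp: weak_saturation_def)
  fix \<U> assume \<U>: "(\<forall>U\<in>\<U>. openin weak_L1 U) \<and> weak_saturation X \<subseteq> \<Union> \<U>"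
  have "X \<subseteq> weak_saturation X" using X by (auto simp: weak_saturation_def)
  then obtain \<F> where \<F>: "finite \<F>" "\<F> \<subseteq> \<U>" "X \<subseteq> \<Union> \<F>"
    using assms \<U> unfolding compactin_def by (metis subset_trans)
  have "weak_saturation X \<subseteq> \<Union> \<F>"
  proof
    fix g assume "g \<in> weak_saturation X"
    then obtain h where h: "g \<in> L1" "h \<in> X" "\<And>\<phi>. \<phi> \<in> L1_dual \<Longrightarrow> \<phi> g = \<phi> h"
      by (auto simp: weak_saturation_def)
    then obtain U where "U \<in> \<F>" "h \<in> U" using \<F> by blast
    then show "g \<in> \<Union> \<F>"
      using openin_weak_L1_saturated[of U g h] h \<U> \<F> X by blast
  qed
  then show "\<exists>\<F>. finite \<F> \<and> \<F> \<subseteq> \<U> \<and> weak_saturation X \<subseteq> \<Union> \<F>"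
    using \<F> by blast
qed

text \<open>The usual argument that compact sets are closed in a Hausdorff space: a point outside
  the saturation is separated from each member of X by a functional, with balls of half the
  distance.\<close>

lemma closedin_weak_saturation:
  assumes X: "compactin weak_L1 X"
  shows "closedin weak_L1 (weak_saturation X)"
  unfolding closedin_def
proof (intro conjI)
  show "weak_saturation X \<subseteq> topspace weak_L1" by (auto simp: weak_saturation_def)
  show "openin weak_L1 (topspace weak_L1 - weak_saturation X)"
  proof (subst openin_subopen, intro ballI)
    fix g assume "g \<in> topspace weak_L1 - weak_saturation X"
    then have g: "g \<in> L1" and "\<forall>h\<in>X. \<exists>\<phi>\<in>L1_dual. \<phi> g \<noteq> \<phi> h"
      by (auto simp: weak_saturation_def)
    then obtain \<Phi> where \<Phi>: "\<And>h. h \<in> X \<Longrightarrow> \<Phi> h \<in> L1_dual" "\<And>h. h \<in> X \<Longrightarrow> \<Phi> h g \<noteq> \<Phi> h h"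
      by metis
    define r where "r h = dist (\<Phi> h g) (\<Phi> h h) / 2" for h
    define U where "U h = {f \<in> L1. \<Phi> h f \<in> ball (\<Phi> h h) (r h)}" for h
    define V where "V h = {f \<in> L1. \<Phi> h f \<in> ball (\<Phi> h g) (r h)}" for h
    have XL: "X \<subseteq> L1" using compactin_subset_topspace[OF X] by simp
    have r: "0 < r h" if "h \<in> X" for h using \<Phi>(2)[OF that] by (simp add: r_def)
    have "\<forall>W\<in>U ` X. openin weak_L1 W"
      unfolding U_def using \<Phi>(1) openin_weak_L1_basic open_ball by blast
    moreover have "X \<subseteq> \<Union> (U ` X)"
      using XL r by (auto simp: U_def)
    ultimately obtain \<F> where "finite \<F>" "\<F> \<subseteq> U ` X" "X \<subseteq> \<Union> \<F>"
      using X unfolding compactin_def by metis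
    then obtain Y where Y: "finite Y" "Y \<subseteq> X" "X \<subseteq> \<Union> (U ` Y)"
      by (metis finite_subset_image)
    define N where "N = (topspace weak_L1 \<inter> (\<Inter>h\<in>Y. V h))"
    have "openin weak_L1 N"
      unfolding N_def
      using Y(1,2)
    proof (induction Y rule: finite_induct)
      case (insert h Y)
      have "openin weak_L1 (V h)"
        unfolding V_def using insert \<Phi>(1) by (intro openin_weak_L1_basic) auto
      moreover have "openin weak_L1 (topspace weak_L1 \<inter> (\<Inter>h\<in>Y. V h))" using insert by auto
      ultimately have "openin weak_L1 (V h \<inter> (topspace weak_L1 \<inter> (\<Inter>h\<in>Y. V h)))" by (rule openin_Int)
      then show ?case by (simp add: Int_left_commute)
    qed (use openin_topspace[of weak_L1] in simp)
    moreover have "g \<in> N" using g r Y by (auto simp: N_def V_def)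
    moreover have "N \<subseteq> topspace weak_L1 - weak_saturation X"
    proof
      fix f assume f: "f \<in> N"
      have "f \<notin> weak_saturation X"
      proof
        assume "f \<in> weak_saturation X"
        then obtain h' where h': "h' \<in> X" "\<And>\<phi>. \<phi> \<in> L1_dual \<Longrightarrow> \<phi> f = \<phi> h'"
          by (auto simp: weak_saturation_def)
        then obtain h where h: "h \<in> Y" "h' \<in> U h" using Y by blast
        have "\<Phi> h f = \<Phi> h h'"
          using h(1) \<Phi>(1) Y(2) by (intro h'(2)) blast
        then have "dist (\<Phi> h h) (\<Phi> h f) < r h"
          using h(2) by (simp add: U_def)
        moreover have "dist (\<Phi> h g) (\<Phi> h f) < r h"
          using f h by (auto simp: N_def V_def)
        ultimately show False
          using dist_triangle2[of "\<Phi> h g" "\<Phi> h h" "\<Phi> h f"] by (simp add: r_def)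
      qed
      then show "f \<in> topspace weak_L1 - weak_saturation X" using f by (simp add: N_def)
    qed
    ultimately show "\<exists>N. openin weak_L1 N \<and> g \<in> N \<and> N \<subseteq> topspace weak_L1 - weak_saturation X"
      by blast
  qed
qed

lemma relatively_weakly_compact_subset_saturation:
  assumes "compactin weak_L1 X" "F \<subseteq> weak_saturation X"
  shows "relatively_weakly_compact F"
proof -
  have "weak_L1 closure_of F \<subseteq> weak_saturation X"
    using assms by (intro closure_of_minimal closedin_weak_saturation)
  then have "compactin weak_L1 (weak_L1 closure_of F)"
    by (rule closed_compactin[OF compactin_weak_saturation[OF assms(1)] _ closedin_closure_of])
  then show ?thesis
    using assms by (auto simp: relatively_weakly_compact_def weak_saturation_def)
qed

subsection \<open>Limits of invariant densities\<close>

lemma antimono_uptoD: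
  assumes "s \<in> antimono_upto B"
  shows "antimono s" "0 \<le> s x" "s x \<le> B" "s \<in> borel_measurable unit_leb"
    "A \<in> sets unit_leb \<Longrightarrow> set_integrable unit_leb A s"
  using assms borel_measurable_antimono_unit_leb[of s]
  by (auto simp: antimono_upto_def intro!: set_integrable_bounded[where C = B])

lemma set_integral_antimono_upto_le:
  assumes s: "s \<in> antimono_upto B" and A: "A \<in> sets unit_leb"
  shows "(LINT x:A|unit_leb. s x) \<le> B * measure unit_leb A"
proof -
  have "(LINT x:A|unit_leb. s x) \<le> (LINT x|unit_leb. B * indicator A x)"
    unfolding set_lebesgue_integral_def
  proof (rule integral_mono)
    show "integrable unit_leb (\<lambda>x. indicator A x *\<^sub>R s x)"
      using antimono_uptoD(5)[OF s A] by (simp add: set_integrable_def)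
    show "integrable unit_leb (\<lambda>x. B * indicator A x)"
      using A by (intro integrable_mult_right integrable_unit_leb_indicator)
  qed (use antimono_uptoD[OF s] in \<open>simp add: indicator_def\<close>)
  also have "\<dots> = B * measure unit_leb A"
    using A by (simp add: sets_unit_leb_iff Int_absorb2)
  finally show ?thesis .
qed

lemma abs_set_integral_diff_le:
  assumes s: "s \<in> antimono_upto B" and sets: "A \<in> sets unit_leb" "A' \<in> sets unit_leb" "D \<in> sets unit_leb"
    and D: "A - A' \<subseteq> D" "A' - A \<subseteq> D"
  shows "\<bar>(LINT x:A|unit_leb. s x) - (LINT x:A'|unit_leb. s x)\<bar> \<le> (LINT x:D|unit_leb. s x)"
proof -
  note int = antimono_uptoD(5)[OF s, unfolded set_integrable_def]
  have "\<bar>(LINT x:A|unit_leb. s x) - (LINT x:A'|unit_leb. s x)\<bar> =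
      \<bar>LINT x|unit_leb. indicator A x *\<^sub>R s x - indicator A' x *\<^sub>R s x\<bar>"
    unfolding set_lebesgue_integral_def
    using int[OF sets(1)] int[OF sets(2)] by (subst Bochner_Integration.integral_diff) auto
  also have "\<dots> \<le> (LINT x|unit_leb. \<bar>indicator A x *\<^sub>R s x - indicator A' x *\<^sub>R s x\<bar>)"
    by (rule integral_abs_bound)
  also have "\<dots> \<le> (LINT x:D|unit_leb. s x)"
    unfolding set_lebesgue_integral_def
  proof (rule integral_mono)
    show "integrable unit_leb (\<lambda>x. \<bar>indicator A x *\<^sub>R s x - indicator A' x *\<^sub>R s x\<bar>)"
      using int[OF sets(1)] int[OF sets(2)] by (intro integrable_abs Bochner_Integration.integrable_diff)
    show "\<bar>indicator A x *\<^sub>R s x - indicator A' x *\<^sub>R s x\<bar> \<le> indicator D x *\<^sub>R s x" for x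
      using D antimono_uptoD(2)[OF s, of x] by (auto simp: indicator_def)
  qed (rule int[OF sets(3)])
  finally show ?thesis .
qed

lemma set_integral_cong_AE_unit_leb:
  fixes f g :: "real \<Rightarrow> real"
  assumes "f \<in> borel_measurable unit_leb" "g \<in> borel_measurable unit_leb" "A \<in> sets unit_leb"
    and "AE x in unit_leb. f x = g x"
  shows "(LINT x:A|unit_leb. f x) = (LINT x:A|unit_leb. g x)"
  unfolding set_lebesgue_integral_def
  using assms by (intro integral_cong_AE borel_measurable_scaleR borel_measurable_indicator) auto

context piecewise_convex begin

lemma vimage_\<tau>_sets: "A \<in> sets unit_leb \<Longrightarrow> \<tau> -` A \<inter> {0..1} \<in> sets unit_leb"
  using nonsingular_\<tau> measurable_sets[of \<tau> unit_leb unit_leb A] by (simp add: nonsingular_map_def)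

text \<open>The error has two sources. Moving y to a grid point changes the two integrals by O(1 /
  k), and replacing the approximating map by \<tau> affects only points of [0, a n), where the
  density is at most B.\<close>

lemma ulam_densities:
  obtains B C where "0 \<le> B"
    "\<And>n k f. 1 \<le> n \<Longrightarrow> 1 \<le> k \<Longrightarrow> ulam_invariant_density (approx_map \<tau> a n) k f \<Longrightarrow>
      \<exists>s\<in>antimono_upto B. (AE x in unit_leb. f x = s x) \<and>
        (\<forall>y. 0 \<le> y \<longrightarrow> y < 1 \<longrightarrow> \<bar>(LINT x:{0..<y}|unit_leb. f x) -
          (LINT x:(\<tau> -` {0..<y} \<inter> {0..1})|unit_leb. f x)\<bar> \<le> C / real k + B * a n)"
proof -
  obtain B where B: "0 \<le> B"
    "\<And>n s. 1 \<le> n \<Longrightarrow> antimono s \<Longrightarrow> (\<And>x. 0 \<le> s x) \<Longrightarrow> (\<And>x. s x \<le> s 0) \<Longrightarrow>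
      (LINT x|unit_leb. s x) = 1 \<Longrightarrow> s 0 \<le> (\<Sum>j\<le>n. s (left_end j) / left_slope n j) \<Longrightarrow> s 0 \<le> B"
    using density_bound by blast
  define R where "R = 2 * (\<Sum>j. 1 / d (Suc j))"
  show ?thesis
  proof (rule that[OF B(1), where C = "B + B * R"])
    fix n k :: nat and f assume n: "1 \<le> n" and k: "1 \<le> k"
      and f: "ulam_invariant_density (approx_map \<tau> a n) k f"
    let ?T = "approx_map \<tau> a n"
    obtain e where "finite_convex_branches ?T {..n} left_end (right_end n) (left_slope n) e"
      using approx_map_branches[OF n] .
    then interpret finite_convex_branches ?T "{..n}" left_end "right_end n" "left_slope n" e .
    obtain s where s: "antimono s" "\<And>x. 0 \<le> s x" "AE x in unit_leb. f x = s x"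
      "s 0 \<le> (\<Sum>i\<le>n. s (left_end i) / left_slope n i)" "\<And>x. s x \<le> s 0"
      "\<And>m. m < k \<Longrightarrow> (LINT x:{0..<real m / real k}|unit_leb. f x) =
        (LINT x:(?T -` {0..<real m / real k} \<inter> {0..1})|unit_leb. f x)"
      using ulam_invariant_density_step_function[OF k f] by blast
    have fm: "f \<in> borel_measurable unit_leb"
      using f by (auto simp: ulam_invariant_density_def ulam_space_def L1_def)
    have sm: "s \<in> borel_measurable unit_leb" by (rule borel_measurable_antimono_unit_leb[OF s(1)])
    have fs: "(LINT x:A|unit_leb. f x) = (LINT x:A|unit_leb. s x)" if "A \<in> sets unit_leb" for A
      using fm sm that s(3) by (rule set_integral_cong_AE_unit_leb)
    have "(LINT x|unit_leb. s x) = (LINT x|unit_leb. f x)"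
      using fm sm s(3) by (intro integral_cong_AE) auto
    then have int1: "(LINT x|unit_leb. s x) = 1" using f by (simp add: ulam_invariant_density_def)
    have "s 0 \<le> B" using B(2)[OF n s(1,2,5) int1 s(4)] .
    then have sB: "s \<in> antimono_upto B"
      using s(1,2) order_trans[OF s(5)] by (auto simp: antimono_upto_def)
    have "\<bar>(LINT x:{0..<y}|unit_leb. f x) - (LINT x:(\<tau> -` {0..<y} \<inter> {0..1})|unit_leb. f x)\<bar>
        \<le> (B + B * R) / real k + B * a n" if y: "0 \<le> y" "y < 1" for y
    proof -
      \<comment> \<open>z = m / k is the last grid point not above y; y < 1 ensures m < k, where
        exact invariance is available.\<close>
      define m where "m = nat \<lfloor>y * real k\<rfloor>"
      define z where "z = real m / real k"
      have "real m = of_int \<lfloor>y * real k\<rfloor>" using y by (simp add: m_def)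
      then have "real m \<le> y * real k" "y * real k < real m + 1" by linarith+
      then have z: "z \<le> y" "y \<le> z + 1 / real k" using k by (auto simp: z_def field_simps)
      have z0: "0 \<le> z" by (simp add: z_def)
      have "z < 1" using z y by simp
      then have mk: "m < k" using k by (simp add: z_def)
      let ?I = "\<lambda>A. LINT x:A|unit_leb. s x"
      let ?V = "\<lambda>y. ?T -` {0..<y} \<inter> {0..1}"
      have sets: "{0..<y} \<in> sets unit_leb" "{0..<z} \<in> sets unit_leb" "{z..y} \<in> sets unit_leb"
          "{0..a n} \<in> sets unit_leb"
        using y z z0 a_le_1[of n] by (auto simp: sets_unit_leb_iff)
      have V: "?V y \<in> sets unit_leb" for y by (rule vimage_sets) simp
      have W: "\<tau> -` {0..<y} \<inter> {0..1} \<in> sets unit_leb" by (rule vimage_\<tau>_sets[OF sets(1)])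
      have "\<bar>?I {0..<y} - ?I {0..<z}\<bar> \<le> ?I {z..y}"
        using z by (intro abs_set_integral_diff_le[OF sB] sets) auto
      also have "\<dots> \<le> B * measure unit_leb {z..y}"
        by (rule set_integral_antimono_upto_le[OF sB sets(3)])
      also have "\<dots> \<le> B * (1 / real k)"
        using z z0 y B(1) by (intro mult_left_mono) (auto simp: measure_unit_leb_Icc)
      finally have 1: "\<bar>?I {0..<y} - ?I {0..<z}\<bar> \<le> B / real k" by simp
      have 2: "?I {0..<z} = ?I (?V z)"
        using s(6)[OF mk] fs[OF sets(2)] fs[OF V] by (simp add: z_def)
      let ?D = "{x \<in> {0..1}. z \<le> ?T x \<and> ?T x \<le> z + 1 / real k}"
      have "\<bar>?I (?V z) - ?I (?V y)\<bar> \<le> ?I ?D"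
        using z by (intro abs_set_integral_diff_le[OF sB] V vimage_Icc_sets) auto
      also have "\<dots> \<le> 1 / real k * (\<Sum>i\<le>n. s (left_end i) / left_slope n i)"
        using s by (intro set_integral_vimage_le) auto
      also have "(\<Sum>i\<le>n. s (left_end i) / left_slope n i) \<le> (\<Sum>i\<le>n. B * (1 / left_slope n i))"
        using antimono_uptoD(3)[OF sB] d_pos by (intro sum_mono) (simp add: divide_right_mono less_imp_le)
      also have "\<dots> = B * (\<Sum>i\<le>n. 1 / left_slope n i)" by (simp add: sum_distrib_left)
      also have "\<dots> \<le> B * R"
        unfolding R_def using sum_inverse_left_slope_le B(1) by (intro mult_left_mono)
      finally have 3: "\<bar>?I (?V z) - ?I (?V y)\<bar> \<le> B * R / real k"
        by (simp add: divide_right_mono)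
      \<comment> \<open>The two maps agree from a n onwards, so the preimages differ inside [0, a n]
        only.\<close>
      have "\<bar>?I (?V y) - ?I (\<tau> -` {0..<y} \<inter> {0..1})\<bar> \<le> ?I {0..a n}"
        by (intro abs_set_integral_diff_le[OF sB] sets V W) (auto simp: approx_map_def split: if_splits)
      also have "\<dots> \<le> B * measure unit_leb {0..a n}"
        by (rule set_integral_antimono_upto_le[OF sB sets(4)])
      also have "\<dots> = B * a n" using a_nonneg[of n] a_le_1[of n] by (simp add: measure_unit_leb_Icc)
      finally have 4: "\<bar>?I (?V y) - ?I (\<tau> -` {0..<y} \<inter> {0..1})\<bar> \<le> B * a n" .
      have "\<bar>?I {0..<y} - ?I (\<tau> -` {0..<y} \<inter> {0..1})\<bar> \<le> B / real k + B * R / real k + B * a n"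
        using 1 2 3 4 by linarith
      then show ?thesis
        using fs[OF sets(1)] fs[OF W] by (simp add: add_divide_distrib)
    qed
    then show "\<exists>s\<in>antimono_upto B. (AE x in unit_leb. f x = s x) \<and>
        (\<forall>y. 0 \<le> y \<longrightarrow> y < 1 \<longrightarrow> \<bar>(LINT x:{0..<y}|unit_leb. f x) -
          (LINT x:(\<tau> -` {0..<y} \<inter> {0..1})|unit_leb. f x)\<bar> \<le> (B + B * R) / real k + B * a n)"
      using sB s(3) by blast
  qed
qed

end

lemma integral_antimono_Ico_bounds:
  assumes s: "s \<in> antimono_upto B" and xy: "0 \<le> x" "x \<le> y" "y \<le> 1"
  shows "(y - x) * s y \<le> (LINT t:{x..<y}|unit_leb. s t)" "(LINT t:{x..<y}|unit_leb. s t) \<le> (y - x) * s x"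
proof -
  have A: "{x..<y} \<in> sets unit_leb" "{x..<y} \<inter> {0..1} = {x..<y}" using xy by (auto simp: sets_unit_leb_iff)
  have const: "(LINT t|unit_leb. c * indicator {x..<y} t) = (y - x) * c" for c
    using A xy by (simp add: measure_unit_leb_Ico)
  have ic: "integrable unit_leb (\<lambda>t. c * indicator {x..<y} t)" for c :: real
    using A by (intro integrable_mult_right integrable_unit_leb_indicator)
  have int_s: "integrable unit_leb (\<lambda>t. indicator {x..<y} t *\<^sub>R s t)"
    using antimono_uptoD(5)[OF s A(1)] by (simp add: set_integrable_def)
  have anti: "antimono s" by (rule antimono_uptoD(1)[OF s])
  show "(y - x) * s y \<le> (LINT t:{x..<y}|unit_leb. s t)"
    unfolding set_lebesgue_integral_def const[symmetric]
    using antimonoD[OF anti] by (intro integral_mono ic int_s) (auto simp: indicator_def)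
  show "(LINT t:{x..<y}|unit_leb. s t) \<le> (y - x) * s x"
    unfolding set_lebesgue_integral_def const[symmetric]
    using antimonoD[OF anti] by (intro integral_mono ic int_s) (auto simp: indicator_def)
qed

text \<open>The value s j x is at most the mean of s j over an interval ending at x. These means
  converge to the mean of h, which is at most h at the left end, hence close to h x. Intervals
  starting at x give the lower bound.\<close>

lemma tendsto_antimono_at_continuity_point:
  assumes s: "\<And>j. s j \<in> antimono_upto B" and h: "h \<in> antimono_upto B"
    and int: "\<And>x y. 0 \<le> x \<Longrightarrow> x \<le> y \<Longrightarrow> y \<le> 1 \<Longrightarrow>
      (\<lambda>j. LINT t:{x..<y}|unit_leb. s j t) \<longlonglongrightarrow> (LINT t:{x..<y}|unit_leb. h t)"
    and x: "0 < x" "x < 1" and cont: "isCont h x"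
  shows "(\<lambda>j. s j x) \<longlonglongrightarrow> h x"
proof (rule order_tendstoI)
  have ev: "eventually (\<lambda>\<delta>. P (x + \<delta>) \<and> P (x - \<delta>) \<and> x + \<delta> < 1 \<and> 0 < x - \<delta> \<and> 0 < \<delta>) (at_right 0)"
    if "eventually P (nhds x)" for P
  proof -
    have 1: "((\<lambda>\<delta>. x + \<delta>) \<longlongrightarrow> x) (at_right 0)" by (auto intro!: tendsto_eq_intros)
    have 2: "((\<lambda>\<delta>. x - \<delta>) \<longlongrightarrow> x) (at_right 0)" by (auto intro!: tendsto_eq_intros)
    show ?thesis
      using eventually_compose_filterlim[OF that 1] eventually_compose_filterlim[OF that 2]
        order_tendstoD(2)[OF 1 x(2)] order_tendstoD(1)[OF 2 x(1)] eventually_at_right_less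
      by eventually_elim simp
  qed
  have nh: "(h \<longlongrightarrow> h x) (nhds x)" using cont by (simp add: isCont_def tendsto_nhds_iff)
  have at0: "\<exists>\<delta>. P \<delta>" if "eventually P (at_right (0::real))" for P
    using eventually_happens[OF that] by auto
  {
    fix u assume u: "h x < u"
    obtain \<delta> where \<delta>: "h (x - \<delta>) < u" "0 < x - \<delta>" "0 < \<delta>"
      using at0[OF ev[OF order_tendstoD(2)[OF nh u]]] by blast
    have "(LINT t:{x - \<delta>..<x}|unit_leb. h t) \<le> (x - (x - \<delta>)) * h (x - \<delta>)"
      using \<delta> x by (intro integral_antimono_Ico_bounds[OF h]) auto
    also have "\<dots> < \<delta> * u" using \<delta> by simp
    finally have "eventually (\<lambda>j. (LINT t:{x - \<delta>..<x}|unit_leb. s j t) < \<delta> * u) sequentially"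
      using \<delta> x by (intro order_tendstoD(2)[OF int]) auto
    then show "eventually (\<lambda>j. s j x < u) sequentially"
    proof eventually_elim
      case (elim j)
      have "(x - (x - \<delta>)) * s j x \<le> (LINT t:{x - \<delta>..<x}|unit_leb. s j t)"
        using \<delta> x by (intro integral_antimono_Ico_bounds[OF s]) auto
      with elim have "\<delta> * s j x < \<delta> * u" by simp
      then show ?case using \<delta>(3) by simp
    qed
  next
    fix l assume l: "l < h x"
    obtain \<delta> where \<delta>: "l < h (x + \<delta>)" "x + \<delta> < 1" "0 < \<delta>"
      using at0[OF ev[OF order_tendstoD(1)[OF nh l]]] by blast
    have "\<delta> * l < (x + \<delta> - x) * h (x + \<delta>)" using \<delta> by simp
    also have "\<dots> \<le> (LINT t:{x..<x + \<delta>}|unit_leb. h t)"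
      using \<delta> x by (intro integral_antimono_Ico_bounds[OF h]) auto
    finally have "eventually (\<lambda>j. \<delta> * l < (LINT t:{x..<x + \<delta>}|unit_leb. s j t)) sequentially"
      using \<delta> x by (intro order_tendstoD(1)[OF int]) auto
    then show "eventually (\<lambda>j. l < s j x) sequentially"
    proof eventually_elim
      case (elim j)
      have "(LINT t:{x..<x + \<delta>}|unit_leb. s j t) \<le> (x + \<delta> - x) * s j x"
        using \<delta> x by (intro integral_antimono_Ico_bounds[OF s]) auto
      with elim have "\<delta> * l < \<delta> * s j x" by simp
      then show ?case using \<delta>(3) by simp
    qed
  }
qed

lemma AE_isCont_antimono:
  fixes h :: "real \<Rightarrow> real"
  assumes "antimono h"
  shows "AE x in unit_leb. 0 < x \<and> x < 1 \<and> isCont h x"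
proof -
  have "mono (\<lambda>x. - h x)" using assms by (auto simp: mono_def antimono_def)
  then have "countable {x. \<not> isCont (\<lambda>x. - h x) x}" by (rule mono_ctble_discont)
  moreover have "isCont (\<lambda>x. - h x) x \<longleftrightarrow> isCont h x" for x
    using isCont_minus[of x h] isCont_minus[of x "\<lambda>x. - h x"] by auto
  ultimately have "countable ({0, 1} \<union> {x. \<not> isCont h x})" by simp
  then have "negligible ({0, 1} \<union> {x. \<not> isCont h x})"
    unfolding negligible_iff_null_sets by (intro null_sets_completionI countable_imp_null_set_lborel)
  then have "({0, 1} \<union> {x. \<not> isCont h x}) \<inter> {0..1} \<in> null_sets unit_leb"
    by (simp add: null_sets_unit_leb_iff negligible_Int)
  from AE_not_in[OF this] AE_space show ?thesis
    by eventually_elim auto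
qed

text \<open>A pi-lambda argument for the integral of the difference, which may change sign.
  Half-lines generate the Borel sets, and the equal total integrals serve complements.\<close>

lemma AE_eq_if_integrals_Ico_eq:
  assumes u: "u \<in> L1" and v: "v \<in> L1"
    and eq: "\<And>y. 0 \<le> y \<Longrightarrow> y < 1 \<Longrightarrow> (LINT x:{0..<y}|unit_leb. u x) = (LINT x:{0..<y}|unit_leb. v x)"
    and eq1: "(LINT x|unit_leb. u x) = (LINT x|unit_leb. v x)"
  shows "AE x in unit_leb. u x = v x"
proof -
  define w where "w = (\<lambda>x. u x - v x)"
  have uv: "integrable unit_leb u" "integrable unit_leb v" using u v by (simp_all add: L1_def)
  then have w: "integrable unit_leb w" by (simp add: w_def)
  have si: "set_integrable unit_leb A f" if "integrable unit_leb f" "A \<in> sets unit_leb" for A and f :: "real \<Rightarrow> real"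
    unfolding set_integrable_def using that by (intro integrable_mult_indicator)
  have Iw: "(LINT x:A|unit_leb. w x) = (LINT x:A|unit_leb. u x) - (LINT x:A|unit_leb. v x)"
    if "A \<in> sets unit_leb" for A
    unfolding w_def by (intro set_integral_diff(2) si uv that)
  have wm: "w \<in> borel_measurable unit_leb" using w by simp
  have AE_set: "(LINT x:A|unit_leb. w x) = (LINT x:A'|unit_leb. w x)"
    if "A \<in> sets unit_leb" "A' \<in> sets unit_leb" "AE x in unit_leb. x \<in> A \<longleftrightarrow> x \<in> A'" for A A'
    unfolding set_lebesgue_integral_def
  proof (rule integral_cong_AE)
    show "AE x in unit_leb. indicator A x *\<^sub>R w x = indicator A' x *\<^sub>R w x"
      using that(3) by eventually_elim (simp add: indicator_def)
  qed (use that(1,2) wm in \<open>intro borel_measurable_scaleR borel_measurable_indicator; simp\<close>)+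
  have top: "{0..1} \<in> sets unit_leb" by (simp add: sets_unit_leb_iff)
  have whole: "(LINT x:{0..1}|unit_leb. w x) = 0"
  proof -
    have "(LINT x:{0..1}|unit_leb. f x) = (LINT x|unit_leb. f x)" for f :: "real \<Rightarrow> real"
      unfolding set_lebesgue_integral_def by (intro Bochner_Integration.integral_cong) auto
    then show ?thesis using Iw[OF top] eq1 by simp
  qed
  have borel_sets: "A \<inter> {0..1} \<in> sets unit_leb" if "A \<in> sets borel" for A
    using that by (auto simp: sets_unit_leb_iff)
  have borel0: "(LINT x:(A \<inter> {0..1})|unit_leb. w x) = 0" if "A \<in> sets borel" for A
  proof -
    have gen: "sets borel = sigma_sets UNIV (range (\<lambda>y::real. {..<y}))"
      by (subst borel_Iio) simp
    have "Int_stable (range (\<lambda>y::real. {..<y}))"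
      by (auto simp: Int_stable_def lessThan_def Int_def min_less_iff_conj[symmetric] simp del: min_less_iff_conj)
    moreover have "range (\<lambda>y::real. {..<y}) \<subseteq> Pow UNIV" by simp
    ultimately show ?thesis
      using that[unfolded gen]
    proof (induction rule: sigma_sets_induct_disjoint)
      case (basic A)
      then obtain y :: real where A: "A = {..<y}" by blast
      consider "y \<le> 0" | "0 < y" "y < 1" | "1 \<le> y" by linarith
      then show ?case
      proof cases
        case 1
        then have "A \<inter> {0..1} = {}" by (auto simp: A)
        then show ?thesis by (simp add: set_lebesgue_integral_def)
      next
        case 2
        then have "A \<inter> {0..1} = {0..<y}" by (auto simp: A)
        moreover have "{0..<y} \<in> sets unit_leb" using 2 by (auto simp: sets_unit_leb_iff)
        ultimately show ?thesis using Iw[of "{0..<y}"] eq[of y] 2 by simp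
      next
        case 3
        \<comment> \<open>For y = 1 the half-line misses the point 1, a null set.\<close>
        have "(LINT x:(A \<inter> {0..1})|unit_leb. w x) = (LINT x:{0..1}|unit_leb. w x)"
        proof (rule AE_set[OF borel_sets top])
          have "AE x in unit_leb. x \<notin> {1}"
            by (intro AE_not_in) (simp add: null_sets_unit_leb_iff)
          then show "AE x in unit_leb. x \<in> A \<inter> {0..1} \<longleftrightarrow> x \<in> {0..1}"
            by eventually_elim (use 3 in \<open>auto simp: A\<close>)
        qed (simp add: A)
        then show ?thesis using whole by simp
      qed
    next
      case empty
      then show ?case by (simp add: set_lebesgue_integral_def)
    next
      case (compl A)
      then have A: "A \<in> sets borel" by (simp add: gen)
      have "(LINT x:(A \<inter> {0..1}) \<union> ((UNIV - A) \<inter> {0..1})|unit_leb. w x) =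
          (LINT x:(A \<inter> {0..1})|unit_leb. w x) + (LINT x:((UNIV - A) \<inter> {0..1})|unit_leb. w x)"
        using A by (intro set_integral_Un si w borel_sets) auto
      moreover have "(A \<inter> {0..1}) \<union> ((UNIV - A) \<inter> {0..1}) = {0..1}" by blast
      ultimately show ?case using whole compl by simp
    next
      case (union F)
      then have F: "F i \<in> sets borel" for i by (auto simp: gen)
      then have UF: "(\<Union>i. F i) \<inter> {0..1} \<in> sets unit_leb" by (intro borel_sets) auto
      have "(LINT x:(\<Union>i. F i \<inter> {0..1})|unit_leb. w x) = (\<Sum>i. LINT x:(F i \<inter> {0..1})|unit_leb. w x)"
      proof (rule lebesgue_integral_countable_add)
        show "set_integrable unit_leb (\<Union>i. F i \<inter> {0..1}) w"
          using si[OF w UF] by simp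
        show "F i \<inter> {0..1} \<inter> (F j \<inter> {0..1}) = {}" if "i \<noteq> j" for i j
          using union(1) that by (auto simp: disjoint_family_on_def)
      qed (rule borel_sets[OF F])
      then show ?case using union by simp
    qed
  qed
  \<comment> \<open>A Lebesgue set agrees with a Borel set up to a null set.\<close>
  have "(LINT x:A|unit_leb. w x) = 0" if A: "A \<in> sets unit_leb" for A
  proof -
    have A': "A \<subseteq> {0..1}" "A \<in> sets lebesgue" using A by (simp_all add: sets_unit_leb_iff)
    obtain S N N' where SN: "A = S \<union> N" "N \<subseteq> N'" "N' \<in> null_sets lborel" "S \<in> sets lborel"
      by (rule sets_completionE[OF A'(2)])
    have "N' \<inter> {0..1} \<in> null_sets unit_leb"
      using null_sets_completionI[OF SN(3)] by (simp add: null_sets_unit_leb_iff negligible_iff_null_sets[symmetric] negligible_Int)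
    from AE_not_in[OF this] AE_space have "AE x in unit_leb. x \<in> A \<longleftrightarrow> x \<in> S \<inter> {0..1}"
      by eventually_elim (use SN in auto)
    then have "(LINT x:A|unit_leb. w x) = (LINT x:(S \<inter> {0..1})|unit_leb. w x)"
      using A borel_sets[of S] SN(4) by (intro AE_set) auto
    then show ?thesis using borel0[of S] SN(4) by simp
  qed
  then show ?thesis
    using Iw uv by (intro density_unique_real) auto
qed

text \<open>The closed saturation contains the weak limit and so provides a decreasing version h of
  it. Convergence at the continuity points of h is convergence almost everywhere, and the common
  bound B gives convergence in norm.\<close>

lemma weak_limit_of_antimono:
  assumes fL: "\<And>j. f j \<in> L1" and s: "\<And>j. s j \<in> antimono_upto B"
    and fs: "\<And>j. AE x in unit_leb. f j x = s j x"
    and lim: "limitin weak_L1 f g sequentially"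
  shows "(\<lambda>j. L1_norm (\<lambda>x. f j x - g x)) \<longlonglongrightarrow> 0" "AE x in unit_leb. (\<lambda>j. f j x) \<longlonglongrightarrow> g x"
proof -
  have gL: "g \<in> L1" using limitin_topspace[OF lim] by simp
  have sL: "s j \<in> L1" for j using antimono_upto_L1[OF s] .
  have sat: "f j \<in> weak_saturation (antimono_upto B)" for j
    using fL s L1_dual_AE_eq[OF _ fL sL fs] unfolding weak_saturation_def by blast
  have "g \<in> weak_saturation (antimono_upto B)"
    by (rule limitin_closedin[OF lim closedin_weak_saturation[OF compactin_weak_L1_antimono_upto]])
      (use sat in auto)
  then obtain h where h: "h \<in> antimono_upto B" "\<And>\<phi>. \<phi> \<in> L1_dual \<Longrightarrow> \<phi> g = \<phi> h"
    by (auto simp: weak_saturation_def)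
  have hL: "h \<in> L1" by (rule antimono_upto_L1[OF h(1)])
  \<comment> \<open>Integrals over measurable sets are among the functionals that agree on g and
    h.\<close>
  have gh: "AE x in unit_leb. g x = h x"
    using gL hL h(2)[OF set_integral_in_L1_dual] by (intro density_unique_real) (auto simp: L1_def)
  have int: "(\<lambda>j. LINT t:{x..<y}|unit_leb. s j t) \<longlonglongrightarrow> (LINT t:{x..<y}|unit_leb. h t)"
    if xy: "0 \<le> x" "x \<le> y" "y \<le> 1" for x y
  proof -
    have "{x..<y} \<in> sets unit_leb" using xy by (auto simp: sets_unit_leb_iff)
    note \<phi> = set_integral_in_L1_dual[OF this]
    show ?thesis
      using limitin_weak_L1_dual[OF lim \<phi>] L1_dual_AE_eq[OF \<phi> fL sL fs] h(2)[OF \<phi>] by simp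
  qed
  have "AE x in unit_leb. \<forall>j. f j x = s j x" using fs by (simp add: AE_all_countable)
  with AE_isCont_antimono[OF antimono_uptoD(1)[OF h(1)]] gh
  show conv: "AE x in unit_leb. (\<lambda>j. f j x) \<longlonglongrightarrow> g x"
  proof eventually_elim
    case (elim x)
    then show ?case using tendsto_antimono_at_continuity_point[OF s h(1) int, of x] by simp
  qed
  have "(\<lambda>j. LINT x|unit_leb. \<bar>f j x - g x\<bar>) \<longlonglongrightarrow> (LINT x|unit_leb. 0)"
  proof (rule integral_dominated_convergence[where w = "\<lambda>_. B"])
    show "(\<lambda>x. \<bar>f j x - g x\<bar>) \<in> borel_measurable unit_leb" for j
      using fL[of j] gL by (auto simp: L1_def)
    show "AE x in unit_leb. (\<lambda>j. \<bar>f j x - g x\<bar>) \<longlonglongrightarrow> 0"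
      using conv by eventually_elim (auto intro!: tendsto_eq_intros)
    show "AE x in unit_leb. norm \<bar>f j x - g x\<bar> \<le> B" for j
      using fs[of j] gh
    proof eventually_elim
      case (elim x)
      then show ?case using antimono_uptoD(2,3)[OF s[of j], of x] antimono_uptoD(2,3)[OF h(1), of x] by (simp add: abs_le_iff)
    qed
  qed auto
  then show "(\<lambda>j. L1_norm (\<lambda>x. f j x - g x)) \<longlonglongrightarrow> 0" by (simp add: L1_norm_def)
qed

text \<open>For each y both integrals are weakly continuous in the density, so the vanishing of
  their difference passes to the limit.\<close>

lemma (in piecewise_convex) weak_limit_invariant:
  assumes lim: "limitin weak_L1 f g sequentially"
    and err: "\<And>y. 0 \<le> y \<Longrightarrow> y < 1 \<Longrightarrow> (\<lambda>j. (LINT x:{0..<y}|unit_leb. f j x) -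
          (LINT x:(\<tau> -` {0..<y} \<inter> {0..1})|unit_leb. f j x)) \<longlonglongrightarrow> 0"
  shows "AE x in unit_leb. frobenius_perron \<tau> g x = g x"
proof -
  have gL: "g \<in> L1" using limitin_topspace[OF lim] by simp
  let ?P = "frobenius_perron \<tau> g"
  have P: "is_frobenius_perron_image \<tau> g ?P"
    by (rule is_frobenius_perron_image_frobenius_perron[OF nonsingular_\<tau> gL])
  then have PL: "?P \<in> L1" by (simp add: is_frobenius_perron_image_def)
  show ?thesis
  proof (rule AE_eq_if_integrals_Ico_eq[OF PL gL])
    fix y :: real assume y: "0 \<le> y" "y < 1"
    have A: "{0..<y} \<in> sets unit_leb" using y by (auto simp: sets_unit_leb_iff)
    let ?A' = "\<tau> -` {0..<y} \<inter> {0..1}"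
    have "(\<lambda>j. (LINT x:{0..<y}|unit_leb. f j x) - (LINT x:?A'|unit_leb. f j x)) \<longlonglongrightarrow>
        (LINT x:{0..<y}|unit_leb. g x) - (LINT x:?A'|unit_leb. g x)"
      using limitin_weak_L1_dual[OF lim set_integral_in_L1_dual[OF A]]
        limitin_weak_L1_dual[OF lim set_integral_in_L1_dual[OF vimage_\<tau>_sets[OF A]]]
      by (rule tendsto_diff)
    then have "(LINT x:{0..<y}|unit_leb. g x) - (LINT x:?A'|unit_leb. g x) = 0"
      using err[OF y] by (rule LIMSEQ_unique)
    then show "(LINT x:{0..<y}|unit_leb. ?P x) = (LINT x:{0..<y}|unit_leb. g x)"
      using P A by (simp add: is_frobenius_perron_image_def)
  next
    have top: "{0..1} \<in> sets unit_leb" by (simp add: sets_unit_leb_iff)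
    \<comment> \<open>The total integral is preserved because \<tau> maps the unit interval into
      itself.\<close>
    have "\<tau> -` {0..1} \<inter> {0..1} = {0..1}" using \<tau>_maps by blast
    then have "(LINT x:{0..1}|unit_leb. ?P x) = (LINT x:{0..1}|unit_leb. g x)"
      using P top unfolding is_frobenius_perron_image_def by metis
    moreover have "(LINT x:{0..1}|unit_leb. u x) = (LINT x|unit_leb. u x)" for u :: "real \<Rightarrow> real"
      unfolding set_lebesgue_integral_def by (intro Bochner_Integration.integral_cong) auto
    ultimately show "(LINT x|unit_leb. ?P x) = (LINT x|unit_leb. g x)" by simp
  qed
qed

theorem theorem5:
  fixes \<tau> :: "real \<Rightarrow> real" and a :: "nat \<Rightarrow> real" and f :: "nat \<Rightarrow> nat \<Rightarrow> real \<Rightarrow> real"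
  assumes "piecewise_convex_map \<tau> a"
    and "\<And>n k. 1 \<le> n \<Longrightarrow> 1 \<le> k \<Longrightarrow> ulam_invariant_density (approx_map \<tau> a n) k (f n k)"
  shows "relatively_weakly_compact {f n k | n k. 1 \<le> n \<and> 1 \<le> k} \<and>
    (\<exists>B. \<forall>n\<ge>1. \<forall>k\<ge>1. AE x in unit_leb. \<bar>f n k x\<bar> \<le> B) \<and>
    (\<forall>(\<nu> :: nat \<Rightarrow> nat) (\<kappa> :: nat \<Rightarrow> nat) g.
       (\<forall>j. 1 \<le> \<nu> j \<and> 1 \<le> \<kappa> j) \<longrightarrow>
       filterlim \<nu> at_top sequentially \<longrightarrow> filterlim \<kappa> at_top sequentially \<longrightarrow>
       limitin weak_L1 (\<lambda>j. f (\<nu> j) (\<kappa> j)) g sequentially \<longrightarrow>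
         (\<lambda>j. L1_norm (\<lambda>x. f (\<nu> j) (\<kappa> j) x - g x)) \<longlonglongrightarrow> 0 \<and>
         (AE x in unit_leb. (\<lambda>j. f (\<nu> j) (\<kappa> j) x) \<longlonglongrightarrow> g x) \<and>
         (AE x in unit_leb. frobenius_perron \<tau> g x = g x))"
proof -
  obtain d where d: "\<forall>j\<ge>1. (\<tau> has_real_derivative d j) (at_right (a j)) \<and> 0 < d j"
    "summable (\<lambda>j. 1 / d (Suc j))"
    using assms(1) unfolding piecewise_convex_map_def by blast
  interpret piecewise_convex \<tau> a d
    using assms(1) d by unfold_locales auto
  obtain B C where "0 \<le> B" and BC:
    "\<And>n k f. 1 \<le> n \<Longrightarrow> 1 \<le> k \<Longrightarrow> ulam_invariant_density (approx_map \<tau> a n) k f \<Longrightarrow>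
      \<exists>s\<in>antimono_upto B. (AE x in unit_leb. f x = s x) \<and>
        (\<forall>y. 0 \<le> y \<longrightarrow> y < 1 \<longrightarrow> \<bar>(LINT x:{0..<y}|unit_leb. f x) -
          (LINT x:(\<tau> -` {0..<y} \<inter> {0..1})|unit_leb. f x)\<bar> \<le> C / real k + B * a n)"
    using ulam_densities by blast
  \<comment> \<open>The decreasing versions are selected for all n and k at once, so that a sequence
    of them is at hand below.\<close>
  have "\<forall>n k. \<exists>s. 1 \<le> n \<longrightarrow> 1 \<le> k \<longrightarrow> s \<in> antimono_upto B \<and> (AE x in unit_leb. f n k x = s x) \<and>
        (\<forall>y. 0 \<le> y \<longrightarrow> y < 1 \<longrightarrow> \<bar>(LINT x:{0..<y}|unit_leb. f n k x) -
          (LINT x:(\<tau> -` {0..<y} \<inter> {0..1})|unit_leb. f n k x)\<bar> \<le> C / real k + B * a n)"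
    using BC[OF _ _ assms(2)] by blast
  then obtain s where s: "\<And>n k. 1 \<le> n \<Longrightarrow> 1 \<le> k \<Longrightarrow> s n k \<in> antimono_upto B"
    and fs: "\<And>n k. 1 \<le> n \<Longrightarrow> 1 \<le> k \<Longrightarrow> AE x in unit_leb. f n k x = s n k x"
    and err: "\<And>n k y. 1 \<le> n \<Longrightarrow> 1 \<le> k \<Longrightarrow> 0 \<le> y \<Longrightarrow> y < 1 \<Longrightarrow>
        \<bar>(LINT x:{0..<y}|unit_leb. f n k x) - (LINT x:(\<tau> -` {0..<y} \<inter> {0..1})|unit_leb. f n k x)\<bar>
          \<le> C / real k + B * a n"
    by (simp only: choice_iff) blast
  have fL: "f n k \<in> L1" if "1 \<le> n" "1 \<le> k" for n k
    using assms(2)[OF that] by (simp add: ulam_invariant_density_def ulam_space_def)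
  show ?thesis
  proof (intro conjI allI impI)
    show "relatively_weakly_compact {f n k | n k. 1 \<le> n \<and> 1 \<le> k}"
    proof (rule relatively_weakly_compact_subset_saturation[OF compactin_weak_L1_antimono_upto])
      \<comment> \<open>\<open>f n k\<close> is only almost everywhere equal to a decreasing
        function, hence a member of the saturation.\<close>
      have "f n k \<in> weak_saturation (antimono_upto B)" if nk: "1 \<le> n" "1 \<le> k" for n k
        using fL[OF nk] s[OF nk] L1_dual_AE_eq[OF _ fL[OF nk] antimono_upto_L1[OF s[OF nk]] fs[OF nk]]
        unfolding weak_saturation_def by blast
      then show "{f n k | n k. 1 \<le> n \<and> 1 \<le> k} \<subseteq> weak_saturation (antimono_upto B)" by blast
    qed
    have "AE x in unit_leb. \<bar>f n k x\<bar> \<le> B" if nk: "1 \<le> n" "1 \<le> k" for n k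
      using fs[OF nk] by eventually_elim (use antimono_uptoD(2,3)[OF s[OF nk]] in simp)
    then show "\<exists>B. \<forall>n\<ge>1. \<forall>k\<ge>1. AE x in unit_leb. \<bar>f n k x\<bar> \<le> B" by blast
  next
    fix \<nu> \<kappa> :: "nat \<Rightarrow> nat" and g
    assume ge1: "\<forall>j. 1 \<le> \<nu> j \<and> 1 \<le> \<kappa> j" and \<nu>: "filterlim \<nu> at_top sequentially"
      and \<kappa>: "filterlim \<kappa> at_top sequentially"
      and lim: "limitin weak_L1 (\<lambda>j. f (\<nu> j) (\<kappa> j)) g sequentially"
    from ge1 have ge: "1 \<le> \<nu> j" "1 \<le> \<kappa> j" for j by auto
    note weak_limit_of_antimono[of "\<lambda>j. f (\<nu> j) (\<kappa> j)" "\<lambda>j. s (\<nu> j) (\<kappa> j)", OF fL[OF ge] s[OF ge] fs[OF ge] lim]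
    then show "(\<lambda>j. L1_norm (\<lambda>x. f (\<nu> j) (\<kappa> j) x - g x)) \<longlonglongrightarrow> 0"
      "AE x in unit_leb. (\<lambda>j. f (\<nu> j) (\<kappa> j) x) \<longlonglongrightarrow> g x" .
    show "AE x in unit_leb. frobenius_perron \<tau> g x = g x"
    proof (rule weak_limit_invariant[OF lim])
      fix y :: real assume y: "0 \<le> y" "y < 1"
      have "(\<lambda>j. C / real (\<kappa> j)) \<longlonglongrightarrow> 0"
        using filterlim_compose[OF filterlim_real_sequentially \<kappa>]
        by (intro real_tendsto_divide_at_top[OF tendsto_const])
      moreover have "(\<lambda>j. B * a (\<nu> j)) \<longlonglongrightarrow> B * 0"
        by (intro tendsto_mult tendsto_const filterlim_compose[OF a_lim \<nu>])
      ultimately have "(\<lambda>j. C / real (\<kappa> j) + B * a (\<nu> j)) \<longlonglongrightarrow> 0"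
        using tendsto_add by fastforce
      then show "(\<lambda>j. (LINT x:{0..<y}|unit_leb. f (\<nu> j) (\<kappa> j) x) -
          (LINT x:(\<tau> -` {0..<y} \<inter> {0..1})|unit_leb. f (\<nu> j) (\<kappa> j) x)) \<longlonglongrightarrow> 0"
        by (rule Lim_null_comparison[rotated]) (use err[OF ge y] in simp)
    qed
  qed
qed

end
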